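(* Let $h:\mathbb{R}\to\mathbb{R}$ be a measurable function with $\mathbb{E}|h(X)|<\infty$, where $X\sim\mathrm{VG}_2(\nu,1,\beta,0)$, and $\nu>-1/2$ and $-1<\beta<1$. Write $\widetilde{\mathrm{VG}}^{\nu,1}_{\beta,0}h=\mathbb{E}h(X)$. Then a solution $f:\mathbb{R}\to\mathbb{R}$ to the Variance-Gamma Stein equation $$xf''(x)+(2\nu+1+2\beta x)f'(x)+((2\nu+1)\beta-(1-\beta^2)x)f(x)=h(x)-\widetilde{\mathrm{VG}}^{\nu,1}_{\beta,0}h$$ is given by $$f(x)=-\frac{e^{-\beta x}K_\nu(|x|)}{|x|^\nu}\int_0^xe^{\beta y}|y|^\nu I_\nu(|y|)\left[h(y)-\widetilde{\mathrm{VG}}^{\nu,1}_{\beta,0}h\right]dy-\frac{e^{-\beta x}I_\nu(|x|)}{|x|^\nu}\int_x^\infty e^{\beta y}|y|^\nu K_\nu(|y|)\left[h(y)-\widetilde{\mathrm{VG}}^{\nu,1}_{\beta,0}h\right]dy.$$ Suppose further that $h$ is bounded. Then $f(x)$ and $f'(x)$ are bounded for all $x\in\mathbb{R}$. Moreover, this is the unique bounded solution when $\nu\ge0$ and $-1<\beta<1$.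
   Context: $I_\nu$ and $K_\nu$ are the modified Bessel functions of the first and second kind. $\mathrm{VG}_2(\nu,1,\beta,0)$ is the distribution on $\mathbb{R}$ with density $$\frac{(1-\beta^2)^{\nu+1/2}}{\sqrt\pi\,\Gamma(\nu+\frac12)}\left(\frac{|x|}2\right)^\nu e^{\beta x}K_\nu(|x|).$$
   Formalization: For merely measurable h the equation cannot hold at every x and f'(0) may not exist; so the equation is asserted for almost every x and wherever h is continuous, f' is bounded wherever it exists (all x≠0), f(0) is the limit of the formula, and uniqueness is in this class of solutions. *)

theory Defs
  imports "HOL-Probability.Probability"
begin

(* Modified Bessel functions of real order; both definitions are meant for x > 0 only, and their
   values at x = 0 are junk (bessel_I 0 0 = 0 because 0 powr 0 = 0).  The reciprocal Gamma
   function rGamma encodes the convention 1 / Gamma (-n) = 0. *)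

definition bessel_I :: "real \<Rightarrow> real \<Rightarrow> real" where
  "bessel_I \<nu> x =
     (\<Sum>k. rGamma (\<nu> + real k + 1) / fact k * (x / 2) powr (\<nu> + 2 * real k))"

definition bessel_K :: "real \<Rightarrow> real \<Rightarrow> real" where
  "bessel_K \<nu> x = (LBINT t:{0..}. exp (- x * cosh t) * cosh (\<nu> * t))"

definition vg2_density :: "real \<Rightarrow> real \<Rightarrow> real \<Rightarrow> real" where
  "vg2_density \<nu> \<beta> x =
     (1 - \<beta>\<^sup>2) powr (\<nu> + 1/2) / (sqrt pi * Gamma (\<nu> + 1/2))
       * (\<bar>x\<bar> / 2) powr \<nu> * exp (\<beta> * x) * bessel_K \<nu> \<bar>x\<bar>"

(* The equation at the single point x, with deriv u and deriv (deriv u) for u' and u''.  At x = 0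
   the second-order term drops out, whether or not u''(0) exists. *)

definition vg_stein_eq_at ::
  "real \<Rightarrow> real \<Rightarrow> (real \<Rightarrow> real) \<Rightarrow> real \<Rightarrow> (real \<Rightarrow> real) \<Rightarrow> real \<Rightarrow> bool" where
  "vg_stein_eq_at \<nu> \<beta> h c u x \<longleftrightarrow>
     x * deriv (deriv u) x + (2 * \<nu> + 1 + 2 * \<beta> * x) * deriv u x
       + ((2 * \<nu> + 1) * \<beta> - (1 - \<beta>\<^sup>2) * x) * u x = h x - c"

(* Since h is only measurable, u'' exists only almost everywhere, and u'(0) need not exist (if h
   jumps at the singular point 0, then u'(0+) and u'(0-) differ).  So a solution is meant in the
   sense of Caratheodory, as for every second-order linear equation with a measurable right-hand
   side: u is continuous on the real line and differentiable off 0, u' is absolutely continuous on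
   every compact interval avoiding 0 (third and fourth clause: u'' exists almost everywhere, is
   Lebesgue integrable on {a..b} and integrates back to u'), and the equation holds almost
   everywhere. *)

definition vg_stein_solution ::
  "real \<Rightarrow> real \<Rightarrow> (real \<Rightarrow> real) \<Rightarrow> real \<Rightarrow> (real \<Rightarrow> real) \<Rightarrow> bool" where
  "vg_stein_solution \<nu> \<beta> h c u \<longleftrightarrow>
     continuous_on UNIV u \<and>
     (\<forall>x. x \<noteq> 0 \<longrightarrow> u differentiable (at x)) \<and>
     (AE x in lborel. deriv u differentiable (at x)) \<and>
     (\<forall>a b. a \<le> b \<and> 0 \<notin> {a..b} \<longrightarrow>
        deriv (deriv u) absolutely_integrable_on {a..b} \<and>
        integral {a..b} (deriv (deriv u)) = deriv u b - deriv u a) \<and>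
     (AE x in lborel. vg_stein_eq_at \<nu> \<beta> h c u x)"

(* The right-hand side of the explicit solution, for x \<noteq> 0.  The interval integrals are
   oriented, so that for x < 0 the first one is minus the integral over {x..0}. *)

definition vg_stein_formula ::
  "real \<Rightarrow> real \<Rightarrow> (real \<Rightarrow> real) \<Rightarrow> real \<Rightarrow> real \<Rightarrow> real" where
  "vg_stein_formula \<nu> \<beta> h c x =
     - (exp (- \<beta> * x) * bessel_K \<nu> \<bar>x\<bar> / \<bar>x\<bar> powr \<nu>)
         * (LBINT y=0..ereal x. exp (\<beta> * y) * \<bar>y\<bar> powr \<nu> * bessel_I \<nu> \<bar>y\<bar> * (h y - c))
     - (exp (- \<beta> * x) * bessel_I \<nu> \<bar>x\<bar> / \<bar>x\<bar> powr \<nu>)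
         * (LBINT y=ereal x..\<infinity>. exp (\<beta> * y) * \<bar>y\<bar> powr \<nu> * bessel_K \<nu> \<bar>y\<bar> * (h y - c))"

(* At x = 0 the formula has a removable singularity (K_\<nu> is infinite or I_\<nu>(|x|) / |x|^\<nu>
   is 0/0 there) and is read as its limit. *)

definition vg_stein_sol ::
  "real \<Rightarrow> real \<Rightarrow> (real \<Rightarrow> real) \<Rightarrow> real \<Rightarrow> real \<Rightarrow> real" where
  "vg_stein_sol \<nu> \<beta> h c x =
     (if x = 0 then Lim (at 0) (vg_stein_formula \<nu> \<beta> h c) else vg_stein_formula \<nu> \<beta> h c x)"

end

theory Submission
  imports Defs "HOL-Real_Asymp.Real_Asymp"
begin

text \<open>
  With \<open>f(x) = exp (-\<beta> x) G(x)\<close> and \<open>a = 2\<nu> + 1\<close> the equation becomes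
  \<open>x G'' + a G' - x G = exp (\<beta> x) (h - c)\<close> on each half-line, with homogeneous solutions
  \<open>k(x) = K\<^sub>\<nu>(x) / x\<^sup>\<nu>\<close> and \<open>i(x) = I\<^sub>\<nu>(x) / x\<^sup>\<nu>\<close>, whose Wronskian satisfies
  \<open>x\<^sup>a (i' k - i k') = 1\<close>.  The formula is variation of constants; on the negative half-line it is
  minus the formula for \<open>h(-x)\<close> and \<open>-\<beta>\<close>, and the two halves match at 0 because \<open>h - c\<close> has mean zero.
  For bounded \<open>h\<close>, the sign properties \<open>0 \<le> i' \<le> i\<close> and \<open>0 < k \<le> -k'\<close> bound all terms of
  \<open>f\<close> and \<open>f'\<close> by \<open>(-k') \<integral> w i\<close> and \<open>i \<integral> w k\<close> with \<open>w(x) = exp (\<beta> x) x ^ (a - 1)\<close>,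
  up to the factor \<open>exp (-\<beta> x)\<close>.  These integrals are estimated by comparing \<open>w i\<close>
  and \<open>w k\<close> with derivatives of explicit functions, after which the Wronskian identity gives a
  constant bound without any Bessel asymptotics.  For uniqueness, the difference of two solutions is
  \<open>exp (-\<beta> x) (c\<^sub>1 i + c\<^sub>2 k)\<close> on each half-line; the first summand is unbounded at infinity and, for
  \<open>\<nu> \<ge> 0\<close>, the second one at 0.
\<close>

section \<open>Absolutely continuous functions\<close>

text \<open>Since \<open>h\<close> is merely measurable, the second derivative exists only almost
  everywhere. Existence and uniqueness are therefore argued in a small calculus of pairs (function,
  density), \<open>has_ac_derivative_on\<close>: its product rule justifies variation of constants,
  and its upgrade at continuity points of the density returns classical derivatives where they
  exist. After the locale \<open>bessel_pair\<close> has been instantiated, only the facts listed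
  there are used about the pair of solutions. In particular the growth of \<open>i\<close> at
  infinity is not taken from its series: it follows from the Wronskian identity and a crude decay of
  \<open>k'\<close>. The condition \<nu> > -1/2 makes a positive and gives |\<nu>| \<le> |\<nu> +
  1|, the source of \<open>k \<le> - k'\<close>. The condition \<nu> \<ge> 0 means a \<ge> 1; then
  x^(-a), the size of -k' near 0, is not integrable there, which is why \<open>k\<close> is
  unbounded.\<close>

text \<open>If the difference quotients at \<open>x\<close> stay \<open>\<epsilon>\<close>-far from \<open>f x\<close>, arbitrarily short intervals with
  endpoint \<open>x\<close> violate the Henstock estimate by at least \<open>\<epsilon>\<close> times their length; by Vitali's covering
  lemma disjoint ones cover such points up to a factor 5, and Henstock's lemma bounds their total length.\<close>

lemma indefinite_integral_deriv_AE:
  fixes f :: "real \<Rightarrow> real"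
  assumes f: "f integrable_on {a..b}"
  shows "negligible {x \<in> {a<..<b}. \<not> ((\<lambda>x. integral {a..x} f) has_real_derivative f x) (at x)}"
proof -
  define F where "F = (\<lambda>x. integral {a..x} f)"
  have F_diff: "F v - F u = integral {u..v} f" if "a \<le> u" "u \<le> v" "v \<le> b" for u v
  proof -
    have "integral {a..u} f + integral {u..v} f = integral {a..v} f"
      by (rule Henstock_Kurzweil_Integration.integral_combine) (use that f in \<open>auto intro: integrable_subinterval_real\<close>)
    thus ?thesis by (simp add: F_def)
  qed
  define E where "E = (\<lambda>\<epsilon>. {x \<in> {a<..<b}. \<forall>\<delta>>0. \<exists>y. 0 < \<bar>y - x\<bar> \<and> \<bar>y - x\<bar> < \<delta> \<and>
      \<bar>F y - F x - f x * (y - x)\<bar> > \<epsilon> * \<bar>y - x\<bar>})"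
  have negl: "negligible (E \<epsilon>)" if "\<epsilon> > 0" for \<epsilon>
    unfolding negligible_outer_le
  proof (intro allI impI)
    fix e :: real assume "e > 0"
    \<comment> \<open>Each chosen interval has an excess of at least \<epsilon> times its length, so
      a total excess below \<open>\<eta>\<close> leaves total length at most e/5; the factor 5 is
      the Vitali enlargement.\<close>
    define \<eta> where "\<eta> = \<epsilon> * e / 5"
    have "\<eta> > 0" using \<open>e > 0\<close> \<open>\<epsilon> > 0\<close> by (simp add: \<eta>_def)
    have f': "f integrable_on cbox a b" using f by simp
    obtain \<gamma> where \<gamma>: "gauge \<gamma>"
      and hl: "\<And>p. \<lbrakk>p tagged_partial_division_of (cbox a b); \<gamma> fine p\<rbrakk> \<Longrightarrow>
             sum (\<lambda>(x,k). norm (measure lborel k *\<^sub>R f x - integral k f)) p < \<eta>"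
      by (rule Henstock_lemma[OF f' \<open>\<eta> > 0\<close>]) blast
    \<comment> \<open>A pair \<open>q\<close> stores a tag and the other endpoint, in either order;
      \<open>cball (c q) (r q)\<close> is the closed interval between them, so the tag lies in its
      interval as a tagged division demands.\<close>
    define c where "c = (\<lambda>q::real\<times>real. (fst q + snd q) / 2)"
    define r where "r = (\<lambda>q::real\<times>real. \<bar>snd q - fst q\<bar> / 2)"
    have cb: "cball (c q) (r q) = {min (fst q) (snd q)..max (fst q) (snd q)}" for q
      by (auto simp: cball_eq_atLeastAtMost c_def r_def min_def max_def field_simps)
    define K where "K = {q. 0 < r q \<and> r q \<le> 1 \<and> cball (c q) (r q) \<subseteq> \<gamma> (fst q) \<inter> {a..b} \<and>
       \<bar>F (snd q) - F (fst q) - f (fst q) * (snd q - fst q)\<bar> > \<epsilon> * \<bar>snd q - fst q\<bar>}"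
    have cov: "E \<epsilon> \<subseteq> (\<Union>q\<in>K. cball (c q) (r q))"
    proof
      fix x assume x: "x \<in> E \<epsilon>"
      hence xab: "a < x" "x < b" by (auto simp: E_def)
      from \<gamma> have "open (\<gamma> x)" "x \<in> \<gamma> x" by (auto simp: gauge_def)
      then obtain d where d: "d > 0" "ball x d \<subseteq> \<gamma> x" by (meson open_contains_ball)
      define \<delta> where "\<delta> = Min {d, x - a, b - x, 1}"
      have \<delta>: "\<delta> > 0" "\<delta> \<le> d" "\<delta> \<le> x - a" "\<delta> \<le> b - x" "\<delta> \<le> 1"
        using d xab by (auto simp: \<delta>_def)
      from x \<delta>(1) obtain y where y: "0 < \<bar>y - x\<bar>" "\<bar>y - x\<bar> < \<delta>"
         "\<bar>F y - F x - f x * (y - x)\<bar> > \<epsilon> * \<bar>y - x\<bar>" unfolding E_def by blast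
      have "cball (c (x,y)) (r (x,y)) \<subseteq> ball x d"
        unfolding cb using y \<delta> by (auto simp: dist_real_def)
      moreover have "cball (c (x,y)) (r (x,y)) \<subseteq> {a..b}"
        unfolding cb using y \<delta> by auto
      ultimately have "(x, y) \<in> K" using y \<delta> d by (auto simp: K_def r_def)
      moreover have "x \<in> cball (c (x,y)) (r (x,y))" unfolding cb by auto
      ultimately show "x \<in> (\<Union>q\<in>K. cball (c q) (r q))" by blast
    qed
    obtain C where C: "countable C" "C \<subseteq> K"
       "pairwise (\<lambda>i j. disjnt (cball (c i) (r i)) (cball (c j) (r j))) C"
       "E \<epsilon> \<subseteq> (\<Union>i\<in>C. cball (c i) (5 * r i))"
      by (rule Vitali_covering_lemma_cballs[OF cov, of 1]) (auto simp: K_def)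
    have bd: "measure lebesgue (\<Union>q\<in>I. cball (c q) (5 * r q)) \<le> e" if I: "I \<subseteq> C" "finite I" for I
    proof -
      define \<phi> where "\<phi> = (\<lambda>q. (fst q, cball (c q) (r q)))"
      have inj: "inj_on \<phi> I"
      proof (rule inj_onI)
        fix p q assume pq: "p \<in> I" "q \<in> I" "\<phi> p = \<phi> q"
        show "p = q"
        proof (rule ccontr)
          assume "p \<noteq> q"
          with C(3) pq I have "disjnt (cball (c p) (r p)) (cball (c q) (r q))"
            by (auto simp: pairwise_def)
          moreover have "cball (c p) (r p) = cball (c q) (r q)" using pq(3) by (simp add: \<phi>_def)
          moreover have "fst p \<in> cball (c p) (r p)" unfolding cb by auto
          ultimately show False unfolding disjnt_def by blast
        qed
      qed
      have td: "(\<phi> ` I) tagged_partial_division_of (cbox a b)"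
        unfolding tagged_partial_division_of_def
      proof (intro conjI allI impI)
        show "finite (\<phi> ` I)" using I by simp
        fix x k assume "(x, k) \<in> \<phi> ` I"
        then obtain q where q: "q \<in> I" "x = fst q" "k = cball (c q) (r q)" by (auto simp: \<phi>_def)
        show "x \<in> k" unfolding q cb by auto
        show "k \<subseteq> cbox a b" using q I C by (auto simp: K_def)
        show "\<exists>a b. k = cbox a b" unfolding q cb by auto
      next
        fix x1 k1 x2 k2 assume *: "(x1, k1) \<in> \<phi> ` I \<and> (x2, k2) \<in> \<phi> ` I \<and> (x1, k1) \<noteq> (x2, k2)"
        then obtain p q where pq: "p \<in> I" "q \<in> I" "(x1,k1) = \<phi> p" "(x2,k2) = \<phi> q" by blast
        hence "p \<noteq> q" using * by auto
        with C(3) pq I have "disjnt (cball (c p) (r p)) (cball (c q) (r q))"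
          by (auto simp: pairwise_def)
        hence "k1 \<inter> k2 = {}" using pq by (auto simp: \<phi>_def disjnt_def)
        thus "interior k1 \<inter> interior k2 = {}" using interior_subset by blast
      qed
      have fine: "\<gamma> fine (\<phi> ` I)"
        using I C by (auto simp: fine_def \<phi>_def K_def)
      have "(\<Sum>q\<in>I. \<epsilon> * (2 * r q)) \<le> (\<Sum>q\<in>I. norm (measure lborel (cball (c q) (r q)) *\<^sub>R f (fst q) - integral (cball (c q) (r q)) f))"
      proof (rule sum_mono)
        fix q assume "q \<in> I"
        hence q: "q \<in> K" using I C by auto
        obtain x y where xy: "q = (x, y)" by (cases q)
        have K: "\<bar>F y - F x - f x * (y - x)\<bar> > \<epsilon> * \<bar>y - x\<bar>" "{min x y..max x y} \<subseteq> {a..b}"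
          using q cb[of q] unfolding K_def xy by auto
        have ab: "x \<in> {a..b}" "y \<in> {a..b}" using K(2) by (auto simp: subset_iff min_def max_def split: if_splits)
        have "\<epsilon> * \<bar>y - x\<bar> \<le> \<bar>measure lborel {min x y..max x y} * f x - integral {min x y..max x y} f\<bar>"
        proof (cases "x \<le> y")
          case True
          thus ?thesis using K F_diff[of x y] ab by (auto simp: min_def max_def algebra_simps abs_minus_commute)
        next
          case False
          thus ?thesis using K F_diff[of y x] ab by (auto simp: min_def max_def algebra_simps)
        qed
        thus "\<epsilon> * (2 * r q) \<le> norm (measure lborel (cball (c q) (r q)) *\<^sub>R f (fst q) - integral (cball (c q) (r q)) f)"
          unfolding cb xy by (simp add: r_def)
      qed
      also have "\<dots> = sum (\<lambda>(x,k). norm (measure lborel k *\<^sub>R f x - integral k f)) (\<phi> ` I)"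
        by (subst sum.reindex[OF inj]) (simp add: \<phi>_def)
      also have "\<dots> < \<eta>" by (rule hl[OF td fine])
      finally have s: "(\<Sum>q\<in>I. 2 * r q) \<le> e / 5"
        using \<open>\<epsilon> > 0\<close> by (simp add: \<eta>_def sum_distrib_left[symmetric])
      have "measure lebesgue (\<Union>q\<in>I. cball (c q) (5 * r q)) \<le> (\<Sum>q\<in>I. measure lebesgue (cball (c q) (5 * r q)))"
        by (rule measure_UNION_le) (use I in auto)
      also have "\<dots> = (\<Sum>q\<in>I. 5 * (2 * r q))"
        by (rule sum.cong) (auto simp: cball_eq_atLeastAtMost r_def)
      also have "\<dots> \<le> e" using s by (simp add: sum_distrib_left[symmetric])
      finally show ?thesis .
    qed
    show "\<exists>T. E \<epsilon> \<subseteq> T \<and> T \<in> lmeasurable \<and> measure lebesgue T \<le> e"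
      using C(4) fmeasurable_UN_bound[OF C(1) _ bd] measure_UN_bound[OF C(1) _ bd]
      by (metis (no_types, lifting) lmeasurable_cball)
  qed
  \<comment> \<open>Where the derivative fails, the excess stays above some positive number and
    hence above some 1/(n+1), so countably many null sets suffice.\<close>
  have "{x \<in> {a<..<b}. \<not> (F has_real_derivative f x) (at x)} \<subseteq> (\<Union>n. E (inverse (real (Suc n))))"
  proof
    fix x assume "x \<in> {x \<in> {a<..<b}. \<not> (F has_real_derivative f x) (at x)}"
    hence x: "x \<in> {a<..<b}" and nd: "\<not> (F has_real_derivative f x) (at x)" by auto
    from nd obtain e where e: "e > 0" "\<not> eventually (\<lambda>y. dist ((F y - F x) / (y - x)) (f x) < e) (at x)"
      unfolding has_field_derivative_iff tendsto_iff by auto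
    then obtain n where n: "inverse (real (Suc n)) < e" using reals_Archimedean by blast
    have "x \<in> E (inverse (real (Suc n)))"
      unfolding E_def
    proof (intro CollectI conjI x allI impI)
      fix \<delta> :: real assume "\<delta> > 0"
      with e(2) obtain y where y: "y \<noteq> x" "\<bar>y - x\<bar> < \<delta>" "\<not> dist ((F y - F x) / (y - x)) (f x) < e"
        unfolding eventually_at by (auto simp: dist_real_def)
      have "inverse (real (Suc n)) < \<bar>(F y - F x) / (y - x) - f x\<bar>"
        using y n by (auto simp: dist_real_def)
      also have "(F y - F x) / (y - x) - f x = (F y - F x - f x * (y - x)) / (y - x)"
        using y by (simp add: diff_divide_distrib)
      also have "\<bar>\<dots>\<bar> = \<bar>F y - F x - f x * (y - x)\<bar> / \<bar>y - x\<bar>"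
        by (rule abs_divide)
      finally show "\<exists>y. 0 < \<bar>y - x\<bar> \<and> \<bar>y - x\<bar> < \<delta> \<and>
          inverse (real (Suc n)) * \<bar>y - x\<bar> < \<bar>F y - F x - f x * (y - x)\<bar>"
        using y by (intro exI[of _ y]) (simp add: pos_less_divide_eq)
    qed
    thus "x \<in> (\<Union>n. E (inverse (real (Suc n))))" by blast
  qed
  moreover have "negligible (\<Union>n. E (inverse (real (Suc n))))"
    by (intro negligible_Union_nat negl) auto
  ultimately show ?thesis unfolding F_def by (rule negligible_subset[rotated])
qed

text \<open>\<open>F\<close> is locally absolutely continuous with derivative \<open>f\<close> almost everywhere.  For an arbitrary
  set \<open>S\<close> this compares values of \<open>F\<close> only within one connected component.\<close>

definition has_ac_derivative_on :: "(real \<Rightarrow> real) \<Rightarrow> (real \<Rightarrow> real) \<Rightarrow> real set \<Rightarrow> bool" where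
  "has_ac_derivative_on F f S \<longleftrightarrow>
     (\<forall>a b. a \<le> b \<and> {a..b} \<subseteq> S \<longrightarrow> f absolutely_integrable_on {a..b} \<and> integral {a..b} f = F b - F a)"

lemma ac_derivD:
  assumes "has_ac_derivative_on F f S" "a \<le> b" "{a..b} \<subseteq> S"
  shows "f absolutely_integrable_on {a..b}" "f integrable_on {a..b}" "integral {a..b} f = F b - F a"
  using assms by (auto simp: has_ac_derivative_on_def absolutely_integrable_on_def)

lemma ac_deriv_C1:
  assumes "\<And>x. x \<in> S \<Longrightarrow> (F has_real_derivative f x) (at x)" "continuous_on S f"
  shows "has_ac_derivative_on F f S"
  unfolding has_ac_derivative_on_def
proof (intro allI impI conjI; elim conjE)
  fix a b :: real assume ab: "a \<le> b" "{a..b} \<subseteq> S"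
  show "f absolutely_integrable_on {a..b}"
    by (rule absolutely_integrable_continuous_real) (use assms ab continuous_on_subset in blast)
  have "(f has_integral (F b - F a)) {a..b}"
  proof (rule fundamental_theorem_of_calculus[OF ab(1)])
    fix x assume "x \<in> {a..b}"
    hence "x \<in> S" using ab by auto
    from assms(1)[OF this] show "(F has_vector_derivative f x) (at x within {a..b})"
      by (simp add: has_real_derivative_iff_has_vector_derivative has_vector_derivative_at_within)
  qed
  thus "integral {a..b} f = F b - F a" by (rule integral_unique)
qed

lemma ac_deriv_mono:
  assumes "has_ac_derivative_on U u S" "has_ac_derivative_on V v S"
    "p \<le> q" "{p..q} \<subseteq> S" "\<And>x. p \<le> x \<Longrightarrow> x \<le> q \<Longrightarrow> u x \<le> v x"
  shows "U q - U p \<le> V q - V p"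
proof -
  have "integral {p..q} u \<le> integral {p..q} v"
    by (rule Henstock_Kurzweil_Integration.integral_le)
      (use ac_derivD(2)[OF assms(1,3,4)] ac_derivD(2)[OF assms(2,3,4)] assms(5) in auto)
  thus ?thesis using ac_derivD(3)[OF assms(1,3,4)] ac_derivD(3)[OF assms(2,3,4)] by simp
qed

lemma ac_deriv_add:
  assumes "has_ac_derivative_on F f S" "has_ac_derivative_on G g S"
  shows "has_ac_derivative_on (\<lambda>x. F x + G x) (\<lambda>x. f x + g x) S"
  unfolding has_ac_derivative_on_def
proof (intro allI impI; elim conjE)
  fix a b :: real assume ab: "a \<le> b" "{a..b} \<subseteq> S"
  note * = ac_derivD[OF assms(1) ab] ac_derivD[OF assms(2) ab]
  show "(\<lambda>x. f x + g x) absolutely_integrable_on {a..b} \<and>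
      integral {a..b} (\<lambda>x. f x + g x) = F b + G b - (F a + G a)"
    using * by (simp add: set_integral_add Henstock_Kurzweil_Integration.integral_add)
qed

lemma ac_deriv_cmult:
  assumes "has_ac_derivative_on F f S"
  shows "has_ac_derivative_on (\<lambda>x. c * F x) (\<lambda>x. c * f x) S"
  unfolding has_ac_derivative_on_def
proof (intro allI impI; elim conjE)
  fix a b :: real assume ab: "a \<le> b" "{a..b} \<subseteq> S"
  note * = ac_derivD[OF assms ab]
  show "(\<lambda>x. c * f x) absolutely_integrable_on {a..b} \<and>
      integral {a..b} (\<lambda>x. c * f x) = c * F b - c * F a"
    using * by (simp add: right_diff_distrib)
qed

lemma ac_deriv_diff:
  assumes "has_ac_derivative_on F f S" "has_ac_derivative_on G g S"
  shows "has_ac_derivative_on (\<lambda>x. F x - G x) (\<lambda>x. f x - g x) S"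
  using ac_deriv_add[OF assms(1) ac_deriv_cmult[OF assms(2), of "-1"]] by simp

lemma ac_deriv_cong:
  assumes "has_ac_derivative_on F f S" "\<And>x. x \<in> S \<Longrightarrow> G x = F x" "\<And>x. x \<in> S \<Longrightarrow> g x = f x"
  shows "has_ac_derivative_on G g S"
  unfolding has_ac_derivative_on_def
proof (intro allI impI; elim conjE)
  fix a b :: real assume ab: "a \<le> b" "{a..b} \<subseteq> S"
  note * = ac_derivD[OF assms(1) ab]
  have "g absolutely_integrable_on {a..b}"
    by (rule absolutely_integrable_spike[OF *(1), of "{}"]) (use assms ab in auto)
  moreover have "integral {a..b} g = integral {a..b} f"
    by (rule Henstock_Kurzweil_Integration.integral_cong) (use assms ab in auto)
  moreover have "a \<in> S" "b \<in> S" using ab by auto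
  ultimately show "g absolutely_integrable_on {a..b} \<and> integral {a..b} g = G b - G a"
    using * assms by auto
qed

lemma ac_deriv_cong_AE:
  assumes "has_ac_derivative_on F f S" "negligible N" "\<And>x. x \<in> S - N \<Longrightarrow> g x = f x"
  shows "has_ac_derivative_on F g S"
  unfolding has_ac_derivative_on_def
proof (intro allI impI; elim conjE)
  fix a b :: real assume ab: "a \<le> b" "{a..b} \<subseteq> S"
  note * = ac_derivD[OF assms(1) ab]
  have "g absolutely_integrable_on {a..b}"
    by (rule absolutely_integrable_spike[OF *(1) assms(2)]) (use assms ab in auto)
  moreover have "integral {a..b} g = integral {a..b} f"
    by (rule integral_spike[OF assms(2)]) (use assms ab in auto)
  ultimately show "g absolutely_integrable_on {a..b} \<and> integral {a..b} g = F b - F a"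
    using * by auto
qed

lemma ac_deriv_reflect:
  assumes "has_ac_derivative_on F f S"
  shows "has_ac_derivative_on (\<lambda>x. F (- x)) (\<lambda>x. - f (- x)) (uminus ` S)"
  unfolding has_ac_derivative_on_def
proof (intro allI impI; elim conjE)
  fix a b :: real assume ab: "a \<le> b" "{a..b} \<subseteq> uminus ` S"
  have "{-b..-a} \<subseteq> S"
  proof
    fix x assume "x \<in> {-b..-a}"
    hence "- x \<in> {a..b}" by auto
    with ab(2) show "x \<in> S" by auto
  qed
  with ab have *: "f absolutely_integrable_on {-b..-a}" "integral {-b..-a} f = F (-a) - F (-b)"
    using ac_derivD[OF assms, of "-b" "-a"] by auto
  have "(\<lambda>x. f (- x)) absolutely_integrable_on {a..b}"
    using *(1) absolutely_integrable_reflect_real[where f = f and a = "-b" and b = "-a"] by simp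
  hence "(\<lambda>x. (-1) * f (- x)) absolutely_integrable_on {a..b}"
    by (subst set_integrable_mult_right_iff) auto
  moreover have "integral {a..b} (\<lambda>x. - f (- x)) = F (- b) - F (- a)"
    using *(2) Henstock_Kurzweil_Integration.integral_reflect_real[where a = "-b" and b = "-a" and f = f] by simp
  ultimately show "(\<lambda>x. - f (- x)) absolutely_integrable_on {a..b} \<and>
      integral {a..b} (\<lambda>x. - f (- x)) = F (- b) - F (- a)" by simp
qed

lemma ac_deriv_continuous_on_Icc:
  assumes "has_ac_derivative_on F f S" "{a..b} \<subseteq> S"
  shows "continuous_on {a..b} F"
proof (cases "a \<le> b")
  case True
  have "continuous_on {a..b} (\<lambda>x. F a + integral {a..x} f)"
    using ac_derivD(2)[OF assms(1) True assms(2)]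
    by (intro continuous_intros indefinite_integral_continuous_1)
  moreover have "F a + integral {a..x} f = F x" if "x \<in> {a..b}" for x
    using ac_derivD(3)[OF assms(1), of a x] that assms(2) by (auto simp: subset_iff)
  ultimately show ?thesis by (subst continuous_on_cong[OF refl]) auto
qed auto

lemma open_real_Icc_nhd:
  fixes x :: real
  assumes "open S" "x \<in> S"
  obtains a b where "a < x" "x < b" "{a..b} \<subseteq> S"
proof -
  obtain e where e: "e > 0" "cball x e \<subseteq> S" using assms open_contains_cball by blast
  thus ?thesis by (intro that[of "x - e" "x + e"]) (auto simp: cball_eq_atLeastAtMost)
qed

lemma ac_deriv_isCont:
  assumes "has_ac_derivative_on F f S" "open S" "x \<in> S"
  shows "isCont F x"
proof -
  obtain a b where "a < x" "x < b" "{a..b} \<subseteq> S" using open_real_Icc_nhd[OF assms(2,3)] .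
  with ac_deriv_continuous_on_Icc[OF assms(1) this(3)] show ?thesis
    by (intro continuous_on_interior[of "{a..b}"]) auto
qed

text \<open>Near \<open>x\<close> the function is a constant plus an indefinite integral of
  \<open>f\<close>, so continuity of \<open>f\<close> at the single point \<open>x\<close> is
  enough. This makes the first derivative of the solution classical off 0, and the second one
  wherever \<open>h\<close> is continuous.\<close>

lemma ac_deriv_has_real_derivative:
  assumes "has_ac_derivative_on F f S" "open S" "x \<in> S" "isCont f x"
  shows "(F has_real_derivative f x) (at x)"
proof -
  obtain a b where ab: "a < x" "x < b" "{a..b} \<subseteq> S" using open_real_Icc_nhd[OF assms(2,3)] .
  note * = ac_derivD[OF assms(1) _ ab(3)]
  have "((\<lambda>u. integral {a..u} f) has_vector_derivative f x) (at x within ({a..b} - {}))"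
    by (rule integral_has_vector_derivative_continuous_at)
      (use * ab assms(4) in \<open>auto intro: continuous_at_imp_continuous_at_within\<close>)
  hence "((\<lambda>u. F a + integral {a..u} f) has_real_derivative f x) (at x within {a..b})"
    by (auto simp: has_real_derivative_iff_has_vector_derivative intro!: derivative_eq_intros)
  hence "(F has_real_derivative f x) (at x within {a..b})"
    by (rule has_field_derivative_transform_within[where d = 1])
      (use ab in \<open>auto simp: ac_derivD(3)[OF assms(1)] subset_iff\<close>)
  thus ?thesis using at_within_Icc_at[of a x b] ab by simp
qed

text \<open>Each point has an interval around it on which \<open>F\<close> is a constant plus an
  indefinite integral of \<open>f\<close>, and a locally negligible set is negligible.\<close>

lemma ac_deriv_AE:
  assumes "has_ac_derivative_on F f S" "open S"
  shows "negligible {x \<in> S. \<not> (F has_real_derivative f x) (at x)}"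
proof -
  let ?N = "{x \<in> S. \<not> (F has_real_derivative f x) (at x)}"
  have "negligible (?N \<inter> {a<..<b})" if ab: "{a..b} \<subseteq> S" for a b :: real
  proof (cases "a < b")
    case True
    note * = ac_derivD[OF assms(1) _ ab]
    have "?N \<inter> {a<..<b} \<subseteq> {x \<in> {a<..<b}. \<not> ((\<lambda>x. integral {a..x} f) has_real_derivative f x) (at x)}"
    proof safe
      fix x assume x: "x \<in> {a<..<b}" "((\<lambda>x. integral {a..x} f) has_real_derivative f x) (at x)"
      from x(2) have "((\<lambda>u. F a + integral {a..u} f) has_real_derivative f x) (at x)"
        by (auto intro!: derivative_eq_intros)
      hence "(F has_real_derivative f x) (at x)"
        by (rule has_field_derivative_transform_within_open[where S = "{a<..<b}"])
          (use x ab in \<open>auto simp: ac_derivD(3)[OF assms(1)] subset_iff\<close>)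
      moreover assume "\<not> (F has_real_derivative f x) (at x)"
      ultimately show False by simp
    qed
    moreover have "negligible {x \<in> {a<..<b}. \<not> ((\<lambda>x. integral {a..x} f) has_real_derivative f x) (at x)}"
      by (rule indefinite_integral_deriv_AE) (use * True in auto)
    ultimately show ?thesis using negligible_subset by blast
  qed auto
  note 1 = this
  have "\<exists>T. open T \<and> x \<in> T \<and> negligible (?N \<inter> T)" if "x \<in> ?N" for x
  proof -
    obtain a b where "a < x" "x < b" "{a..b} \<subseteq> S" using open_real_Icc_nhd[OF assms(2), of x] \<open>x \<in> ?N\<close> by blast
    thus ?thesis using 1 by (intro exI[of _ "{a<..<b}"]) auto
  qed
  hence "\<exists>U. openin (top_of_set ?N) U \<and> x \<in> U \<and> negligible U" if "x \<in> ?N" for x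
    using that by (meson IntI openin_open_Int)
  thus ?thesis by (subst locally_negligible_alt) blast
qed

text \<open>Cutting {a..b} into n equal pieces bounds the sum of the increments of \<open>D\<close>
  by (b - a) (V b - V a) / n, which is arbitrarily small. It serves the product rule, whose defect
  has increments of second order.\<close>

lemma constant_if_dominated_increments:
  fixes D V :: "real \<Rightarrow> real"
  assumes "a \<le> b"
    and D: "\<And>c d. a \<le> c \<Longrightarrow> c \<le> d \<Longrightarrow> d \<le> b \<Longrightarrow> \<bar>D d - D c\<bar> \<le> (d - c) * (V d - V c)"
  shows "D b = D a"
proof (rule ccontr)
  assume "D b \<noteq> D a"
  hence "\<bar>D b - D a\<bar> > 0" by simp
  then obtain n where n: "(b - a) * (V b - V a) < real n * \<bar>D b - D a\<bar>"
    using reals_Archimedean3 by blast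
  have "(b - a) * (V b - V a) \<ge> 0" using D[of a b] assms(1) by linarith
  hence "n > 0" using n by (cases n) auto
  define t where "t = (\<lambda>j. a + (b - a) * real j / real n)"
  have t: "t 0 = a" "t n = b" using \<open>n > 0\<close> by (auto simp: t_def)
  have step: "t (Suc j) - t j = (b - a) / real n" for j
    by (simp add: t_def field_simps add_divide_distrib diff_divide_distrib)
  have "\<bar>D b - D a\<bar> = \<bar>\<Sum>j<n. D (t (Suc j)) - D (t j)\<bar>"
    by (subst sum_lessThan_telescope) (simp add: t)
  also have "\<dots> \<le> (\<Sum>j<n. \<bar>D (t (Suc j)) - D (t j)\<bar>)" by (rule sum_abs)
  also have "\<dots> \<le> (\<Sum>j<n. (t (Suc j) - t j) * (V (t (Suc j)) - V (t j)))"
  proof (rule sum_mono, rule D)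
    fix j assume j: "j \<in> {..<n}"
    show "a \<le> t j" using assms(1) by (auto simp: t_def)
    show "t j \<le> t (Suc j)" using step[of j] assms(1) \<open>n > 0\<close> by (smt (verit) divide_nonneg_pos of_nat_0_less_iff)
    have "(b - a) * real (Suc j) \<le> (b - a) * real n" using j assms(1) by (intro mult_left_mono) auto
    thus "t (Suc j) \<le> b" using \<open>n > 0\<close> by (simp add: t_def field_simps)
  qed
  also have "\<dots> = (b - a) / real n * (\<Sum>j<n. V (t (Suc j)) - V (t j))"
    unfolding step by (simp add: sum_distrib_left)
  also have "\<dots> = (b - a) / real n * (V b - V a)"
    by (subst sum_lessThan_telescope) (simp add: t)
  finally show False using n \<open>n > 0\<close> by (simp add: field_simps)
qed

lemma absolutely_integrable_continuous_mult:
  fixes f :: "real \<Rightarrow> real"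
  assumes "f absolutely_integrable_on {a..b}" "continuous_on {a..b} p"
  shows "(\<lambda>x. p x * f x) absolutely_integrable_on {a..b}"
  by (rule absolutely_integrable_bounded_measurable_product_real)
    (use assms in \<open>auto intro: continuous_imp_measurable_on_sets_lebesgue compact_imp_bounded compact_continuous_image\<close>)

text \<open>The defect \<open>D\<close> of the product rule changes over {c..d} by at most 2 M (d -
  c) times the integral of |f|: one of the two small factors measures the variation of
  \<open>p\<close>, the other that of \<open>F\<close>. Hence \<open>D\<close> is constant, without
  any differentiation almost everywhere.\<close>

lemma ac_deriv_mult:
  assumes F: "has_ac_derivative_on F f S"
    and p: "\<And>x. x \<in> S \<Longrightarrow> (p has_real_derivative p' x) (at x)" "continuous_on S p'"
  shows "has_ac_derivative_on (\<lambda>x. p x * F x) (\<lambda>x. p' x * F x + p x * f x) S"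
  unfolding has_ac_derivative_on_def
proof (intro allI impI; elim conjE)
  fix a b :: real assume ab: "a \<le> b" "{a..b} \<subseteq> S"
  let ?g = "\<lambda>x. p' x * F x + p x * f x"
  have contp: "continuous_on {a..b} p"
    using p(1) ab by (meson DERIV_isCont continuous_at_imp_continuous_on subset_iff)
  have contp': "continuous_on {a..b} p'" using p(2) ab continuous_on_subset by blast
  have contF: "continuous_on {a..b} F" by (rule ac_deriv_continuous_on_Icc[OF F ab(2)])
  have f: "f absolutely_integrable_on {a..b}" by (rule ac_derivD[OF F ab])
  have i1: "(\<lambda>x. p x * f x) absolutely_integrable_on {a..b}"
    by (rule absolutely_integrable_continuous_mult[OF f contp])
  have i2: "(\<lambda>x. p' x * F x) absolutely_integrable_on {a..b}"
    by (intro absolutely_integrable_continuous_real continuous_intros contp' contF)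
  have g: "?g absolutely_integrable_on {a..b}" using i1 i2 by (rule set_integral_add(1)[rotated])
  obtain M where M: "\<And>x. x \<in> {a..b} \<Longrightarrow> \<bar>p' x\<bar> \<le> M"
    using compact_continuous_image[OF contp' compact_Icc, THEN compact_imp_bounded]
    unfolding bounded_iff by (metis imageI real_norm_def)
  have "\<bar>p' a\<bar> \<le> M" using M ab by simp
  hence "M \<ge> 0" by linarith
  have p_FTC: "(p' has_integral (p d - p c)) {c..d}" if "a \<le> c" "c \<le> d" "d \<le> b" for c d
  proof (rule fundamental_theorem_of_calculus[OF that(2)])
    fix x assume "x \<in> {c..d}"
    hence "x \<in> S" using that ab by auto
    from p(1)[OF this] show "(p has_vector_derivative p' x) (at x within {c..d})"
      by (simp add: has_real_derivative_iff_has_vector_derivative has_vector_derivative_at_within)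
  qed
  define D where "D = (\<lambda>x. p x * F x - integral {a..x} ?g)"
  define V where "V = (\<lambda>x. 2 * M * integral {a..x} (\<lambda>y. \<bar>f y\<bar>))"
  have "D b = D a"
  proof (rule constant_if_dominated_increments[OF ab(1)])
    fix c d assume cd: "a \<le> c" "c \<le> d" "d \<le> b"
    have sub: "{c..d} \<subseteq> {a..b}" using cd by auto
    have int_cd: "u absolutely_integrable_on {c..d}" if "u absolutely_integrable_on {a..b}" for u :: "real \<Rightarrow> real"
      using absolutely_integrable_on_subinterval[OF that sub] .
    have hk: "u integrable_on {c..d}" if "u absolutely_integrable_on {a..b}" for u :: "real \<Rightarrow> real"
      using int_cd[OF that] by (simp add: absolutely_integrable_on_def)
    have split: "integral {a..d} u - integral {a..c} u = integral {c..d} u" if "u integrable_on {a..b}" for u :: "real \<Rightarrow> real"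
      using Henstock_Kurzweil_Integration.integral_combine[OF cd(1,2), of u] integrable_subinterval_real[OF that, of a d] cd by auto
    have abs_f: "(\<lambda>y. \<bar>f y\<bar>) absolutely_integrable_on {a..b}"
      using f by (rule set_integrable_abs)
    define W where "W = integral {c..d} (\<lambda>y. \<bar>f y\<bar>)"
    have V: "V d - V c = 2 * M * W"
      unfolding V_def W_def using split[of "\<lambda>y. \<bar>f y\<bar>"] abs_f
      by (simp add: right_diff_distrib[symmetric] absolutely_integrable_on_def)
    have Fc: "\<bar>F c - F y\<bar> \<le> W" if y: "y \<in> {c..d}" for y
    proof -
      have "F y - F c = integral {c..y} f" using ac_derivD(3)[OF F, of c y] y cd ab by (auto simp: subset_iff)
      moreover have "norm (integral {c..y} f) \<le> integral {c..y} (\<lambda>y. \<bar>f y\<bar>)"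
        by (rule integral_norm_bound_integral)
          (use integrable_subinterval_real[of f c d c y] integrable_subinterval_real[of "\<lambda>x. \<bar>f x\<bar>" c d c y] hk[OF f] hk[OF abs_f] y in auto)
      moreover have "integral {c..y} (\<lambda>y. \<bar>f y\<bar>) \<le> W"
        unfolding W_def using y hk[OF abs_f] by (intro integral_subset_le) (auto intro: integrable_subinterval_real)
      ultimately show ?thesis by simp
    qed
    have pd: "\<bar>p d - p y\<bar> \<le> M * (d - c)" if y: "y \<in> {c..d}" for y
    proof -
      have "norm (p d - p y) \<le> M * measure lborel (cbox y d)"
        using has_integral_bound[OF \<open>M \<ge> 0\<close>, of p' "p d - p y" y d] p_FTC[of y d] M y cd by auto
      also have "\<dots> \<le> M * (d - c)" using y \<open>M \<ge> 0\<close> by (intro mult_left_mono) auto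
      finally show ?thesis by simp
    qed
    \<comment> \<open>Freezing \<open>p\<close> at d and \<open>F\<close> at c reproduces the
      increment of the product exactly: p(d) F(d) - p(c) F(c) = p(d) (F(d) - F(c)) + F(c) (p(d) -
      p(c)).\<close>
    let ?r = "\<lambda>y. (p d * f y + F c * p' y) - ?g y"
    have "(?r has_integral (p d * (F d - F c) + F c * (p d - p c)) - integral {c..d} ?g) {c..d}"
    proof (intro has_integral_diff has_integral_add has_integral_mult_right)
      show "(f has_integral F d - F c) {c..d}"
        using ac_derivD[OF F, of c d] cd ab sub by (metis has_integral_integral order_trans)
      show "(p' has_integral p d - p c) {c..d}" using p_FTC cd by auto
      show "(?g has_integral integral {c..d} ?g) {c..d}" using hk[OF g] by blast
    qed
    hence r: "(?r has_integral (D d - D c)) {c..d}"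
      using split[of ?g] g by (simp add: D_def algebra_simps absolutely_integrable_on_def)
    have "norm (integral {c..d} ?r) \<le> integral {c..d} (\<lambda>y. M * (d - c) * \<bar>f y\<bar> + M * W)"
    proof (rule integral_norm_bound_integral)
      show "?r integrable_on {c..d}" using r by blast
      show "(\<lambda>y. M * (d - c) * \<bar>f y\<bar> + M * W) integrable_on {c..d}"
        by (intro integrable_add integrable_on_mult_right hk[OF abs_f] integrable_const_ivl)
      fix y assume y: "y \<in> {c..d}"
      have "?r y = (p d - p y) * f y + p' y * (F c - F y)" by (simp add: algebra_simps)
      also have "norm \<dots> \<le> \<bar>p d - p y\<bar> * \<bar>f y\<bar> + \<bar>p' y\<bar> * \<bar>F c - F y\<bar>"
        by (simp add: abs_mult[symmetric] abs_triangle_ineq)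
      also have "\<dots> \<le> M * (d - c) * \<bar>f y\<bar> + M * W"
        using y pd Fc M[of y] sub \<open>M \<ge> 0\<close> by (intro add_mono mult_mono) auto
      finally show "norm (?r y) \<le> M * (d - c) * \<bar>f y\<bar> + M * W" .
    qed
    also have "\<dots> = M * (d - c) * W + M * W * (d - c)"
      by (subst Henstock_Kurzweil_Integration.integral_add)
        (use cd in \<open>simp_all add: W_def integrable_on_mult_right hk[OF abs_f] integrable_const_ivl\<close>)
    also have "\<dots> = (d - c) * (V d - V c)" unfolding V by (simp add: algebra_simps)
    finally show "\<bar>D d - D c\<bar> \<le> (d - c) * (V d - V c)"
      using integral_unique[OF r] by simp
  qed
  hence "integral {a..b} ?g = p b * F b - p a * F a" by (simp add: D_def)
  with g show "?g absolutely_integrable_on {a..b} \<and> integral {a..b} ?g = p b * F b - p a * F a" by blast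
qed

section \<open>Modified Bessel functions\<close>

definition bessel_I_coeff :: "real \<Rightarrow> nat \<Rightarrow> real" where
  "bessel_I_coeff \<nu> k = rGamma (\<nu> + real k + 1) / fact k"

text \<open>\<open>reduced_I \<nu> x\<close> is \<open>I\<^sub>\<nu>(x) / x\<^sup>\<nu>\<close>, extended to an even entire function.\<close>

definition reduced_I :: "real \<Rightarrow> real \<Rightarrow> real" where
  "reduced_I \<nu> x = 2 powr (- \<nu>) * (\<Sum>k. bessel_I_coeff \<nu> k * (x\<^sup>2 / 4) ^ k)"

definition reduced_K :: "real \<Rightarrow> real \<Rightarrow> real" where
  "reduced_K \<nu> x = x powr (- \<nu>) * bessel_K \<nu> x"

lemma rGamma_pos: "x > 0 \<Longrightarrow> rGamma (x :: real) > 0"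
  by (simp add: Gamma_real_pos rGamma_inverse_Gamma)

lemma bessel_I_coeff_nonneg: "\<nu> > -1 \<Longrightarrow> bessel_I_coeff \<nu> k \<ge> 0"
  using rGamma_pos[of "\<nu> + real k + 1"] by (simp add: bessel_I_coeff_def)

lemma bessel_I_coeff_rec:
  "bessel_I_coeff \<nu> k = (\<nu> + real k + 1) * bessel_I_coeff (\<nu> + 1) k"
  using rGamma_plus1[of "\<nu> + real k + 1"] by (simp add: add_ac bessel_I_coeff_def)

lemma bessel_I_coeff_Suc: "real (Suc k) * bessel_I_coeff \<nu> (Suc k) = bessel_I_coeff (\<nu> + 1) k"
proof -
  have "rGamma (\<nu> + real (Suc k) + 1) = rGamma (\<nu> + 1 + real k + 1)" by (simp add: add_ac)
  thus ?thesis by (simp add: bessel_I_coeff_def del: of_nat_Suc)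
qed

lemma summable_bessel_I_coeff:
  assumes "\<nu> > -1"
  shows "summable (\<lambda>k. bessel_I_coeff \<nu> k * z ^ k)"
proof -
  \<comment> \<open>From \<open>N\<close> on, n + 1 \<ge> 2 |z| and \<nu> + n + 1 \<ge> 1, so the
    ratio |z| / ((\<nu> + n + 1) (n + 1)) of consecutive terms is at most 1/2.\<close>
  define N where "N = Suc (nat \<lceil>2 * \<bar>z\<bar>\<rceil>)"
  show ?thesis
  proof (rule summable_ratio_test[of "1/2" N])
    fix n assume n: "n \<ge> N"
    hence n': "real n \<ge> 2 * \<bar>z\<bar>" "real n \<ge> 1" unfolding N_def by linarith+
    have d: "(\<nu> + real n + 1) * real (Suc n) \<ge> 2 * \<bar>z\<bar>"
    proof -
      have "1 * (2 * \<bar>z\<bar>) \<le> (\<nu> + real n + 1) * real (Suc n)"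
        using n' assms by (intro mult_mono) auto
      thus ?thesis by simp
    qed
    have dpos: "(\<nu> + real n + 1) * real (Suc n) > 0" using n' assms by (intro mult_pos_pos) auto
    have "bessel_I_coeff \<nu> n = (\<nu> + real n + 1) * real (Suc n) * bessel_I_coeff \<nu> (Suc n)"
      by (simp only: bessel_I_coeff_rec[of \<nu> n] bessel_I_coeff_Suc[symmetric] mult.assoc)
    hence eq: "bessel_I_coeff \<nu> (Suc n) = bessel_I_coeff \<nu> n / ((\<nu> + real n + 1) * real (Suc n))"
      using dpos by (simp add: field_simps del: of_nat_Suc)
    have "norm (bessel_I_coeff \<nu> (Suc n) * z ^ Suc n)
        = bessel_I_coeff \<nu> n * \<bar>z\<bar> ^ n * (\<bar>z\<bar> / ((\<nu> + real n + 1) * real (Suc n)))"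
      unfolding eq norm_mult norm_divide using bessel_I_coeff_nonneg[OF assms, of n] dpos assms
      by (simp add: norm_power abs_mult power_abs del: of_nat_Suc)
    also have "\<dots> \<le> bessel_I_coeff \<nu> n * \<bar>z\<bar> ^ n * (1 / 2)"
      using d dpos bessel_I_coeff_nonneg[OF assms, of n]
      by (intro mult_left_mono) (auto simp: divide_le_eq simp del: of_nat_Suc)
    also have "\<dots> = 1 / 2 * norm (bessel_I_coeff \<nu> n * z ^ n)"
      using bessel_I_coeff_nonneg[OF assms, of n] by (simp add: abs_mult power_abs)
    finally show "norm (bessel_I_coeff \<nu> (Suc n) * z ^ Suc n) \<le> 1 / 2 * norm (bessel_I_coeff \<nu> n * z ^ n)" .
  qed simp
qed

lemma diffs_bessel_I_coeff: "diffs (bessel_I_coeff \<nu>) = bessel_I_coeff (\<nu> + 1)"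
  by (rule ext) (simp only: diffs_def bessel_I_coeff_Suc)

text \<open>Termwise differentiation in z = x^2/4 raises the order by one
  (\<open>diffs_bessel_I_coeff\<close>); of the inner derivative x/2, the 1/2 turns
  \<open>2 powr (- \<nu>)\<close> into the prefactor of order \<nu> + 1.\<close>

lemma reduced_I_has_real_derivative:
  assumes "\<nu> > -1"
  shows "(reduced_I \<nu> has_real_derivative x * reduced_I (\<nu> + 1) x) (at x)"
proof -
  have "((\<lambda>z. \<Sum>k. bessel_I_coeff \<nu> k * z ^ k) has_real_derivative
      (\<Sum>k. bessel_I_coeff (\<nu> + 1) k * z ^ k)) (at z)" for z
    using termdiffs_strong_converges_everywhere[OF summable_bessel_I_coeff[OF assms]]
    unfolding diffs_bessel_I_coeff .
  note * = DERIV_chain2[OF this, where g = "\<lambda>x. x\<^sup>2 / 4" and x = x and s = UNIV and Db = "x / 2"]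
  have "((\<lambda>x. x\<^sup>2 / 4) has_real_derivative x / 2) (at x)"
    by (auto intro!: derivative_eq_intros)
  from DERIV_cmult[OF *[OF this], of "2 powr (- \<nu>)"] show ?thesis
    unfolding reduced_I_def[abs_def]
    by (rule back_subst[of "\<lambda>d. (_ has_real_derivative d) (at x)"])
      (simp add: powr_diff powr_minus field_simps powr_add)
qed

text \<open>The classical recurrence between the orders \<nu>, \<nu> + 1 and \<nu> + 2. The factor
  \<nu> + n + 1 of \<open>bessel_I_coeff_rec\<close> is split: n yields the differentiated series,
  of order \<nu> + 2, and \<nu> + 1 the series itself. It turns the derivative formula into the
  second-order equation.\<close>

lemma reduced_I_rec:
  assumes "\<nu> > -1"
  shows "reduced_I \<nu> x = x\<^sup>2 * reduced_I (\<nu> + 2) x + 2 * (\<nu> + 1) * reduced_I (\<nu> + 1) x"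
proof -
  define z where "z = x\<^sup>2 / 4"
  let ?c = "bessel_I_coeff (\<nu> + 1)"
  have \<nu>1: "\<nu> + 1 > -1" "\<nu> + 2 > -1" using assms by auto
  have eq2: "bessel_I_coeff (\<nu> + 1 + 1) = bessel_I_coeff (\<nu> + 2)" by (simp add: add_ac)
  have "(\<lambda>n. of_nat n * ?c n * z ^ (n - Suc 0)) sums (\<Sum>n. diffs ?c n * z ^ n)"
    by (rule diffs_equiv) (use summable_bessel_I_coeff[OF \<nu>1(2)] in \<open>simp only: diffs_bessel_I_coeff eq2\<close>)
  from sums_mult[OF this, of z] have "(\<lambda>n. real n * (?c n * z ^ n)) sums (z * (\<Sum>n. bessel_I_coeff (\<nu> + 2) n * z ^ n))"
    unfolding diffs_bessel_I_coeff eq2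
  proof (rule back_subst[of "\<lambda>f. f sums _"], intro ext)
    fix n show "z * (real n * ?c n * z ^ (n - Suc 0)) = real n * (?c n * z ^ n)"
      by (cases n) auto
  qed
  moreover have "(\<lambda>n. (\<nu> + 1) * (?c n * z ^ n)) sums ((\<nu> + 1) * (\<Sum>n. ?c n * z ^ n))"
    by (intro sums_mult summable_sums summable_bessel_I_coeff \<nu>1)
  ultimately have "(\<lambda>n. real n * (?c n * z ^ n) + (\<nu> + 1) * (?c n * z ^ n)) sums
      (z * (\<Sum>n. bessel_I_coeff (\<nu> + 2) n * z ^ n) + (\<nu> + 1) * (\<Sum>n. ?c n * z ^ n))"
    by (rule sums_add)
  also have "(\<lambda>n. real n * (?c n * z ^ n) + (\<nu> + 1) * (?c n * z ^ n)) = (\<lambda>n. bessel_I_coeff \<nu> n * z ^ n)"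
    by (subst (3) bessel_I_coeff_rec) (simp add: algebra_simps)
  finally have "(\<Sum>n. bessel_I_coeff \<nu> n * z ^ n) =
      z * (\<Sum>n. bessel_I_coeff (\<nu> + 2) n * z ^ n) + (\<nu> + 1) * (\<Sum>n. ?c n * z ^ n)"
    by (rule sums_unique[symmetric])
  moreover have "2 powr (- \<nu>) = 4 * 2 powr (- (\<nu> + 2))" "2 powr (- \<nu>) = 2 * 2 powr (- (\<nu> + 1))"
    by (simp_all add: powr_diff powr_minus powr_add field_simps)
  ultimately show ?thesis
    unfolding reduced_I_def z_def[symmetric] by (simp add: z_def algebra_simps)
qed

lemma reduced_I_pos:
  assumes "\<nu> > -1"
  shows "reduced_I \<nu> x > 0"
proof -
  have "(\<Sum>k. bessel_I_coeff \<nu> k * (x\<^sup>2 / 4) ^ k) > 0"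
    by (rule suminf_pos2[of _ 0])
      (use assms summable_bessel_I_coeff[OF assms] bessel_I_coeff_nonneg[OF assms] rGamma_pos[of "\<nu> + 1"] in
        \<open>auto simp: bessel_I_coeff_def[of _ 0] intro!: mult_nonneg_nonneg\<close>)
  thus ?thesis by (simp add: reduced_I_def)
qed

lemma reduced_I_0: "reduced_I \<nu> 0 = 2 powr (- \<nu>) * rGamma (\<nu> + 1)"
proof -
  have "(\<Sum>k. bessel_I_coeff \<nu> k * 0 ^ k) = (\<Sum>k\<in>{0}. bessel_I_coeff \<nu> k * 0 ^ k)"
    by (rule suminf_finite) auto
  thus ?thesis by (simp add: reduced_I_def bessel_I_coeff_def)
qed

lemma bessel_I_eq_reduced:
  assumes "\<nu> > -1" "x > 0"
  shows "bessel_I \<nu> x = x powr \<nu> * reduced_I \<nu> x"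
proof -
  have "bessel_I \<nu> x = (\<Sum>k. (x / 2) powr \<nu> * (bessel_I_coeff \<nu> k * (x\<^sup>2 / 4) ^ k))"
    unfolding bessel_I_def bessel_I_coeff_def[symmetric]
  proof (rule suminf_cong)
    fix k
    have "(x / 2) powr (2 * real k) = ((x / 2) powr 2) powr real k" by (simp add: powr_powr)
    also have "\<dots> = (x\<^sup>2 / 4) ^ k" using assms by (simp add: powr_realpow power_divide)
    finally show "bessel_I_coeff \<nu> k * (x / 2) powr (\<nu> + 2 * real k) =
        (x / 2) powr \<nu> * (bessel_I_coeff \<nu> k * (x\<^sup>2 / 4) ^ k)"
      by (simp add: powr_add)
  qed
  also have "\<dots> = (x / 2) powr \<nu> * (\<Sum>k. bessel_I_coeff \<nu> k * (x\<^sup>2 / 4) ^ k)"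
    by (rule suminf_mult[OF summable_bessel_I_coeff[OF assms(1)]])
  also have "(x / 2) powr \<nu> = x powr \<nu> * 2 powr (- \<nu>)" using assms by (simp add: powr_divide powr_minus field_simps)
  finally show ?thesis by (simp add: reduced_I_def)
qed

section \<open>The function K through its integral representation\<close>

lemma cosh_mult_cosh: "cosh t * cosh (\<mu> * t) = (cosh ((\<mu> + 1) * t) + cosh ((\<mu> - 1) * t)) / 2" for t \<mu> :: real
  by (simp add: cosh_add cosh_diff distrib_right left_diff_distrib)

lemma sinh_mult_sinh: "sinh t * sinh (\<mu> * t) = (cosh ((\<mu> + 1) * t) - cosh ((\<mu> - 1) * t)) / 2" for t \<mu> :: real
  by (simp add: cosh_add cosh_diff distrib_right left_diff_distrib)

text \<open>An integrable majorant: cosh t \<ge> t^2/4, and completing the square absorbs the linear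
  exponent b t at the cost of b^2/x. The extra 1 in b = |\<mu>| + 1 leaves the factor exp
  (-t).\<close>

lemma exp_cosh_bound:
  fixes x \<mu> t :: real
  assumes "x > 0" "t \<ge> 0"
  shows "exp (- x * cosh t) * cosh (\<mu> * t) \<le> exp ((\<bar>\<mu>\<bar> + 1)\<^sup>2 / x) * exp (- t)"
proof -
  define b where "b = \<bar>\<mu>\<bar> + 1"
  have "cosh (\<mu> * t) = cosh (\<bar>\<mu>\<bar> * t)"
    using cosh_real_abs[of "\<mu> * t"] assms by (simp add: abs_mult)
  also have "\<dots> \<le> exp (\<bar>\<mu>\<bar> * t)"
    using cosh_plus_sinh[of "\<bar>\<mu>\<bar> * t"] sinh_real_nonneg_iff[of "\<bar>\<mu>\<bar> * t"] assms
    by (smt (verit) mult_nonneg_nonneg)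
  finally have 1: "cosh (\<mu> * t) \<le> exp (\<bar>\<mu>\<bar> * t)" .
  have "cosh t \<ge> exp t / 2" by (simp add: cosh_field_def)
  moreover have "exp t \<ge> t\<^sup>2 / 2" using exp_lower_Taylor_quadratic[OF assms(2)] assms(2) by linarith
  ultimately have "x * cosh t \<ge> x * (t\<^sup>2 / 4)" using assms by (intro mult_left_mono) auto
  moreover have "x * (t\<^sup>2 / 4) - b * t + b\<^sup>2 / x = (x * t / 2 - b)\<^sup>2 / x"
    using assms by (simp add: field_simps power2_eq_square)
  moreover have "(x * t / 2 - b)\<^sup>2 / x \<ge> 0" using assms by simp
  ultimately have "- x * cosh t + \<bar>\<mu>\<bar> * t \<le> b\<^sup>2 / x - t" by (simp add: b_def algebra_simps)
  hence 2: "exp (- x * cosh t + \<bar>\<mu>\<bar> * t) \<le> exp (b\<^sup>2 / x - t)" by simp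
  have "exp (- x * cosh t) * cosh (\<mu> * t) \<le> exp (- x * cosh t) * exp (\<bar>\<mu>\<bar> * t)"
    using 1 by (intro mult_left_mono) auto
  also have "\<dots> \<le> exp (b\<^sup>2 / x - t)" using 2 by (simp only: exp_add)
  finally show ?thesis by (simp add: b_def exp_diff exp_minus field_simps)
qed

lemma set_integrable_exp_minus: "set_integrable lborel {0..} (\<lambda>t::real. c * exp (- t))"
proof -
  have "set_integrable lborel ({0} \<union> {0<..}) (\<lambda>t::real. exp (- t))"
    by (rule set_integrable_Un) (use integrable_I0i_exp_mscale[of 1] in auto)
  moreover have "{0} \<union> {0<..} = {0::real..}" by auto
  ultimately show ?thesis by (intro set_integrable_mult_right) simp
qed

lemma set_integrable_bessel_K:
  fixes x \<mu> :: real
  assumes "x > 0"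
  shows "set_integrable lborel {0..} (\<lambda>t. exp (- x * cosh t) * cosh (\<mu> * t))"
proof (rule set_integrable_bound[OF set_integrable_exp_minus[of "exp ((\<bar>\<mu>\<bar> + 1)\<^sup>2 / x)"]])
  show "set_borel_measurable lborel {0..} (\<lambda>t. exp (- x * cosh t) * cosh (\<mu> * t))"
    unfolding set_borel_measurable_def
    by (intro borel_measurable_continuous_on_indicator borel_measurable_scaleR continuous_intros) (auto intro!: borel_measurable_continuous_onI continuous_intros)
qed (use exp_cosh_bound[OF assms] in auto)

lemma bessel_K_integrable_on:
  fixes x \<mu> :: real
  shows "x > 0 \<Longrightarrow> (\<lambda>t. exp (- x * cosh t) * cosh (\<mu> * t)) integrable_on {0..}"
  using set_borel_integral_eq_integral(1)[OF set_integrable_bessel_K] .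

lemma bessel_K_eq_integral:
  fixes x \<mu> :: real
  shows "x > 0 \<Longrightarrow> bessel_K \<mu> x = integral {0..} (\<lambda>t. exp (- x * cosh t) * cosh (\<mu> * t))"
  unfolding bessel_K_def using set_borel_integral_eq_integral(2)[OF set_integrable_bessel_K] by simp

text \<open>Differentiation under the integral sign by dominated convergence; the factor cosh t that
  it produces is distributed over the orders \<mu> + 1 and \<mu> - 1 by
  \<open>cosh_mult_cosh\<close>.\<close>

lemma bessel_K_has_real_derivative:
  assumes "x > 0"
  shows "(bessel_K \<mu> has_real_derivative - (bessel_K (\<mu> + 1) x + bessel_K (\<mu> - 1) x) / 2) (at x)"
proof -
  let ?g = "\<lambda>t. - (1 / 2) * (exp (- x * cosh t) * cosh ((\<mu> + 1) * t) + exp (- x * cosh t) * cosh ((\<mu> - 1) * t))"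
  let ?h = "\<lambda>t. (exp (- (x / 2) * cosh t) * cosh ((\<mu> + 1) * t) + exp (- (x / 2) * cosh t) * cosh ((\<mu> - 1) * t)) / 2"
  have int_g: "integral {0..} ?g = - (bessel_K (\<mu> + 1) x + bessel_K (\<mu> - 1) x) / 2"
    by (simp only: bessel_K_eq_integral[OF assms] integral_mult_right
        Henstock_Kurzweil_Integration.integral_add[OF bessel_K_integrable_on bessel_K_integrable_on, OF assms assms])
  have int_h: "?h integrable_on {0..}"
    using bessel_K_integrable_on[of "x / 2"] assms
    by (intro integrable_on_divide integrable_add) auto
  \<comment> \<open>Approaching only through points above x/2 keeps the mean value point above x/2,
    so one integrable function, with x/2 in place of x, dominates all difference quotients.\<close>
  have "((\<lambda>y. (bessel_K \<mu> y - bessel_K \<mu> x) / (y - x)) \<longlongrightarrow> integral {0..} ?g) (at x within {x/2<..})"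
    unfolding tendsto_at_iff_sequentially comp_def
  proof (intro allI impI)
    fix X :: "nat \<Rightarrow> real" assume X: "\<forall>i. X i \<in> {x/2<..} - {x}" "X \<longlonglongrightarrow> x"
    have Xpos: "X n > 0" for n using X(1)[rule_format, of n] assms by auto
    let ?f = "\<lambda>n t. (exp (- X n * cosh t) * cosh (\<mu> * t) - exp (- x * cosh t) * cosh (\<mu> * t)) / (X n - x)"
    have "(bessel_K \<mu> (X n) - bessel_K \<mu> x) / (X n - x) = integral {0..} (?f n)" for n
      using bessel_K_integrable_on[OF assms] bessel_K_integrable_on[OF Xpos[of n]]
      by (simp add: bessel_K_eq_integral[OF assms] bessel_K_eq_integral[OF Xpos[of n]]
          Henstock_Kurzweil_Integration.integral_diff)
    moreover have "(\<lambda>n. integral {0..} (?f n)) \<longlonglongrightarrow> integral {0..} ?g"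
    proof (rule dominated_convergence(2)[OF _ int_h])
      fix n show "?f n integrable_on {0..}"
        by (intro integrable_on_divide integrable_diff bessel_K_integrable_on assms Xpos)
    next
      fix n and t :: real
      let ?\<phi> = "\<lambda>y. exp (- y * cosh t)"
      have "\<exists>\<xi>. \<xi> > x / 2 \<and> ?\<phi> (X n) - ?\<phi> x = (X n - x) * (- cosh t * ?\<phi> \<xi>)"
      proof -
        have D: "(?\<phi> has_real_derivative - cosh t * ?\<phi> y) (at y)" for y
          by (auto intro!: derivative_eq_intros)
        consider "X n < x" | "X n > x" using X(1)[rule_format, of n] by force
        thus ?thesis
        proof cases
          case 1
          from MVT2[OF 1, of ?\<phi> "\<lambda>y. - cosh t * ?\<phi> y"] D
          obtain z where z: "X n < z" "?\<phi> x - ?\<phi> (X n) = (x - X n) * (- cosh t * ?\<phi> z)" by blast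
          thus ?thesis using X(1)[rule_format, of n] by (intro exI[of _ z]) (auto simp: algebra_simps)
        next
          case 2
          from MVT2[OF 2, of ?\<phi> "\<lambda>y. - cosh t * ?\<phi> y"] D
          obtain z where z: "x < z" "?\<phi> (X n) - ?\<phi> x = (X n - x) * (- cosh t * ?\<phi> z)" by blast
          thus ?thesis using assms by (intro exI[of _ z]) (auto simp: algebra_simps)
        qed
      qed
      then obtain \<xi> where \<xi>: "\<xi> > x / 2" "?\<phi> (X n) - ?\<phi> x = (X n - x) * (- cosh t * ?\<phi> \<xi>)" by blast
      have "?f n t = (?\<phi> (X n) - ?\<phi> x) / (X n - x) * cosh (\<mu> * t)"
        by (simp add: left_diff_distrib)
      also have "\<dots> = - (?\<phi> \<xi> * (cosh t * cosh (\<mu> * t)))"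
        unfolding \<xi>(2) using X(1)[rule_format, of n] by simp
      finally have "norm (?f n t) = ?\<phi> \<xi> * (cosh t * cosh (\<mu> * t))" by (simp add: abs_mult)
      also have "\<dots> \<le> exp (- (x / 2) * cosh t) * (cosh t * cosh (\<mu> * t))"
        using \<xi>(1) by (intro mult_right_mono) auto
      also have "\<dots> = ?h t" unfolding cosh_mult_cosh by (simp add: algebra_simps)
      finally show "norm (?f n t) \<le> ?h t" .
    next
      fix t :: real
      have "((\<lambda>y. exp (- y * cosh t) * cosh (\<mu> * t)) has_real_derivative
          - (exp (- x * cosh t) * (cosh t * cosh (\<mu> * t)))) (at x)"
        by (auto intro!: derivative_eq_intros)
      hence "((\<lambda>y. (exp (- y * cosh t) * cosh (\<mu> * t) - exp (- x * cosh t) * cosh (\<mu> * t)) / (y - x))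
          \<longlongrightarrow> - (exp (- x * cosh t) * (cosh t * cosh (\<mu> * t)))) (at x within UNIV)"
        by (simp add: has_field_derivative_iff)
      with X have "(\<lambda>n. ?f n t) \<longlonglongrightarrow> - (exp (- x * cosh t) * (cosh t * cosh (\<mu> * t)))"
        unfolding tendsto_at_iff_sequentially comp_def by auto
      thus "(\<lambda>n. ?f n t) \<longlonglongrightarrow> ?g t" unfolding cosh_mult_cosh by (simp add: algebra_simps add_divide_distrib)
    qed
    ultimately show "(\<lambda>n. (bessel_K \<mu> (X n) - bessel_K \<mu> x) / (X n - x)) \<longlonglongrightarrow> integral {0..} ?g" by (simp only:)
  qed
  moreover have "at x within {x/2<..} = at x" using assms by (intro at_within_open) auto
  ultimately show ?thesis by (simp only: has_field_derivative_iff int_g)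
qed

text \<open>Integration by parts in disguise: \<open>?f\<close> is the derivative of exp (-x cosh t)
  sinh (\<mu> t), which vanishes at 0 and at infinity, so the integral of \<open>?f\<close> is 0;
  \<open>sinh_mult_sinh\<close> separates the orders.\<close>

lemma bessel_K_rec:
  assumes "x > 0"
  shows "bessel_K (\<mu> + 1) x - bessel_K (\<mu> - 1) x = 2 * \<mu> / x * bessel_K \<mu> x"
proof -
  let ?E = "\<lambda>t. exp (- x * cosh t)"
  let ?F = "\<lambda>t. ?E t * sinh (\<mu> * t)"
  let ?f = "\<lambda>t. \<mu> * (?E t * cosh (\<mu> * t)) - x / 2 * (?E t * cosh ((\<mu> + 1) * t)) + x / 2 * (?E t * cosh ((\<mu> - 1) * t))"
  note int = set_integrable_bessel_K[OF assms]
  have f_int: "set_integrable lborel {0..} ?f"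
    by (intro set_integral_add set_integral_diff set_integrable_mult_right int)
  have "(LBINT t=0..\<infinity>. ?f t) = 0 - 0"
  proof (rule interval_integral_FTC_integrable)
    fix t :: real
    have "?f t = ?E t * (\<mu> * cosh (\<mu> * t)) - x * ?E t * (sinh t * sinh (\<mu> * t))"
      unfolding sinh_mult_sinh by (simp add: algebra_simps diff_divide_distrib)
    thus "(?F has_vector_derivative ?f t) (at t)"
      unfolding has_real_derivative_iff_has_vector_derivative[symmetric]
      by (auto intro!: derivative_eq_intros simp: algebra_simps)
    show "isCont ?f t" by (intro continuous_intros)
  next
    show "set_integrable lborel (einterval 0 \<infinity>) ?f"
      by (rule set_integrable_subset[OF f_int]) (auto simp: einterval_def zero_ereal_def)
    have "(?F \<longlongrightarrow> ?F 0) (at_right 0)"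
      by (intro tendsto_intros)
    thus "((?F \<circ> real_of_ereal) \<longlongrightarrow> 0) (at_right 0)"
      by (simp add: zero_ereal_def ereal_tendsto_simps)
    have "(?F \<longlongrightarrow> 0) at_top"
    proof (rule Lim_null_comparison)
      show "eventually (\<lambda>t. norm (?F t) \<le> exp ((\<bar>\<mu>\<bar> + 1)\<^sup>2 / x) * exp (- t)) at_top"
        using eventually_ge_at_top[of 0]
      proof eventually_elim
        case (elim t)
        have "\<bar>sinh (\<mu> * t)\<bar> \<le> cosh (\<mu> * t)"
          using sinh_le_cosh_real[of "\<bar>\<mu> * t\<bar>"] by simp
        hence "norm (?F t) \<le> ?E t * cosh (\<mu> * t)" by (simp add: abs_mult)
        also have "\<dots> \<le> exp ((\<bar>\<mu>\<bar> + 1)\<^sup>2 / x) * exp (- t)" by (rule exp_cosh_bound[OF assms elim])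
        finally show ?case .
      qed
      have "((\<lambda>t::real. exp (- t)) \<longlongrightarrow> 0) at_top"
        by (rule filterlim_compose[OF exp_at_bot filterlim_uminus_at_bot_at_top])
      from tendsto_mult_left[OF this] show "((\<lambda>t. exp ((\<bar>\<mu>\<bar> + 1)\<^sup>2 / x) * exp (- t)) \<longlongrightarrow> 0) at_top" by simp
    qed
    thus "((?F \<circ> real_of_ereal) \<longlongrightarrow> 0) (at_left \<infinity>)" by (simp add: ereal_tendsto_simps)
  qed auto
  hence "(LBINT t:{0<..}. ?f t) = 0" by (simp add: interval_lebesgue_integral_0_infty)
  moreover have "(LBINT t:{0<..}. ?f t) = (LBINT t:{0..}. ?f t)"
  proof (rule set_integral_cong_set)
    have "set_integrable lborel {0<..} ?f" by (rule set_integrable_subset[OF f_int]) auto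
    thus "set_borel_measurable lborel {0<..} ?f"
      unfolding set_integrable_def set_borel_measurable_def by (rule borel_measurable_integrable)
    show "set_borel_measurable lborel {0..} ?f"
      using f_int unfolding set_integrable_def set_borel_measurable_def by (rule borel_measurable_integrable)
    show "AE x in lborel. (x \<in> {0::real..}) = (x \<in> {0<..})"
      by (rule AE_I[of _ _ "{0}"]) auto
  qed
  moreover have "(LBINT t:{0..}. ?f t) = \<mu> * bessel_K \<mu> x - x / 2 * bessel_K (\<mu> + 1) x + x / 2 * bessel_K (\<mu> - 1) x"
    unfolding bessel_K_def
    by (subst set_integral_add set_integral_diff; (intro set_integral_add set_integral_diff set_integrable_mult_right int)?)+
      (simp only: set_integral_mult_right)
  ultimately show ?thesis using assms by (simp add: field_simps)
qed

lemma bessel_K_pos: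
  assumes "x > 0"
  shows "bessel_K \<mu> x > 0"
proof -
  let ?f = "\<lambda>t. exp (- x * cosh t) * cosh (\<mu> * t)"
  have "integral {0..} ?f \<ge> integral {0..1::real} (\<lambda>t. exp (- x * cosh 1))"
  proof (rule order_trans)
    show "integral {0..1::real} (\<lambda>t. exp (- x * cosh 1)) \<le> integral {0..1} ?f"
    proof (rule Henstock_Kurzweil_Integration.integral_le)
      show "?f integrable_on {0..1}" by (intro integrable_continuous_real continuous_intros)
      fix t :: real assume t: "t \<in> {0..1}"
      hence "cosh t \<le> cosh 1" by (subst cosh_real_nonneg_le_iff) auto
      hence "exp (- x * cosh 1) * 1 \<le> exp (- x * cosh t) * cosh (\<mu> * t)"
        using assms cosh_real_ge_1[of "\<mu> * t"] by (intro mult_mono) auto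
      thus "exp (- x * cosh 1) \<le> ?f t" by simp
    qed (auto intro: integrable_continuous_real)
    show "integral {0..1} ?f \<le> integral {0..} ?f"
      by (intro integral_subset_le bessel_K_integrable_on assms integrable_continuous_real continuous_intros) auto
  qed
  moreover have "integral {0..1::real} (\<lambda>t. exp (- x * cosh 1)) > 0" by simp
  ultimately show ?thesis unfolding bessel_K_eq_integral[OF assms] by linarith
qed

text \<open>The integrand is monotone in the modulus of the order. Applied to \<nu> and \<nu> + 1 it
  compares \<open>k\<close> with its derivative.\<close>

lemma bessel_K_mono_order:
  assumes "x > 0" "\<bar>\<mu>\<bar> \<le> \<bar>\<mu>'\<bar>"
  shows "bessel_K \<mu> x \<le> bessel_K \<mu>' x"
  unfolding bessel_K_eq_integral[OF assms(1)]
proof (intro Henstock_Kurzweil_Integration.integral_le bessel_K_integrable_on assms mult_left_mono)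
  fix t :: real
  have "cosh \<bar>\<mu> * t\<bar> \<le> cosh \<bar>\<mu>' * t\<bar>"
    using assms by (subst cosh_real_nonneg_le_iff) (auto simp: abs_mult intro: mult_right_mono)
  thus "cosh (\<mu> * t) \<le> cosh (\<mu>' * t)" by simp
qed auto

text \<open>Since cosh t \<ge> 1, moving from 1 to x costs at least a factor exp (1 - x) in the
  integrand. The power of x in the true asymptotics is given away.\<close>

lemma bessel_K_exp_decay:
  assumes "x \<ge> 1"
  shows "bessel_K \<mu> x \<le> exp 1 * bessel_K \<mu> 1 * exp (- x)"
proof -
  have "bessel_K \<mu> x \<le> integral {0..} (\<lambda>t. exp (1 - x) * (exp (- 1 * cosh t) * cosh (\<mu> * t)))"
    unfolding bessel_K_eq_integral[of x, OF order.strict_trans2[OF zero_less_one assms]]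
  proof (intro Henstock_Kurzweil_Integration.integral_le bessel_K_integrable_on integrable_on_mult_right)
    fix t :: real
    have "(x - 1) * 1 \<le> (x - 1) * cosh t" using assms cosh_real_ge_1[of t] by (intro mult_left_mono) auto
    hence "- x * cosh t \<le> (1 - x) - 1 * cosh t" by (simp add: algebra_simps)
    hence "exp (- x * cosh t) \<le> exp ((1 - x) + - 1 * cosh t)" by simp
    also have "\<dots> = exp (1 - x) * exp (- 1 * cosh t)" by (rule exp_add)
    finally show "exp (- x * cosh t) * cosh (\<mu> * t) \<le> exp (1 - x) * (exp (- 1 * cosh t) * cosh (\<mu> * t))"
      by (simp add: mult.assoc[symmetric] mult_right_mono)
  qed (use assms in auto)
  also have "\<dots> = exp (1 - x) * bessel_K \<mu> 1"
    by (simp only: bessel_K_eq_integral[OF zero_less_one] integral_mult_right)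
  finally show ?thesis by (simp add: exp_diff exp_minus field_simps)
qed

text \<open>Substituting u = (x/2) exp t, with the two exponentials of cosh (\<mu> t) kept apart. In
  this form x enters the integrand only through x^2/u, so that letting x tend to 0 leaves a Gamma
  integrand.\<close>

lemma bessel_K_substitution:
  assumes "x > 0"
  shows "((\<lambda>u. exp (- u - x\<^sup>2 / (4 * u)) * ((2 * u) powr \<mu> + (x\<^sup>2 / (2 * u)) powr \<mu>) / (2 * u))
           has_integral x powr \<mu> * bessel_K \<mu> x) {x/2..}"
proof -
  let ?f = "\<lambda>u. exp (- u - x\<^sup>2 / (4 * u)) * ((2 * u) powr \<mu> + (x\<^sup>2 / (2 * u)) powr \<mu>) / (2 * u)"
  define g where "g = (\<lambda>t. x / 2 * exp t)"
  have img: "g ` {0..} = {x/2..}"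
  proof (intro equalityI subsetI)
    fix u assume u: "u \<in> {x/2..}"
    hence "2 * u / x \<ge> 1" using assms by (simp add: field_simps)
    thus "u \<in> g ` {0..}" using assms u
      by (intro image_eqI[of _ _ "ln (2 * u / x)"]) (auto simp: g_def exp_ln_iff)
  qed (use assms in \<open>auto simp: g_def\<close>)
  have der: "(g has_field_derivative g t) (at t within {0..})" for t
    unfolding g_def by (auto intro!: derivative_eq_intros)
  have inj: "inj_on g {0..}" using assms by (auto simp: inj_on_def g_def)
  have eq: "\<bar>g t\<bar> * ?f (g t) = x powr \<mu> * (exp (- x * cosh t) * cosh (\<mu> * t))" for t
  proof -
    have gpos: "g t > 0" using assms by (simp add: g_def)
    have e1: "2 * g t = x * exp t" by (simp add: g_def)
    have e2: "x\<^sup>2 / (2 * g t) = x * exp (- t)" using assms by (simp add: g_def exp_minus field_simps power2_eq_square)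
    have e3: "x\<^sup>2 / (4 * g t) = x * exp (- t) / 2" using assms by (simp add: g_def exp_minus field_simps power2_eq_square)
    have e4: "- g t - x\<^sup>2 / (4 * g t) = - x * cosh t" unfolding e3 by (simp add: g_def cosh_field_def field_simps)
    have p1: "(x * exp s) powr \<mu> = x powr \<mu> * exp (\<mu> * s)" for s
      using assms by (simp add: powr_mult exp_powr_real)
    have "\<bar>g t\<bar> * ?f (g t) = exp (- g t - x\<^sup>2 / (4 * g t)) * ((2 * g t) powr \<mu> + (x\<^sup>2 / (2 * g t)) powr \<mu>) / 2"
      using gpos by simp
    also have "\<dots> = exp (- x * cosh t) * (x powr \<mu> * exp (\<mu> * t) + x powr \<mu> * exp (\<mu> * - t)) / 2"
      unfolding e4 unfolding e2 unfolding e1 p1 ..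
    also have "\<dots> = x powr \<mu> * (exp (- x * cosh t) * cosh (\<mu> * t))"
      by (simp add: cosh_field_def algebra_simps)
    finally show ?thesis .
  qed
  have "(\<lambda>t. x powr \<mu> * (exp (- x * cosh t) * cosh (\<mu> * t))) absolutely_integrable_on {0..}"
    by (intro nonnegative_absolutely_integrable_1 integrable_on_mult_right bessel_K_integrable_on assms) auto
  moreover have "integral {0..} (\<lambda>t. x powr \<mu> * (exp (- x * cosh t) * cosh (\<mu> * t))) = x powr \<mu> * bessel_K \<mu> x"
    by (simp only: bessel_K_eq_integral[OF assms] integral_mult_right)
  ultimately have "?f absolutely_integrable_on g ` {0..} \<and> integral (g ` {0..}) ?f = x powr \<mu> * bessel_K \<mu> x"
    using has_absolute_integral_change_of_variables_1'[of "{0..}" g g ?f "x powr \<mu> * bessel_K \<mu> x", OF _ der inj]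
    unfolding eq by auto
  hence "?f integrable_on {x/2..}" "integral {x/2..} ?f = x powr \<mu> * bessel_K \<mu> x"
    unfolding img absolutely_integrable_on_def by blast+
  thus ?thesis using integrable_integral by fastforce
qed

text \<open>Dominated convergence in \<open>bessel_K_substitution\<close>. On the range u \<ge> x/2
  one has x^2/(2u) \<le> 2u, so for \<mu> > 0 the second power is at most the first and twice the
  Gamma integrand dominates; pointwise the second power tends to 0.\<close>

lemma bessel_K_at_0:
  assumes "\<mu> > 0"
  shows "((\<lambda>x. x powr \<mu> * bessel_K \<mu> x) \<longlongrightarrow> 2 powr (\<mu> - 1) * Gamma \<mu>) (at_right 0)"
  unfolding tendsto_at_iff_sequentially comp_def
proof (intro allI impI)
  fix X :: "nat \<Rightarrow> real" assume X: "\<forall>i. X i \<in> {0<..} - {0}" "X \<longlonglongrightarrow> 0"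
  have Xpos: "X n > 0" for n using X(1) by auto
  let ?f = "\<lambda>x u. exp (- u - x\<^sup>2 / (4 * u)) * ((2 * u) powr \<mu> + (x\<^sup>2 / (2 * u)) powr \<mu>) / (2 * u)"
  let ?F = "\<lambda>n u. if u \<in> {X n/2..} then ?f (X n) u else 0"
  let ?g = "\<lambda>u. 2 powr (\<mu> - 1) * (u powr (\<mu> - 1) / exp u)"
  have scale: "(2 * u) powr \<mu> / (2 * u) = 2 powr (\<mu> - 1) * u powr (\<mu> - 1)" if "u > 0" for u
    using that by (simp add: powr_diff powr_mult)
  have G: "((\<lambda>u. c * (u powr (\<mu> - 1) / exp u)) has_integral c * Gamma \<mu>) {0<..}" for c
  proof -
    have "((\<lambda>u. c * (u powr (\<mu> - 1) / exp u)) has_integral c * Gamma \<mu>) {0..}"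
      by (intro has_integral_mult_right Gamma_integral_real assms)
    thus ?thesis
      by (subst (asm) has_integral_spike_set_eq[where T = "{0<..}"]) (auto intro: negligible_subset[of "{0}"])
  qed
  have F_int: "(?F n has_integral X n powr \<mu> * bessel_K \<mu> (X n)) {0<..}" for n
  proof -
    have "(?f (X n) has_integral X n powr \<mu> * bessel_K \<mu> (X n)) {X n/2..}"
      by (rule bessel_K_substitution[OF Xpos])
    moreover have "{X n/2..} \<subseteq> {0<..}" using Xpos[of n] by auto
    ultimately show ?thesis by (simp only: has_integral_restrict)
  qed
  have "(\<lambda>n. integral {0<..} (?F n)) \<longlonglongrightarrow> integral {0<..} ?g"
  proof (rule dominated_convergence(2))
    show "?F n integrable_on {0<..}" for n using F_int by blast
    show "(\<lambda>u. 2 * 2 powr (\<mu> - 1) * (u powr (\<mu> - 1) / exp u)) integrable_on {0<..}"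
      using G by blast
    fix n and u :: real assume "u \<in> {0<..}"
    hence u: "u > 0" by simp
    show "norm (?F n u) \<le> 2 * 2 powr (\<mu> - 1) * (u powr (\<mu> - 1) / exp u)"
    proof (cases "u \<ge> X n / 2")
      case True
      have "(X n)\<^sup>2 \<le> (2 * u)\<^sup>2" using True Xpos[of n] by (intro power_mono) auto
      hence "(X n)\<^sup>2 / (2 * u) \<le> 2 * u" using u by (simp add: field_simps power2_eq_square)
      hence "((X n)\<^sup>2 / (2 * u)) powr \<mu> \<le> (2 * u) powr \<mu>" using u assms by (intro powr_mono2) auto
      hence "?f (X n) u \<le> exp (- u) * ((2 * u) powr \<mu> + (2 * u) powr \<mu>) / (2 * u)"
        using u by (intro divide_right_mono mult_mono) auto
      moreover have "norm (?f (X n) u) = ?f (X n) u" using u by simp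
      ultimately have "norm (?f (X n) u) \<le> exp (- u) * ((2 * u) powr \<mu> + (2 * u) powr \<mu>) / (2 * u)"
        by linarith
      also have "\<dots> = 2 * exp (- u) * ((2 * u) powr \<mu> / (2 * u))" using u by (simp add: field_simps)
      also have "\<dots> = 2 * 2 powr (\<mu> - 1) * (u powr (\<mu> - 1) / exp u)"
        unfolding scale[OF u] by (simp add: exp_minus field_simps)
      finally show ?thesis using True by simp
    qed (use u in auto)
  next
    fix u :: real assume "u \<in> {0<..}"
    hence u: "u > 0" by simp
    have "(\<lambda>n. ?f (X n) u) \<longlonglongrightarrow> exp (- u - 0\<^sup>2 / (4 * u)) * ((2 * u) powr \<mu> + (0\<^sup>2 / (2 * u)) powr \<mu>) / (2 * u)"
      using u assms by (intro tendsto_intros X(2) tendsto_powr') (auto intro!: always_eventually)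
    also have "exp (- u - 0\<^sup>2 / (4 * u)) * ((2 * u) powr \<mu> + (0\<^sup>2 / (2 * u)) powr \<mu>) / (2 * u) = exp (- u) * ((2 * u) powr \<mu> / (2 * u))"
      by simp
    also have "\<dots> = ?g u" unfolding scale[OF u] by (simp add: exp_minus field_simps)
    finally have "(\<lambda>n. ?f (X n) u) \<longlonglongrightarrow> ?g u" .
    moreover have "eventually (\<lambda>n. X n < 2 * u) sequentially"
      using X(2) u by (intro order_tendstoD) auto
    hence "eventually (\<lambda>n. ?f (X n) u = ?F n u) sequentially" by eventually_elim auto
    ultimately show "(\<lambda>n. ?F n u) \<longlonglongrightarrow> ?g u" by (rule Lim_transform_eventually)
  qed
  thus "(\<lambda>n. X n powr \<mu> * bessel_K \<mu> (X n)) \<longlonglongrightarrow> 2 powr (\<mu> - 1) * Gamma \<mu>"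
    using integral_unique[OF F_int] integral_unique[OF G] by simp
qed

text \<open>An interface to the homogeneous equation x u'' + a u' - x u = 0: \<open>i\<close> is the
  solution regular at 0, \<open>k\<close> the one decaying at infinity, \<open>i'\<close> and
  \<open>k'\<close> are their derivatives. The limit of x^a (-k') is the reciprocal of the limit
  \<open>i0\<close> of \<open>i\<close>, which is consistent with a Wronskian normalised to
  1.\<close>

locale bessel_pair =
  fixes a :: real and i i' k k' :: "real \<Rightarrow> real" and i0 :: real
  assumes a_pos: "a > 0"
    and i_deriv: "x > 0 \<Longrightarrow> (i has_real_derivative i' x) (at x)"
    and i'_deriv: "x > 0 \<Longrightarrow> (i' has_real_derivative i x - a / x * i' x) (at x)"
    and k_deriv: "x > 0 \<Longrightarrow> (k has_real_derivative k' x) (at x)"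
    and k'_deriv: "x > 0 \<Longrightarrow> (k' has_real_derivative k x - a / x * k' x) (at x)"
    and i_pos: "x > 0 \<Longrightarrow> i x > 0"
    and i'_nonneg: "x > 0 \<Longrightarrow> i' x \<ge> 0"
    and i'_le: "x > 0 \<Longrightarrow> i' x \<le> i x"
    and k_pos: "x > 0 \<Longrightarrow> k x > 0"
    and k_le: "x > 0 \<Longrightarrow> k x \<le> - k' x"
    and i_0: "(i \<longlongrightarrow> i0) (at_right 0)" "i0 > 0"
    and i'_0: "(i' \<longlongrightarrow> 0) (at_right 0)"
    and k'_0: "((\<lambda>x. x powr a * (- k' x)) \<longlongrightarrow> 1 / i0) (at_right 0)"
    and k'_decay: "\<exists>C. \<forall>x\<ge>1. - k' x \<le> C * (x * exp (- x))"
    and wronskian: "x > 0 \<Longrightarrow> x powr a * (i' x * k x - i x * k' x) = 1"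

text \<open>\<open>bessel_K_rec\<close> eliminates the order \<nu> - 1, and what remains of it
  cancels against the derivative of the power.\<close>

lemma reduced_K_has_real_derivative:
  assumes "x > 0"
  shows "(reduced_K \<nu> has_real_derivative - x * reduced_K (\<nu> + 1) x) (at x)"
proof -
  have "(reduced_K \<nu> has_real_derivative - \<nu> * x powr (- \<nu> - 1) * bessel_K \<nu> x
      + (- (bessel_K (\<nu> + 1) x + bessel_K (\<nu> - 1) x) / 2) * x powr (- \<nu>)) (at x)"
    unfolding reduced_K_def[abs_def]
    by (rule DERIV_mult has_real_derivative_powr bessel_K_has_real_derivative assms)+
  also have "- \<nu> * x powr (- \<nu> - 1) * bessel_K \<nu> x
      + (- (bessel_K (\<nu> + 1) x + bessel_K (\<nu> - 1) x) / 2) * x powr (- \<nu>) = - x * reduced_K (\<nu> + 1) x"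
  proof -
    have e: "bessel_K (\<nu> - 1) x = bessel_K (\<nu> + 1) x - 2 * \<nu> / x * bessel_K \<nu> x"
      using bessel_K_rec[OF assms, of \<nu>] by simp
    have p: "x powr (- \<nu> - 1) = x powr (- \<nu>) / x" "x powr (- (\<nu> + 1)) = x powr (- \<nu>) / x"
      using assms by (simp_all add: powr_diff powr_minus powr_add field_simps)
    show ?thesis using assms unfolding reduced_K_def p e by (simp add: field_simps)
  qed
  finally show ?thesis .
qed

lemma reduced_K_rec:
  assumes "x > 0"
  shows "reduced_K \<nu> x = x\<^sup>2 * reduced_K (\<nu> + 2) x - 2 * (\<nu> + 1) * reduced_K (\<nu> + 1) x"
proof -
  have p: "x powr (- (\<nu> + 2)) = x powr (- \<nu>) / x\<^sup>2" "x powr (- (\<nu> + 1)) = x powr (- \<nu>) / x"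
    using assms by (simp_all add: powr_diff powr_minus powr_add field_simps)
  have e: "bessel_K \<nu> x = bessel_K (\<nu> + 2) x - 2 * (\<nu> + 1) / x * bessel_K (\<nu> + 1) x"
    using bessel_K_rec[OF assms, of "\<nu> + 1"] by (simp add: add_ac)
  show ?thesis using assms unfolding reduced_K_def p e by (simp add: field_simps)
qed

lemma reduced_K_pos: "x > 0 \<Longrightarrow> reduced_K \<nu> x > 0"
  by (simp add: reduced_K_def bessel_K_pos)

lemma bessel_pair_reduced:
  assumes \<nu>: "\<nu> > - 1/2"
  shows "bessel_pair (2 * \<nu> + 1) (reduced_I \<nu>) (\<lambda>x. x * reduced_I (\<nu> + 1) x)
    (reduced_K \<nu>) (\<lambda>x. - x * reduced_K (\<nu> + 1) x) (reduced_I \<nu> 0)"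
proof -
  define a where "a = 2 * \<nu> + 1"
  define i where "i = reduced_I \<nu>"
  define i' where "i' = (\<lambda>x. x * reduced_I (\<nu> + 1) x)"
  define k where "k = reduced_K \<nu>"
  define k' where "k' = (\<lambda>x. - x * reduced_K (\<nu> + 1) x)"
  have \<nu>': "\<nu> > -1" "\<nu> + 1 > -1" "\<nu> + 1 > 0" using \<nu> by auto
  have a: "a > 0" using \<nu> by (simp add: a_def)
  have i_deriv: "(i has_real_derivative i' x) (at x)" for x
    unfolding i_def i'_def by (rule reduced_I_has_real_derivative[OF \<nu>'(1)])
  \<comment> \<open>Written without the quotient a/x, the equation for \<open>i\<close> holds at 0
    as well; the monotonicity argument for \<open>i'_le\<close> and the limits of \<open>i'\<close>
    start there.\<close>
  have i'_deriv0: "(i' has_real_derivative i x - a * reduced_I (\<nu> + 1) x) (at x)" for x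
  proof -
    have "(i' has_real_derivative 1 * reduced_I (\<nu> + 1) x + x * reduced_I (\<nu> + 1 + 1) x * x) (at x)"
      unfolding i'_def by (rule DERIV_mult DERIV_ident reduced_I_has_real_derivative \<nu>')+
    moreover have "1 * reduced_I (\<nu> + 1) x + x * reduced_I (\<nu> + 1 + 1) x * x = i x - a * reduced_I (\<nu> + 1) x"
      unfolding i_def a_def reduced_I_rec[OF \<nu>'(1), of x]
      by (simp add: algebra_simps power2_eq_square)
    ultimately show ?thesis by simp
  qed
  have i'_deriv: "(i' has_real_derivative i x - a / x * i' x) (at x)" if "x > 0" for x
    using i'_deriv0[of x] that by (simp add: i'_def)
  have k_deriv: "(k has_real_derivative k' x) (at x)" if "x > 0" for x
    unfolding k_def k'_def by (rule reduced_K_has_real_derivative[OF that])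
  have k'_deriv: "(k' has_real_derivative k x - a / x * k' x) (at x)" if "x > 0" for x
  proof -
    have "((\<lambda>x. - x) has_real_derivative -1) (at x)" by (auto intro!: derivative_eq_intros)
    hence "(k' has_real_derivative (- 1) * reduced_K (\<nu> + 1) x + (- x * reduced_K (\<nu> + 1 + 1) x) * (- x)) (at x)"
      unfolding k'_def by (rule DERIV_mult) (rule reduced_K_has_real_derivative[OF that])
    moreover have "(- 1) * reduced_K (\<nu> + 1) x + (- x * reduced_K (\<nu> + 1 + 1) x) * (- x) = k x - a / x * k' x"
    proof -
      have "a / x * k' x = - a * reduced_K (\<nu> + 1) x" using that by (simp add: k'_def)
      thus ?thesis unfolding k_def a_def reduced_K_rec[OF that, of \<nu>]
        by (simp add: algebra_simps power2_eq_square)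
    qed
    ultimately show ?thesis by simp
  qed
  have i_pos: "i x > 0" for x unfolding i_def by (rule reduced_I_pos[OF \<nu>'(1)])
  have i'_nonneg: "i' x \<ge> 0" if "x \<ge> 0" for x
    using reduced_I_pos[OF \<nu>'(2), of x] that by (simp add: i'_def)
  have i'_le: "i' x \<le> i x" if "x > 0" for x
  proof -
    \<comment> \<open>The equation makes the derivative of exp x (i - i') equal to exp x times a
      \<open>reduced_I (\<nu> + 1) x\<close>, which is positive, and the value at 0 is i(0) >
      0.\<close>
    let ?d = "\<lambda>x. exp x * (i x - i' x)"
    have "?d 0 \<le> ?d x"
    proof (rule DERIV_nonneg_imp_nondecreasing[of 0 x ?d])
      fix y :: real
      have "(?d has_real_derivative exp y * (i y - i' y) + (i' y - (i y - a * reduced_I (\<nu> + 1) y)) * exp y) (at y)"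
        by (rule DERIV_mult DERIV_diff DERIV_exp i_deriv i'_deriv0)+
      moreover have "exp y * (i y - i' y) + (i' y - (i y - a * reduced_I (\<nu> + 1) y)) * exp y
          = exp y * (a * reduced_I (\<nu> + 1) y)" by (simp add: algebra_simps)
      ultimately show "\<exists>d. (?d has_real_derivative d) (at y) \<and> d \<ge> 0"
        using a reduced_I_pos[OF \<nu>'(2), of y] by auto
    qed (use that in auto)
    moreover have "?d 0 > 0" using i_pos[of 0] by (simp add: i'_def)
    ultimately have "?d x > 0" by linarith
    thus ?thesis by (simp add: zero_less_mult_iff)
  qed
  have k_pos: "k x > 0" if "x > 0" for x unfolding k_def by (rule reduced_K_pos[OF that])
  have mk': "- k' x = x powr (- \<nu>) * bessel_K (\<nu> + 1) x" if "x > 0" for x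
  proof -
    have "x powr (- (\<nu> + 1)) = x powr (- \<nu>) / x"
      using that by (simp_all add: powr_diff powr_minus powr_add field_simps)
    thus ?thesis using that unfolding k'_def reduced_K_def by simp
  qed
  have k_le: "k x \<le> - k' x" if "x > 0" for x
  proof -
    \<comment> \<open>|\<nu>| \<le> |\<nu> + 1| holds because \<nu> > -1/2.\<close>
    have "bessel_K \<nu> x \<le> bessel_K (\<nu> + 1) x" using that \<nu> by (intro bessel_K_mono_order) auto
    thus ?thesis using mk'[OF that] that by (simp add: k_def reduced_K_def)
  qed
  have i_0: "(i \<longlongrightarrow> i 0) (at_right 0)" "(i' \<longlongrightarrow> 0) (at_right 0)"
    using DERIV_isCont[OF i_deriv, of 0] DERIV_isCont[OF i'_deriv0, of 0]
    by (auto simp: isCont_def i'_def intro: filterlim_mono[OF _ order_refl at_le])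
  \<comment> \<open>The reciprocal 2^\<nu> Gamma (\<nu> + 1) is exactly the limit in
    \<open>bessel_K_at_0\<close> for the order \<nu> + 1; this coincidence makes the Wronskian
    constant equal to 1.\<close>
  have i00: "i 0 = 1 / (2 powr \<nu> * Gamma (\<nu> + 1))"
    using \<nu>' by (simp add: i_def reduced_I_0 rGamma_inverse_Gamma powr_minus field_simps)
  have "((\<lambda>x. x powr (\<nu> + 1) * bessel_K (\<nu> + 1) x) \<longlongrightarrow> 1 / i 0) (at_right 0)"
    using bessel_K_at_0[OF \<nu>'(3)] by (simp add: i00)
  hence k'_0: "((\<lambda>x. x powr a * (- k' x)) \<longlongrightarrow> 1 / i 0) (at_right 0)"
  proof (rule Lim_transform_eventually)
    show "eventually (\<lambda>x. x powr (\<nu> + 1) * bessel_K (\<nu> + 1) x = x powr a * (- k' x)) (at_right 0)"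
      using eventually_at_right_less[of 0]
    proof eventually_elim
      case (elim x)
      have "x powr a * x powr (- \<nu>) = x powr (\<nu> + 1)"
        by (simp add: a_def powr_add[symmetric])
      thus ?case unfolding mk'[OF elim] by (metis mult.assoc)
    qed
  qed
  have "- k' x \<le> exp 1 * bessel_K (\<nu> + 1) 1 * (x * exp (- x))" if "x \<ge> 1" for x
  proof -
    \<comment> \<open>Here -\<nu> < 1/2; the exponent 1 avoids a case distinction on the sign of
      \<nu>.\<close>
    have "x powr (- \<nu>) \<le> x powr 1" using that \<nu> by (intro powr_mono) auto
    hence "x powr (- \<nu>) * bessel_K (\<nu> + 1) x \<le> x * (exp 1 * bessel_K (\<nu> + 1) 1 * exp (- x))"
      using that bessel_K_exp_decay[OF that, of "\<nu> + 1"] bessel_K_pos[of x "\<nu> + 1"]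
      by (intro mult_mono) auto
    thus ?thesis using mk'[of x] that by (simp add: mult_ac)
  qed
  hence k'_decay: "\<exists>C. \<forall>x\<ge>1. - k' x \<le> C * (x * exp (- x))" by blast
  let ?W = "\<lambda>x. x powr a * (i' x * k x - i x * k' x)"
  have "\<exists>c. \<forall>x\<in>{0<..}. ?W x = c"
  proof (rule has_field_derivative_zero_constant)
    fix x :: real assume "x \<in> {0<..}"
    hence x: "x > 0" by simp
    have "(?W has_real_derivative a * x powr (a - 1) * (i' x * k x - i x * k' x) +
        (((i x - a / x * i' x) * k x + k' x * i' x) - (i' x * k' x + (k x - a / x * k' x) * i x)) * x powr a) (at x)"
      by (rule DERIV_mult DERIV_diff has_real_derivative_powr i_deriv i'_deriv k_deriv k'_deriv x)+
    moreover have "a * x powr (a - 1) * (i' x * k x - i x * k' x) +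
        (((i x - a / x * i' x) * k x + k' x * i' x) - (i' x * k' x + (k x - a / x * k' x) * i x)) * x powr a = 0"
      using x by (simp add: powr_diff field_simps)
    ultimately show "(?W has_real_derivative 0) (at x within {0<..})"
      by (metis has_field_derivative_at_within)
  qed auto
  then obtain c where c: "\<And>x. x > 0 \<Longrightarrow> ?W x = c" by auto
  \<comment> \<open>The constant value is read off at 0: x^a k \<le> x^a (-k') stays bounded while
    i' tends to 0, so only the term x^a (-k') i survives, with limit (1/i0) i0.\<close>
  have "(?W \<longlongrightarrow> 1) (at_right 0)"
  proof -
    have "((\<lambda>x. x powr a * k x * i' x) \<longlongrightarrow> 0) (at_right 0)"
    proof (rule Lim_null_comparison)
      show "eventually (\<lambda>x. norm (x powr a * k x * i' x) \<le> x powr a * (- k' x) * i' x) (at_right 0)"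
        using eventually_at_right_less[of 0]
      proof eventually_elim
        case (elim x)
        have "norm (x powr a * k x * i' x) = x powr a * k x * i' x"
          using elim k_pos[of x] i'_nonneg[of x] by simp
        also have "\<dots> \<le> x powr a * (- k' x) * i' x"
          using elim k_le[of x] i'_nonneg[of x] by (intro mult_right_mono mult_left_mono) auto
        finally show ?case .
      qed
      from tendsto_mult[OF k'_0 i_0(2)]
      show "((\<lambda>x. x powr a * (- k' x) * i' x) \<longlongrightarrow> 0) (at_right 0)" by simp
    qed
    from tendsto_add[OF this tendsto_mult[OF k'_0 i_0(1)]]
    show ?thesis using i_pos[of 0] by (simp add: algebra_simps)
  qed
  moreover have "(?W \<longlongrightarrow> c) (at_right 0)"
    by (rule Lim_transform_eventually[OF tendsto_const])
      (use eventually_at_right_less[of 0] c in \<open>auto elim!: eventually_mono\<close>)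
  ultimately have "c = 1" using tendsto_unique[of "at_right (0::real)"] by auto
  have "bessel_pair a i i' k k' (i 0)"
    by unfold_locales
      (use a i_deriv i'_deriv k_deriv k'_deriv i_pos i'_nonneg i'_le k_pos k_le i_0 k'_0 k'_decay c \<open>c = 1\<close> in auto)
  thus ?thesis unfolding a_def i_def i'_def k_def k'_def .
qed

section \<open>The equation on a half-line\<close>

lemma set_integrable_lborel_imp_absolutely_integrable_on:
  fixes f :: "real \<Rightarrow> real"
  assumes "set_integrable lborel S f"
  shows "f absolutely_integrable_on S"
proof -
  have "(\<lambda>x. indicat_real S x *\<^sub>R f x) \<in> borel_measurable lborel"
    using assms unfolding set_integrable_def by (rule borel_measurable_integrable)
  from integrable_completion[OF this] show ?thesis
    using assms unfolding set_integrable_def by blast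
qed

lemma absolutely_integrable_on_subset_Ioi:
  fixes f :: "real \<Rightarrow> real"
  assumes "f absolutely_integrable_on {0<..}" "T \<subseteq> {0<..}" "T \<in> sets borel"
  shows "f absolutely_integrable_on T"
  by (rule set_integrable_subset[OF assms(1)]) (use assms in auto)

lemma integral_Ioo_eq_Icc: "integral {a<..<b} f = integral {a..b::real} f"
  for f :: "real \<Rightarrow> real"
  by (rule integral_spike_set) (auto intro: negligible_subset[of "{a, b}"])

lemma absolutely_integrable_on_Icc_if_Ioo:
  fixes f :: "real \<Rightarrow> real"
  assumes "f absolutely_integrable_on {a<..<b}"
  shows "f absolutely_integrable_on {a..b}"
  by (subst absolutely_integrable_spike_set_eq[where T = "{a<..<b}"])
    (auto intro: assms negligible_subset[of "{a, b}"])

lemma ac_deriv_integral_below: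
  fixes f :: "real \<Rightarrow> real"
  assumes "\<And>q. q > 0 \<Longrightarrow> f absolutely_integrable_on {0<..<q}"
  shows "has_ac_derivative_on (\<lambda>x. integral {0<..<x} f) f {0<..}"
  unfolding has_ac_derivative_on_def
proof (intro allI impI; elim conjE)
  fix p q :: real assume pq: "p \<le> q" "{p..q} \<subseteq> {0<..}"
  hence "p > 0" by auto
  have f: "f absolutely_integrable_on {0..q}"
    by (rule absolutely_integrable_on_Icc_if_Ioo) (use \<open>p > 0\<close> pq assms in auto)
  have "f absolutely_integrable_on {p..q}"
    by (rule absolutely_integrable_on_subinterval[OF f]) (use \<open>p > 0\<close> in auto)
  moreover have "integral {0..p} f + integral {p..q} f = integral {0..q} f"
    by (rule Henstock_Kurzweil_Integration.integral_combine)
      (use \<open>p > 0\<close> pq f in \<open>auto simp: absolutely_integrable_on_def\<close>)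
  ultimately show "f absolutely_integrable_on {p..q} \<and> integral {p..q} f = integral {0<..<q} f - integral {0<..<p} f"
    by (simp add: integral_Ioo_eq_Icc)
qed

lemma integral_Ioi_split:
  fixes f :: "real \<Rightarrow> real"
  assumes "f absolutely_integrable_on {p<..}" "p \<le> q"
  shows "integral {p<..} f = integral {p<..<q} f + integral {q<..} f"
proof -
  have "{p<..<q} \<subseteq> {p<..}" "{q<..} \<subseteq> {p<..}" using assms(2) by force+
  hence i: "f integrable_on {p<..<q}" "f integrable_on {q<..}"
    using set_integrable_subset[OF assms(1), of "{p<..<q}"] set_integrable_subset[OF assms(1), of "{q<..}"]
    by (auto simp: absolutely_integrable_on_def)
  have "(f has_integral integral {p<..<q} f + integral {q<..} f) ({p<..<q} \<union> {q<..})"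
  proof (rule has_integral_Un)
    have "{p<..<q} \<inter> {q<..} = {}" by auto
    thus "negligible ({p<..<q} \<inter> {q<..})" by simp
  qed (use i in \<open>auto simp: integrable_integral\<close>)
  moreover have "integral ({p<..<q} \<union> {q<..}) f = integral {p<..} f"
    by (rule integral_spike_set) (use assms(2) in \<open>auto intro: negligible_subset[of "{q}"]\<close>)
  ultimately show ?thesis using integral_unique by metis
qed

lemma ac_deriv_integral_above:
  fixes f :: "real \<Rightarrow> real"
  assumes "f absolutely_integrable_on {0<..}"
  shows "has_ac_derivative_on (\<lambda>x. integral {x<..} f) (\<lambda>x. - f x) {0<..}"
proof -
  have "has_ac_derivative_on (\<lambda>x. integral {0<..<x} f) f {0<..}"
    by (rule ac_deriv_integral_below) (auto intro: absolutely_integrable_on_subset_Ioi[OF assms])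
  from ac_deriv_diff[OF ac_deriv_C1 this, of "\<lambda>_. integral {0<..} f" "\<lambda>_. 0"]
  have "has_ac_derivative_on (\<lambda>x. integral {0<..} f - integral {0<..<x} f) (\<lambda>x. 0 - f x) {0<..}"
    by auto
  thus ?thesis
  proof (rule ac_deriv_cong)
    fix x :: real assume "x \<in> {0<..}"
    thus "integral {x<..} f = integral {0<..} f - integral {0<..<x} f"
      using integral_Ioi_split[OF assms, of x] by auto
  qed auto
qed

lemma integral_below_tendsto_0:
  fixes f :: "real \<Rightarrow> real"
  assumes "f absolutely_integrable_on {0<..<q}" "q > 0"
  shows "((\<lambda>x. integral {0<..<x} f) \<longlongrightarrow> 0) (at_right 0)"
proof -
  have "f integrable_on {0..q}"
    using absolutely_integrable_on_Icc_if_Ioo[OF assms(1)] by (simp add: absolutely_integrable_on_def)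
  from indefinite_integral_continuous_1[OF this]
  have "((\<lambda>x. integral {0..x} f) \<longlongrightarrow> integral {0..0} f) (at 0 within {0..q})"
    using assms(2) unfolding continuous_on_def by (blast intro: less_imp_le atLeastAtMost_iff[THEN iffD2])
  moreover have "at 0 within {0..q} = at_right 0" using assms(2) by (rule at_within_Icc_at_right)
  ultimately show ?thesis by (simp add: integral_Ioo_eq_Icc)
qed

lemma integral_above_tendsto_0:
  fixes f :: "real \<Rightarrow> real"
  assumes "f absolutely_integrable_on {0<..}"
  shows "(\<lambda>n. integral {real n<..} f) \<longlonglongrightarrow> 0"
proof -
  let ?F = "\<lambda>n x. if x \<in> {0<..<real n} then f x else 0"
  have f: "f integrable_on {0<..}" "(\<lambda>x. \<bar>f x\<bar>) integrable_on {0<..}"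
    using assms by (auto simp: absolutely_integrable_on_def)
  have sub: "f absolutely_integrable_on {0<..<real n}" for n
    by (rule absolutely_integrable_on_subset_Ioi[OF assms]) auto
  have F: "(?F n has_integral integral {0<..<real n} f) {0<..}" for n
    using sub[of n] by (subst has_integral_restrict) (auto simp: absolutely_integrable_on_def integrable_integral)
  have "(\<lambda>n. integral {0<..} (?F n)) \<longlonglongrightarrow> integral {0<..} f"
  proof (rule dominated_convergence(2)[OF _ f(2)])
    show "?F n integrable_on {0<..}" for n using F by blast
    fix x :: real assume x: "x \<in> {0<..}"
    have "eventually (\<lambda>n. real n > x) sequentially"
      using filterlim_real_sequentially by (simp add: filterlim_at_top_dense)
    hence "eventually (\<lambda>n. f x = ?F n x) sequentially"
      by eventually_elim (use x in auto)
    thus "(\<lambda>n. ?F n x) \<longlonglongrightarrow> f x" by (rule Lim_transform_eventually[OF tendsto_const])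
  qed auto
  hence "(\<lambda>n. integral {0<..} f - integral {0<..<real n} f) \<longlonglongrightarrow> integral {0<..} f - integral {0<..} f"
    unfolding integral_unique[OF F] by (intro tendsto_diff tendsto_const)
  moreover have "integral {0<..} f - integral {0<..<real n} f = integral {real n<..} f" for n
    using integral_Ioi_split[OF assms, of "real n"] by simp
  ultimately show ?thesis by simp
qed

context bessel_pair
begin

lemma i_cont: "continuous_on {0<..} i" and i'_cont: "continuous_on {0<..} i'"
  and k_cont: "continuous_on {0<..} k" and k'_cont: "continuous_on {0<..} k'"
  by (auto intro!: continuous_at_imp_continuous_on
      intro: DERIV_isCont[OF i_deriv] DERIV_isCont[OF i'_deriv] DERIV_isCont[OF k_deriv] DERIV_isCont[OF k'_deriv])

lemma k'_neg: "x > 0 \<Longrightarrow> k' x < 0"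
  using k_pos[of x] k_le[of x] by linarith

lemma i_mono:
  assumes "0 < x" "x \<le> y"
  shows "i x \<le> i y"
  by (rule DERIV_nonneg_imp_nondecreasing[of x y i])
    (use assms in \<open>auto intro!: exI conjI i_deriv i'_nonneg\<close>)

lemma k_antimono:
  assumes "0 < x" "x \<le> y"
  shows "k y \<le> k x"
  by (rule DERIV_nonpos_imp_nonincreasing[of x y k])
    (use assms in \<open>auto intro!: exI conjI k_deriv less_imp_le[OF k'_neg]\<close>)

lemma wronskian_bound: "x > 0 \<Longrightarrow> x powr a * i x * (- k' x) \<le> 1"
proof -
  assume x: "x > 0"
  have "x powr a * (i' x * k x) \<ge> 0" using i'_nonneg[OF x] k_pos[OF x] by simp
  thus ?thesis using wronskian[OF x] by (simp add: algebra_simps)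
qed

text \<open>The quotient i/k increases, hence is bounded on {0<..<x}. So integrability against
  \<open>k\<close>, which is what the expectation provides, also yields the integrals against
  \<open>i\<close> over bounded intervals.\<close>

lemma weighted_i_integrable:
  assumes g: "(\<lambda>y. g y * k y * r y) absolutely_integrable_on {0<..}" and x: "x > 0"
  shows "(\<lambda>y. g y * i y * r y) absolutely_integrable_on {0<..<x}"
proof -
  have "(\<lambda>y. g y * k y * r y) absolutely_integrable_on {0<..<x}"
    by (rule absolutely_integrable_on_subset_Ioi[OF g]) auto
  moreover have "(\<lambda>y. i y / k y) \<in> borel_measurable (lebesgue_on {0<..<x})"
    by (rule continuous_imp_measurable_on_sets_lebesgue)
      (use k_pos in \<open>force intro!: continuous_intros intro: continuous_on_subset[OF i_cont] continuous_on_subset[OF k_cont]\<close>)+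
  moreover have "bounded ((\<lambda>y. i y / k y) ` {0<..<x})"
    unfolding bounded_iff
  proof (intro exI[of _ "i x / k x"] ballI)
    fix z assume "z \<in> (\<lambda>y. i y / k y) ` {0<..<x}"
    then obtain y where y: "0 < y" "y < x" "z = i y / k y" by auto
    have "i y / k y \<le> i x / k x"
      using y x i_pos[of x] i_pos[of y] k_pos[of x] k_pos[of y] i_mono[of y x] k_antimono[of y x]
      by (intro frac_le) auto
    thus "norm z \<le> i x / k x" using y i_pos[of y] k_pos[of y] by simp
  qed
  ultimately have "(\<lambda>y. i y / k y * (g y * k y * r y)) absolutely_integrable_on {0<..<x}"
    using absolutely_integrable_bounded_measurable_product_real[of "\<lambda>y. i y / k y" "{0<..<x}" "\<lambda>y. g y * k y * r y"] by auto
  thus ?thesis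
  proof (rule absolutely_integrable_spike[of _ _ "{}"])
    fix y assume "y \<in> {0<..<x} - {}"
    thus "g y * i y * r y = i y / k y * (g y * k y * r y)" using k_pos[of y] by simp
  qed auto
qed

end

text \<open>\<open>r\<close> stands for h - c on one half-line. As y^(a-1) k(y) = y^\<nu> K(y), the
  two integrability conditions say that the density and its product with \<open>r\<close> are
  integrable there.\<close>

locale stein_half = bessel_pair +
  fixes \<beta> :: real and r :: "real \<Rightarrow> real"
  assumes \<beta>: "\<bar>\<beta>\<bar> < 1"
    and k_int: "(\<lambda>y. exp (\<beta> * y) * y powr (a - 1) * k y) absolutely_integrable_on {0<..}"
    and r_int: "(\<lambda>y. exp (\<beta> * y) * y powr (a - 1) * k y * r y) absolutely_integrable_on {0<..}"
begin

text \<open>The right-hand side becomes \<open>w r\<close> when x G'' + a G' - x G = exp (\<beta> x)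
  r is multiplied by x^(a-1) to reach the self-adjoint form (x^a G')' - x^a G.\<close>

definition w :: "real \<Rightarrow> real" where "w y = exp (\<beta> * y) * y powr (a - 1)"
definition A :: "real \<Rightarrow> real" where "A x = integral {0<..<x} (\<lambda>y. w y * i y * r y)"
definition B :: "real \<Rightarrow> real" where "B x = integral {x<..} (\<lambda>y. w y * k y * r y)"
definition G :: "real \<Rightarrow> real" where "G x = - (k x * A x) - i x * B x"
text \<open>The terms with the derivatives of \<open>A\<close> and \<open>B\<close> are absent
  because k w i r and i w k r cancel. That is why \<open>G1\<close> is again continuous, although
  \<open>r\<close> need not be. \<open>G2\<close> is obtained by solving the equation for the second
  derivative.\<close>

definition G1 :: "real \<Rightarrow> real" where "G1 x = - (k' x * A x) - i' x * B x"
definition G2 :: "real \<Rightarrow> real" where "G2 x = G x - a / x * G1 x + exp (\<beta> * x) * r x / x"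
definition F :: "real \<Rightarrow> real" where "F x = exp (- \<beta> * x) * G x"
definition F1 :: "real \<Rightarrow> real" where "F1 x = exp (- \<beta> * x) * (G1 x - \<beta> * G x)"
definition F2 :: "real \<Rightarrow> real" where "F2 x = exp (- \<beta> * x) * (G2 x - 2 * \<beta> * G1 x + \<beta>\<^sup>2 * G x)"

lemma w_pos: "x > 0 \<Longrightarrow> w x > 0"
  by (simp add: w_def)

lemma int_kr: "(\<lambda>y. w y * k y * r y) absolutely_integrable_on {0<..}"
  unfolding w_def by (rule r_int)

lemma int_k: "(\<lambda>y. w y * k y) absolutely_integrable_on {0<..}"
  unfolding w_def by (rule k_int)

lemma int_ir: "x > 0 \<Longrightarrow> (\<lambda>y. w y * i y * r y) absolutely_integrable_on {0<..<x}"
  by (rule weighted_i_integrable[OF int_kr])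

lemma int_i: "x > 0 \<Longrightarrow> (\<lambda>y. w y * i y) absolutely_integrable_on {0<..<x}"
  using weighted_i_integrable[of w "\<lambda>_. 1"] int_k by simp

lemma ac_A: "has_ac_derivative_on A (\<lambda>y. w y * i y * r y) {0<..}"
  unfolding A_def[abs_def] by (rule ac_deriv_integral_below[OF int_ir])

lemma ac_B: "has_ac_derivative_on B (\<lambda>y. - (w y * k y * r y)) {0<..}"
  unfolding B_def[abs_def] by (rule ac_deriv_integral_above[OF int_kr])

lemma ac_G: "has_ac_derivative_on G G1 {0<..}"
proof -
  have 1: "has_ac_derivative_on (\<lambda>x. k x * A x) (\<lambda>x. k' x * A x + k x * (w x * i x * r x)) {0<..}"
    by (rule ac_deriv_mult[OF ac_A k_deriv k'_cont]) auto
  have 2: "has_ac_derivative_on (\<lambda>x. i x * B x) (\<lambda>x. i' x * B x + i x * - (w x * k x * r x)) {0<..}"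
    by (rule ac_deriv_mult[OF ac_B i_deriv i'_cont]) auto
  show ?thesis
    by (rule ac_deriv_cong[OF ac_deriv_diff[OF ac_deriv_cmult[OF 1, of "-1"] 2]])
      (simp_all add: G_def G1_def algebra_simps)
qed

lemma ac_G1: "has_ac_derivative_on G1 G2 {0<..}"
proof -
  have c: "continuous_on {0<..} (\<lambda>x. a / x)" by (intro continuous_intros) auto
  have 1: "has_ac_derivative_on (\<lambda>x. k' x * A x) (\<lambda>x. (k x - a / x * k' x) * A x + k' x * (w x * i x * r x)) {0<..}"
    by (rule ac_deriv_mult[OF ac_A k'_deriv]) (auto intro!: continuous_intros k_cont k'_cont c)
  have 2: "has_ac_derivative_on (\<lambda>x. i' x * B x) (\<lambda>x. (i x - a / x * i' x) * B x + i' x * - (w x * k x * r x)) {0<..}"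
    by (rule ac_deriv_mult[OF ac_B i'_deriv]) (auto intro!: continuous_intros i_cont i'_cont c)
  show ?thesis
  proof (rule ac_deriv_cong[OF ac_deriv_diff[OF ac_deriv_cmult[OF 1, of "-1"] 2]])
    fix x :: real assume "x \<in> {0<..}"
    hence x: "x > 0" by simp
    \<comment> \<open>Differentiating \<open>G1\<close> leaves the \<open>r\<close>-terms w r (i' k
      - i k'); the Wronskian identity turns them into exp (\<beta> x) r / x, the inhomogeneity in
      \<open>G2\<close>.\<close>
    have "w x * (i' x * k x - i x * k' x) = exp (\<beta> * x) * (x powr a * (i' x * k x - i x * k' x)) / x"
      using x by (simp add: w_def powr_diff)
    also have "\<dots> = exp (\<beta> * x) / x" unfolding wronskian[OF x] by simp
    finally have e: "exp (\<beta> * x) * r x / x = w x * (i' x * k x - i x * k' x) * r x" by simp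
    show "G2 x = - 1 * ((k x - a / x * k' x) * A x + k' x * (w x * i x * r x)) -
         ((i x - a / x * i' x) * B x + i' x * - (w x * k x * r x))"
      unfolding G2_def e G_def G1_def by (simp add: algebra_simps)
  qed (simp add: G1_def)
qed

lemma exp_deriv: "((\<lambda>x. exp (- \<beta> * x)) has_real_derivative - \<beta> * exp (- \<beta> * x)) (at x)"
  by (auto intro!: derivative_eq_intros)

lemma exp_deriv_cont: "continuous_on S (\<lambda>x. - \<beta> * exp (- \<beta> * x))"
  by (intro continuous_intros)

lemma ac_F: "has_ac_derivative_on F F1 {0<..}"
  by (rule ac_deriv_cong[OF ac_deriv_mult[OF ac_G exp_deriv exp_deriv_cont]])
    (simp_all add: F_def F1_def algebra_simps)

lemma ac_F1: "has_ac_derivative_on F1 F2 {0<..}"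
  by (rule ac_deriv_cong[OF ac_deriv_mult[OF ac_deriv_diff[OF ac_G1 ac_deriv_cmult[OF ac_G, of \<beta>]] exp_deriv exp_deriv_cont]])
    (simp_all add: F1_def F2_def algebra_simps power2_eq_square)

lemma F_deriv: "x > 0 \<Longrightarrow> (F has_real_derivative F1 x) (at x)"
  by (rule ac_deriv_has_real_derivative[OF ac_F])
    (auto intro: ac_deriv_isCont[OF ac_F1])

lemma F1_deriv:
  assumes "x > 0" "isCont r x"
  shows "(F1 has_real_derivative F2 x) (at x)"
  by (rule ac_deriv_has_real_derivative[OF ac_F1])
    (use assms in \<open>auto simp: F2_def[abs_def] G2_def intro!: continuous_intros
      ac_deriv_isCont[OF ac_G] ac_deriv_isCont[OF ac_G1]\<close>)

text \<open>Purely algebraic and valid at every positive point, since \<open>G2\<close> was defined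
  by the equation; that \<open>F2\<close> is a derivative of \<open>F1\<close> almost everywhere is
  the content of \<open>ac_F1\<close>.\<close>

lemma F_eq:
  assumes "x > 0"
  shows "x * F2 x + (a + 2 * \<beta> * x) * F1 x + (a * \<beta> - (1 - \<beta>\<^sup>2) * x) * F x = r x"
proof -
  have "x * F2 x + (a + 2 * \<beta> * x) * F1 x + (a * \<beta> - (1 - \<beta>\<^sup>2) * x) * F x
    = exp (- \<beta> * x) * (x * G2 x + a * G1 x - x * G x)"
    unfolding F_def F1_def F2_def by (simp add: algebra_simps power2_eq_square)
  also have "x * G2 x + a * G1 x - x * G x = exp (\<beta> * x) * r x"
    using assms by (simp add: G2_def field_simps)
  finally show ?thesis by (simp add: exp_minus)
qed

section \<open>Limits of the half-line solution and its derivative at 0\<close>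

definition F0 :: real where "F0 = - (i0 * integral {0<..} (\<lambda>y. w y * k y * r y))"

text \<open>For y < x monotonicity gives k(x) i(y) \<le> k(y) i(x), which moves the singularity of
  \<open>k\<close> into the integrable function w k |r|; its integral over {0<..<x} tends to 0. Thus
  only \<open>B\<close> contributes to \<open>F0\<close>.\<close>

lemma kA_at_0: "((\<lambda>x. k x * A x) \<longlongrightarrow> 0) (at_right 0)"
proof (rule Lim_null_comparison)
  have int: "(\<lambda>y. \<bar>w y * k y * r y\<bar>) absolutely_integrable_on {0<..}"
    by (rule set_integrable_abs[OF int_kr])
  show "eventually (\<lambda>x. norm (k x * A x) \<le> i x * integral {0<..<x} (\<lambda>y. \<bar>w y * k y * r y\<bar>)) (at_right 0)"
    using eventually_at_right_less[of 0]
  proof eventually_elim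
    case (elim x)
    have i1: "(\<lambda>y. \<bar>w y * k y * r y\<bar>) absolutely_integrable_on {0<..<x}"
      by (rule absolutely_integrable_on_subset_Ioi[OF int]) auto
    have "norm (integral {0<..<x} (\<lambda>y. k x * (w y * i y * r y))) \<le> integral {0<..<x} (\<lambda>y. i x * \<bar>w y * k y * r y\<bar>)"
    proof (rule integral_norm_bound_integral)
      show "(\<lambda>y. k x * (w y * i y * r y)) integrable_on {0<..<x}"
        using int_ir[OF elim] by (intro integrable_on_mult_right) (simp add: absolutely_integrable_on_def)
      show "(\<lambda>y. i x * \<bar>w y * k y * r y\<bar>) integrable_on {0<..<x}"
        using i1 by (intro integrable_on_mult_right) (simp add: absolutely_integrable_on_def)
      fix y assume y: "y \<in> {0<..<x}"
      have "k x * i y * (w y * \<bar>r y\<bar>) \<le> k y * i x * (w y * \<bar>r y\<bar>)"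
        using y k_antimono[of y x] i_mono[of y x] i_pos[of y] k_pos[of y] w_pos[of y]
        by (intro mult_right_mono mult_mono) auto
      thus "norm (k x * (w y * i y * r y)) \<le> i x * \<bar>w y * k y * r y\<bar>"
        using y elim k_pos[of x] k_pos[of y] i_pos[of y] w_pos[of y] by (simp add: abs_mult mult_ac)
    qed
    thus ?case by (simp add: A_def)
  qed
  have "((\<lambda>x. integral {0<..<x} (\<lambda>y. \<bar>w y * k y * r y\<bar>)) \<longlongrightarrow> 0) (at_right 0)"
    by (rule integral_below_tendsto_0[where q = 1]) (auto intro: absolutely_integrable_on_subset_Ioi[OF int])
  from tendsto_mult[OF i_0(1) this]
  show "((\<lambda>x. i x * integral {0<..<x} (\<lambda>y. \<bar>w y * k y * r y\<bar>)) \<longlongrightarrow> 0) (at_right 0)" by simp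
qed

lemma B_at_0: "(B \<longlongrightarrow> integral {0<..} (\<lambda>y. w y * k y * r y)) (at_right 0)"
proof (rule Lim_transform_eventually)
  let ?f = "\<lambda>y. w y * k y * r y"
  show "eventually (\<lambda>x. integral {0<..} ?f - integral {0<..<x} ?f = B x) (at_right 0)"
    using eventually_at_right_less[of 0]
  proof eventually_elim
    case (elim x)
    thus ?case using integral_Ioi_split[OF int_kr, of x] by (simp add: B_def)
  qed
  have "((\<lambda>x. integral {0<..<x} ?f) \<longlongrightarrow> 0) (at_right 0)"
    by (rule integral_below_tendsto_0[where q = 1]) (auto intro: absolutely_integrable_on_subset_Ioi[OF int_kr])
  from tendsto_diff[OF tendsto_const this]
  show "((\<lambda>x. integral {0<..} ?f - integral {0<..<x} ?f) \<longlongrightarrow> integral {0<..} ?f) (at_right 0)" by simp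
qed

lemma G_at_0: "(G \<longlongrightarrow> F0) (at_right 0)"
  unfolding G_def[abs_def] F0_def
  using tendsto_diff[OF tendsto_minus[OF kA_at_0] tendsto_mult[OF i_0(1) B_at_0]] by simp

lemma exp_at_0: "((\<lambda>x. exp (c * x)) \<longlongrightarrow> 1) (at_right (0::real))" for c :: real
  using tendsto_exp[OF tendsto_mult[OF tendsto_const[of c] tendsto_ident_at[of 0 "{0<..}"]]] by simp

lemma F_at_0: "(F \<longlongrightarrow> F0) (at_right 0)"
  unfolding F_def[abs_def] using tendsto_mult[OF exp_at_0 G_at_0, of "- \<beta>"] by simp

text \<open>Near 0 the integrand is i0 r0 y^(a-1) up to a relative error in the constant. The rate
  x^a is the one that compensates the growth of k' in \<open>F1_at_0\<close>.\<close>

lemma A_asymp: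
  assumes "(r \<longlongrightarrow> r0) (at_right 0)"
  shows "((\<lambda>x. A x / x powr a) \<longlongrightarrow> i0 * r0 / a) (at_right 0)"
proof (rule tendstoI)
  fix e :: real assume "e > 0"
  \<comment> \<open>The integral of d y^(a-1) over {0<..<x} is d x^a / a, so this choice gives an
    error of e/2 after division by x^a.\<close>
  define d where "d = e * a / 2"
  have "d > 0" using \<open>e > 0\<close> a_pos by (simp add: d_def)
  let ?q = "\<lambda>y. exp (\<beta> * y) * i y * r y"
  have "(?q \<longlongrightarrow> i0 * r0) (at_right 0)"
    using tendsto_mult[OF tendsto_mult[OF exp_at_0[of \<beta>] i_0(1)] assms] by simp
  from tendstoD[OF this \<open>d > 0\<close>] obtain \<delta> where \<delta>: "\<delta> > 0" "\<And>y. 0 < y \<Longrightarrow> y < \<delta> \<Longrightarrow> \<bar>?q y - i0 * r0\<bar> < d"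
    by (auto simp: eventually_at_right_field dist_real_def)
  have "eventually (\<lambda>x. x < \<delta>) (at_right 0)"
    using \<delta>(1) by (auto simp: eventually_at_right_field intro!: exI[of _ \<delta>])
  with eventually_at_right_less[of 0] show "eventually (\<lambda>x. dist (A x / x powr a) (i0 * r0 / a) < e) (at_right 0)"
  proof eventually_elim
    case (elim x)
    have P: "((\<lambda>y. y powr (a - 1)) has_integral x powr a / a) {0<..<x}"
    proof -
      have "((\<lambda>y. y powr (a - 1)) has_integral x powr (a - 1 + 1) / (a - 1 + 1)) {0..x}"
        by (rule has_integral_powr_from_0) (use a_pos elim in auto)
      thus ?thesis by (simp add: has_integral_Icc_iff_Ioo)
    qed
    have I: "((\<lambda>y. w y * i y * r y) has_integral A x) {0<..<x}"
      using int_ir[OF elim(1)] by (simp add: A_def absolutely_integrable_on_def integrable_integral)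
    have "norm (integral {0<..<x} (\<lambda>y. w y * i y * r y - i0 * r0 * y powr (a - 1))) \<le> integral {0<..<x} (\<lambda>y. d * y powr (a - 1))"
    proof (rule integral_norm_bound_integral)
      show "(\<lambda>y. w y * i y * r y - i0 * r0 * y powr (a - 1)) integrable_on {0<..<x}"
        using has_integral_diff[OF I has_integral_mult_right[OF P, of "i0 * r0"]] by blast
      show "(\<lambda>y. d * y powr (a - 1)) integrable_on {0<..<x}"
        using has_integral_mult_right[OF P, of d] by blast
      fix y assume y: "y \<in> {0<..<x}"
      have "w y * i y * r y - i0 * r0 * y powr (a - 1) = (?q y - i0 * r0) * y powr (a - 1)"
        by (simp add: w_def algebra_simps)
      also have "norm \<dots> \<le> d * y powr (a - 1)"
        using \<delta>(2)[of y] y elim by (simp add: abs_mult mult_right_mono less_imp_le)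
      finally show "norm (w y * i y * r y - i0 * r0 * y powr (a - 1)) \<le> d * y powr (a - 1)" .
    qed
    hence "\<bar>A x - i0 * r0 * (x powr a / a)\<bar> \<le> d * (x powr a / a)"
      using integral_unique[OF has_integral_diff[OF I has_integral_mult_right[OF P, of "i0 * r0"]]]
        integral_unique[OF has_integral_mult_right[OF P, of d]] by simp
    moreover have "A x / x powr a - i0 * r0 / a = (A x - i0 * r0 * (x powr a / a)) / x powr a"
      using elim by (simp add: diff_divide_distrib)
    ultimately have "\<bar>A x / x powr a - i0 * r0 / a\<bar> \<le> d / a"
      using elim by (simp add: abs_divide divide_le_eq)
    also have "d / a < e" using \<open>e > 0\<close> a_pos by (simp add: d_def)
    finally show ?case by (simp add: dist_real_def)
  qed
qed

text \<open>The limits 1/i0 of x^a (-k') and i0 r0 / a of A/x^a multiply to r0/a. The resulting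
  value is the one dictated by the equation at x = 0, namely a f'(0) + a \<beta> f(0) = r0.\<close>

lemma F1_at_0:
  assumes "(r \<longlongrightarrow> r0) (at_right 0)"
  shows "(F1 \<longlongrightarrow> r0 / a - \<beta> * F0) (at_right 0)"
proof -
  have "((\<lambda>x. (x powr a * (- k' x)) * (A x / x powr a) - i' x * B x) \<longlongrightarrow> 1 / i0 * (i0 * r0 / a) - 0 * integral {0<..} (\<lambda>y. w y * k y * r y)) (at_right 0)"
    by (intro tendsto_diff tendsto_mult k'_0 A_asymp assms i'_0 B_at_0)
  hence "(G1 \<longlongrightarrow> r0 / a) (at_right 0)"
  proof (rule Lim_transform_eventually[OF tendsto_eq_rhs])
    show "eventually (\<lambda>x. (x powr a * (- k' x)) * (A x / x powr a) - i' x * B x = G1 x) (at_right 0)"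
      using eventually_at_right_less[of 0] by eventually_elim (simp add: G1_def)
  qed (use i_0 in auto)
  from tendsto_mult[OF exp_at_0[of "- \<beta>"] tendsto_diff[OF this tendsto_mult[OF tendsto_const[of \<beta>] G_at_0]]]
  show ?thesis unfolding F1_def[abs_def] by simp
qed

lemma F_deriv_at_0:
  assumes "(r \<longlongrightarrow> r0) (at_right 0)"
  shows "((\<lambda>x. (F x - F0) / x) \<longlongrightarrow> r0 / a - \<beta> * F0) (at_right 0)"
proof (rule lhopital_right)
  show "((\<lambda>x. F x - F0) \<longlongrightarrow> 0) (at_right 0)"
    using tendsto_diff[OF F_at_0 tendsto_const[of F0]] by simp
  show "eventually (\<lambda>x. ((\<lambda>x. F x - F0) has_real_derivative F1 x) (at x)) (at_right 0)"
    using eventually_at_right_less[of 0] by eventually_elim (auto intro!: derivative_eq_intros F_deriv)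
  show "eventually (\<lambda>x::real. ((\<lambda>x. x) has_real_derivative 1) (at x)) (at_right 0)" by simp
  show "((\<lambda>x. F1 x / 1) \<longlongrightarrow> r0 / a - \<beta> * F0) (at_right 0)" using F1_at_0[OF assms] by simp
  show "eventually (\<lambda>x::real. x \<noteq> 0) (at_right 0)"
    using eventually_at_right_less[of 0] by eventually_elim auto
qed (auto intro: tendsto_intros)

end

section \<open>Bounds on the half-line for bounded right-hand sides\<close>

context bessel_pair
begin

text \<open>The weight turns x exp (-x) into x exp (-(1 + \<beta>) x), which is at most 1/(1 +
  \<beta>) because z \<le> exp z.\<close>

lemma k'_exp_bounded:
  assumes "\<bar>\<beta>\<bar> < 1"
  obtains D where "\<And>x. x \<ge> 1 \<Longrightarrow> exp (- \<beta> * x) * (- k' x) \<le> D" "D \<ge> 0"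
proof -
  obtain C where C: "\<And>x. x \<ge> 1 \<Longrightarrow> - k' x \<le> C * (x * exp (- x))" using k'_decay by blast
  have "0 < C * (1 * exp (- 1))" using C[of 1] k'_neg[of 1] by linarith
  hence C_pos: "C > 0" by (simp add: zero_less_mult_iff)
  have c: "1 + \<beta> > 0" using assms by linarith
  show ?thesis
  proof
    fix x :: real assume x: "x \<ge> 1"
    have "exp (- \<beta> * x) * (- k' x) \<le> exp (- \<beta> * x) * (C * (x * exp (- x)))"
      using C[OF x] by (intro mult_left_mono) auto
    also have "\<dots> = C * (x * exp (- ((1 + \<beta>) * x)))"
      by (simp add: algebra_simps exp_diff exp_minus exp_add field_simps)
    also have "\<dots> \<le> C * (1 / (1 + \<beta>))"
    proof (intro mult_left_mono)
      have "(1 + \<beta>) * x \<le> exp ((1 + \<beta>) * x)" using exp_ge_add_one_self[of "(1 + \<beta>) * x"] by linarith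
      hence "(1 + \<beta>) * x * exp (- ((1 + \<beta>) * x)) \<le> exp ((1 + \<beta>) * x) * exp (- ((1 + \<beta>) * x))"
        by (intro mult_right_mono) auto
      also have "\<dots> = 1" by (simp only: exp_minus_inverse)
      finally show "x * exp (- ((1 + \<beta>) * x)) \<le> 1 / (1 + \<beta>)"
        using c by (subst pos_le_divide_eq) (simp_all add: mult_ac)
    qed (use C_pos in auto)
    finally show "exp (- \<beta> * x) * (- k' x) \<le> C * (1 / (1 + \<beta>))" .
  next
    show "0 \<le> C * (1 / (1 + \<beta>))" using C_pos c by simp
  qed
qed

end

context stein_half
begin

text \<open>\<open>A1\<close> and \<open>B1\<close> are \<open>A\<close> and \<open>B\<close> for r
  = 1; a bound on |r| times them dominates \<open>A\<close> and \<open>B\<close>.\<close>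

definition A1 :: "real \<Rightarrow> real" where "A1 x = integral {0<..<x} (\<lambda>y. w y * i y)"
definition B1 :: "real \<Rightarrow> real" where "B1 x = integral {x<..} (\<lambda>y. w y * k y)"

lemma ac_A1: "has_ac_derivative_on A1 (\<lambda>y. w y * i y) {0<..}"
  unfolding A1_def[abs_def] by (rule ac_deriv_integral_below[OF int_i])

lemma ac_B1: "has_ac_derivative_on B1 (\<lambda>y. - (w y * k y)) {0<..}"
  unfolding B1_def[abs_def] by (rule ac_deriv_integral_above[OF int_k])

lemma B1_nonneg: "x > 0 \<Longrightarrow> B1 x \<ge> 0"
  unfolding B1_def
  by (rule Henstock_Kurzweil_Integration.integral_nonneg)
    (use absolutely_integrable_on_subset_Ioi[OF int_k, of "{x<..}"] w_pos k_pos in \<open>auto simp: absolutely_integrable_on_def less_imp_le\<close>)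

text \<open>The solution of (1 - \<beta>^2) y = 1 + a; since a \<beta> \<le> a, the factor (1 -
  \<beta>^2) y - a \<beta> is at least 1 from there on.\<close>

definition x0 :: real where "x0 = (1 + a) / (1 - \<beta>\<^sup>2)"

lemma \<beta>_sq: "\<beta>\<^sup>2 < 1"
  using \<beta> by (simp add: abs_square_less_1)

lemma x0_ge_1: "x0 \<ge> 1"
proof -
  have "1 - \<beta>\<^sup>2 \<le> 1 + a" using a_pos zero_le_power2[of \<beta>] by linarith
  thus ?thesis using \<beta>_sq by (simp add: x0_def)
qed

lemma x0_bound: "y \<ge> x0 \<Longrightarrow> (1 - \<beta>\<^sup>2) * y - a * \<beta> \<ge> 1"
proof -
  assume "y \<ge> x0"
  hence "(1 - \<beta>\<^sup>2) * y \<ge> 1 + a" using \<beta>_sq by (simp add: x0_def field_simps)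
  moreover have "a * \<beta> \<le> a * 1" using \<beta> a_pos by (intro mult_left_mono) auto
  ultimately show ?thesis by simp
qed

text \<open>If \<open>u\<close> solves the homogeneous equation, the derivative of \<open>flux u u'\<close> is \<open>w u\<close> times a factor that
  is at least 1 beyond \<open>x0\<close>; hence \<open>flux\<close> controls the integrals of \<open>w i\<close> and \<open>w k\<close>.\<close>

definition flux :: "(real \<Rightarrow> real) \<Rightarrow> (real \<Rightarrow> real) \<Rightarrow> real \<Rightarrow> real" where
  "flux u u' x = x powr a * (exp (\<beta> * x) * (u' x - \<beta> * u x))"

text \<open>\<open>flux u u'\<close> equals x^a exp (2 \<beta> x) times the derivative of exp
  (-\<beta> x) u, the flux in the self-adjoint form of the original Stein equation. This explains
  why u' drops out of its derivative.\<close>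

lemma flux_deriv:
  assumes "x > 0" "(u has_real_derivative u' x) (at x)" "(u' has_real_derivative u x - a / x * u' x) (at x)"
  shows "(flux u u' has_real_derivative w x * u x * ((1 - \<beta>\<^sup>2) * x - a * \<beta>)) (at x)"
proof -
  have d: "((\<lambda>x. exp (\<beta> * x)) has_real_derivative \<beta> * exp (\<beta> * x)) (at x)"
    by (auto intro!: derivative_eq_intros)
  have "(flux u u' has_real_derivative a * x powr (a - 1) * (exp (\<beta> * x) * (u' x - \<beta> * u x)) +
     (\<beta> * exp (\<beta> * x) * (u' x - \<beta> * u x) + ((u x - a / x * u' x) - \<beta> * u' x) * exp (\<beta> * x)) * x powr a) (at x)"
    unfolding flux_def[abs_def]
    by (rule DERIV_cmult DERIV_mult DERIV_diff has_real_derivative_powr assms d)+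
  also have "x powr a = x powr (a - 1) * x" using assms(1) by (simp add: powr_diff)
  also have "a * x powr (a - 1) * (exp (\<beta> * x) * (u' x - \<beta> * u x)) +
     (\<beta> * exp (\<beta> * x) * (u' x - \<beta> * u x) + ((u x - a / x * u' x) - \<beta> * u' x) * exp (\<beta> * x)) * (x powr (a - 1) * x)
     = w x * u x * ((1 - \<beta>\<^sup>2) * x - a * \<beta>)"
    using assms(1) by (simp add: w_def field_simps power2_eq_square)
  finally show ?thesis .
qed

lemma w_cont: "continuous_on {0<..} w"
  unfolding w_def by (intro continuous_intros) auto

lemma ac_flux:
  assumes "\<And>x. x > 0 \<Longrightarrow> (u has_real_derivative u' x) (at x)"
    "\<And>x. x > 0 \<Longrightarrow> (u' has_real_derivative u x - a / x * u' x) (at x)"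
  shows "has_ac_derivative_on (flux u u') (\<lambda>x. w x * u x * ((1 - \<beta>\<^sup>2) * x - a * \<beta>)) {0<..}"
proof (rule ac_deriv_C1)
  have "continuous_on {0<..} u" using assms(1) by (auto intro!: continuous_at_imp_continuous_on intro: DERIV_isCont)
  thus "continuous_on {0<..} (\<lambda>x. w x * u x * ((1 - \<beta>\<^sup>2) * x - a * \<beta>))"
    by (intro continuous_intros w_cont)
qed (auto intro: flux_deriv assms)

lemma A1_large:
  assumes "x \<ge> x0"
  shows "A1 x \<le> flux i i' x + (A1 x0 - flux i i' x0)"
proof -
  have "A1 x - A1 x0 \<le> flux i i' x - flux i i' x0"
  proof (rule ac_deriv_mono[OF ac_A1 ac_flux])
    fix y assume y: "x0 \<le> y"
    have "w y * i y * 1 \<le> w y * i y * ((1 - \<beta>\<^sup>2) * y - a * \<beta>)"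
      using x0_bound[OF y] w_pos[of y] i_pos[of y] y x0_ge_1 by (intro mult_left_mono) auto
    thus "w y * i y \<le> w y * i y * ((1 - \<beta>\<^sup>2) * y - a * \<beta>)" by simp
  qed (use assms x0_ge_1 i_deriv i'_deriv in auto)
  thus ?thesis by simp
qed

text \<open>On {x..b} the decrease of \<open>B1\<close> is at most the increase of the flux of
  \<open>k\<close>. The flux at b is nonpositive, as k' - \<beta> k \<le> (|\<beta>| - 1) k, and is
  dropped; then b tends to infinity through the integers, where \<open>B1\<close> vanishes.\<close>

lemma B1_large:
  assumes "x \<ge> x0"
  shows "B1 x \<le> - flux k k' x"
proof -
  have *: "B1 x \<le> B1 b - flux k k' x" if "b \<ge> x" for b
  proof -
    have "((-1) * B1 b) - ((-1) * B1 x) \<le> flux k k' b - flux k k' x"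
    proof (rule ac_deriv_mono[OF ac_deriv_cmult[OF ac_B1] ac_flux])
      fix y assume y: "x \<le> y"
      have "w y * k y * 1 \<le> w y * k y * ((1 - \<beta>\<^sup>2) * y - a * \<beta>)"
        using x0_bound[of y] w_pos[of y] k_pos[of y] y assms x0_ge_1 by (intro mult_left_mono) auto
      thus "- 1 * - (w y * k y) \<le> w y * k y * ((1 - \<beta>\<^sup>2) * y - a * \<beta>)" by simp
    qed (use assms that x0_ge_1 k_deriv k'_deriv in auto)
    moreover have "flux k k' b \<le> 0"
    proof -
      have b: "b > 0" using that assms x0_ge_1 by linarith
      have "- (\<beta> * k b) \<le> \<bar>\<beta>\<bar> * k b" using k_pos[OF b] by (simp add: abs_if)
      also have "\<dots> \<le> 1 * k b" using k_pos[OF b] \<beta> by (intro mult_right_mono) auto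
      finally have "k' b - \<beta> * k b \<le> 0" using k_le[OF b] by simp
      thus ?thesis unfolding flux_def by (intro mult_nonneg_nonpos) auto
    qed
    ultimately show ?thesis by simp
  qed
  have "B1 x \<le> 0 - flux k k' x"
  proof (rule Lim_bounded2)
    show "(\<lambda>n. B1 (real n) - flux k k' x) \<longlonglongrightarrow> 0 - flux k k' x"
      unfolding B1_def by (intro tendsto_intros integral_above_tendsto_0 int_k)
    show "\<forall>n\<ge>nat \<lceil>x\<rceil>. B1 x \<le> B1 (real n) - flux k k' x"
      by (intro allI impI *) linarith
  qed
  thus ?thesis by simp
qed

text \<open>Beyond \<open>x0\<close> the flux of \<open>i\<close> is at most 2 x^a exp (\<beta> x)
  i, and \<open>wronskian_bound\<close> turns its product with -k' into 2. Below \<open>x0\<close>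
  the integral of w i is at most a constant times i(x) x^a, and the same bound applies.\<close>

lemma A1_bound:
  obtains M where "\<And>x. x > 0 \<Longrightarrow> exp (- \<beta> * x) * (- k' x) * A1 x \<le> M"
proof -
  obtain D where D: "\<And>x. x \<ge> 1 \<Longrightarrow> exp (- \<beta> * x) * (- k' x) \<le> D" "D \<ge> 0"
    by (rule k'_exp_bounded[OF \<beta>]) blast
  \<comment> \<open>The constant of integration in \<open>A1_large\<close>. It does not scale with
    \<open>i\<close>, so it is controlled by the boundedness of exp (-\<beta> x) (-k').\<close>
  define K where "K = \<bar>A1 x0 - flux i i' x0\<bar>"
  show ?thesis
  proof
    fix x :: real assume x: "x > 0"
    show "exp (- \<beta> * x) * (- k' x) * A1 x \<le> max (D * K + 2) (exp x0 * exp x0 / a)"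
    proof (cases "x \<ge> x0")
      case True
      have "flux i i' x \<le> x powr a * (exp (\<beta> * x) * (2 * i x))"
      proof -
        have "- (\<beta> * i x) \<le> \<bar>\<beta>\<bar> * i x" using i_pos[OF x] by (simp add: abs_if)
        also have "\<dots> \<le> 1 * i x" using i_pos[OF x] \<beta> by (intro mult_right_mono) auto
        finally have "i' x - \<beta> * i x \<le> 2 * i x" using i'_le[OF x] by simp
        thus ?thesis unfolding flux_def by (intro mult_left_mono) auto
      qed
      hence "A1 x \<le> x powr a * (exp (\<beta> * x) * (2 * i x)) + K"
        using A1_large[OF True] unfolding K_def by linarith
      hence "exp (- \<beta> * x) * (- k' x) * A1 x \<le> exp (- \<beta> * x) * (- k' x) * (x powr a * (exp (\<beta> * x) * (2 * i x)) + K)"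
        using k'_neg[OF x] by (intro mult_left_mono) (auto intro!: mult_nonneg_nonpos)
      also have "\<dots> = 2 * (x powr a * i x * (- k' x)) + exp (- \<beta> * x) * (- k' x) * K"
        by (simp add: exp_minus field_simps)
      also have "\<dots> \<le> 2 * 1 + D * K"
        using wronskian_bound[OF x] D(1)[of x] True x0_ge_1
        by (intro add_mono mult_left_mono mult_right_mono) (auto simp: K_def)
      finally show ?thesis by simp
    next
      case False
      have P: "((\<lambda>y. y powr (a - 1)) has_integral x powr a / a) {0<..<x}"
      proof -
        have "((\<lambda>y. y powr (a - 1)) has_integral x powr (a - 1 + 1) / (a - 1 + 1)) {0..x}"
          by (rule has_integral_powr_from_0) (use a_pos x in auto)
        thus ?thesis by (simp add: has_integral_Icc_iff_Ioo)
      qed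
      \<comment> \<open>Used for exp (\<beta> y) under the integral and for exp (-\<beta> x) in
        front of it; hence the two factors exp x0 in the bound.\<close>
      have small: "exp (c * y) \<le> exp x0" if "\<bar>c\<bar> < 1" "0 < y" "y \<le> x" for c y
      proof -
        have "c * y \<le> \<bar>c\<bar> * y" using that by (intro mult_right_mono) auto
        also have "\<dots> \<le> 1 * x0" using that False x0_ge_1 by (intro mult_mono) auto
        finally show ?thesis by simp
      qed
      have "A1 x \<le> integral {0<..<x} (\<lambda>y. exp x0 * i x * y powr (a - 1))"
        unfolding A1_def
      proof (rule Henstock_Kurzweil_Integration.integral_le)
        show "(\<lambda>y. w y * i y) integrable_on {0<..<x}" using int_i[OF x] by (simp add: absolutely_integrable_on_def)
        show "(\<lambda>y. exp x0 * i x * y powr (a - 1)) integrable_on {0<..<x}"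
          using has_integral_mult_right[OF P] by blast
        fix y assume y: "y \<in> {0<..<x}"
        have "exp (\<beta> * y) * i y * y powr (a - 1) \<le> exp x0 * i x * y powr (a - 1)"
          using y small[of \<beta> y] \<beta> i_mono[of y x] i_pos[of y] by (intro mult_right_mono mult_mono) auto
        thus "w y * i y \<le> exp x0 * i x * y powr (a - 1)" by (simp add: w_def mult_ac)
      qed
      also have "\<dots> = exp x0 * i x * (x powr a / a)" by (rule integral_unique[OF has_integral_mult_right[OF P]])
      finally have "exp (- \<beta> * x) * (- k' x) * A1 x \<le> exp (- \<beta> * x) * (- k' x) * (exp x0 * i x * (x powr a / a))"
        using k'_neg[OF x] by (intro mult_left_mono) (auto intro!: mult_nonneg_nonpos)
      also have "\<dots> = exp (- \<beta> * x) * (exp x0 / a) * (x powr a * i x * (- k' x))" by simp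
      also have "\<dots> \<le> exp x0 * (exp x0 / a) * 1"
        using small[of "- \<beta>" x] \<beta> x a_pos wronskian_bound[OF x] i_pos[OF x] k'_neg[OF x]
        by (intro mult_mono) (auto intro!: mult_nonneg_nonpos)
      finally show ?thesis by simp
    qed
  qed
qed

lemma B1_bound:
  obtains M where "\<And>x. x > 0 \<Longrightarrow> exp (- \<beta> * x) * i x * B1 x \<le> M"
proof
  fix x :: real assume x: "x > 0"
  show "exp (- \<beta> * x) * i x * B1 x \<le> max 2 (exp x0 * i x0 * integral {0<..} (\<lambda>y. w y * k y))"
  proof (cases "x \<ge> x0")
    case True
    have "- flux k k' x \<le> x powr a * (exp (\<beta> * x) * (2 * - k' x))"
    proof -
      have "\<beta> * k x \<le> \<bar>\<beta>\<bar> * k x" using k_pos[OF x] by (simp add: abs_if)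
      also have "\<dots> \<le> 1 * k x" using k_pos[OF x] \<beta> by (intro mult_right_mono) auto
      finally have "\<beta> * k x - k' x \<le> 2 * - k' x" using k_le[OF x] by simp
      hence "x powr a * (exp (\<beta> * x) * (\<beta> * k x - k' x)) \<le> x powr a * (exp (\<beta> * x) * (2 * - k' x))"
        by (intro mult_left_mono) auto
      thus ?thesis unfolding flux_def by (simp add: algebra_simps)
    qed
    with B1_large[OF True] have "B1 x \<le> x powr a * (exp (\<beta> * x) * (2 * - k' x))" by linarith
    hence "exp (- \<beta> * x) * i x * B1 x \<le> exp (- \<beta> * x) * i x * (x powr a * (exp (\<beta> * x) * (2 * - k' x)))"
      using i_pos[OF x] by (intro mult_left_mono) auto
    also have "\<dots> = 2 * (x powr a * i x * (- k' x))" by (simp add: exp_minus field_simps)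
    also have "\<dots> \<le> 2 * 1" using wronskian_bound[OF x] by (intro mult_left_mono) auto
    finally show ?thesis by simp
  next
    case False
    have "- \<beta> * x \<le> \<bar>\<beta>\<bar> * x" using x by (intro mult_right_mono) auto
    also have "\<dots> \<le> 1 * x0" using \<beta> x False by (intro mult_mono) auto
    finally have e: "exp (- \<beta> * x) \<le> exp x0" by simp
    have "integral {0<..} (\<lambda>y. w y * k y) = A0 + B1 x \<and> A0 \<ge> 0" if "A0 = integral {0<..<x} (\<lambda>y. w y * k y)" for A0
    proof
      show "integral {0<..} (\<lambda>y. w y * k y) = A0 + B1 x"
        unfolding that B1_def using integral_Ioi_split[OF int_k, of x] x by simp
      have "{0<..<x} \<subseteq> {0<..}" by force
      from absolutely_integrable_on_subset_Ioi[OF int_k this] show "A0 \<ge> 0" unfolding that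
        by (intro Henstock_Kurzweil_Integration.integral_nonneg)
          (use w_pos k_pos in \<open>auto simp: absolutely_integrable_on_def less_imp_le\<close>)
    qed
    hence "B1 x \<le> integral {0<..} (\<lambda>y. w y * k y)" by fastforce
    hence "exp (- \<beta> * x) * i x * B1 x \<le> exp x0 * i x0 * integral {0<..} (\<lambda>y. w y * k y)"
      using e i_mono[of x x0] False x B1_nonneg[OF x] i_pos[of x] i_pos[of x0] by (intro mult_mono) auto
    thus ?thesis by simp
  qed
qed

text \<open>Because k \<le> -k' and i' \<le> i, the quantity (-k') |A| + i |B| dominates |G| and
  |G1| at once. The final 2 M comes from F1 = exp (-\<beta> x) G1 - \<beta> F.\<close>

lemma F_bounded:
  assumes r: "\<And>x. x > 0 \<Longrightarrow> \<bar>r x\<bar> \<le> C"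
  obtains M where "\<And>x. x > 0 \<Longrightarrow> \<bar>F x\<bar> \<le> M" "\<And>x. x > 0 \<Longrightarrow> \<bar>F1 x\<bar> \<le> M"
proof -
  obtain M1 where M1: "\<And>x. x > 0 \<Longrightarrow> exp (- \<beta> * x) * (- k' x) * A1 x \<le> M1" by (rule A1_bound) blast
  obtain M2 where M2: "\<And>x. x > 0 \<Longrightarrow> exp (- \<beta> * x) * i x * B1 x \<le> M2" by (rule B1_bound) blast
  have C: "C \<ge> 0" using r[of 1] by auto
  define M where "M = C * (M1 + M2)"
  have *: "exp (- \<beta> * x) * ((- k' x) * \<bar>A x\<bar> + i x * \<bar>B x\<bar>) \<le> M" if x: "x > 0" for x
  proof -
    have "norm (A x) \<le> integral {0<..<x} (\<lambda>y. C * (w y * i y))"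
      unfolding A_def
    proof (rule integral_norm_bound_integral)
      show "(\<lambda>y. w y * i y * r y) integrable_on {0<..<x}" using int_ir[OF x] by (simp add: absolutely_integrable_on_def)
      show "(\<lambda>y. C * (w y * i y)) integrable_on {0<..<x}" using int_i[OF x]
        by (intro integrable_on_mult_right) (simp add: absolutely_integrable_on_def)
      fix y assume y: "y \<in> {0<..<x}"
      have "w y * i y * \<bar>r y\<bar> \<le> w y * i y * C"
        using r[of y] y w_pos[of y] i_pos[of y] by (intro mult_left_mono) auto
      thus "norm (w y * i y * r y) \<le> C * (w y * i y)" using y w_pos[of y] i_pos[of y] by (simp add: abs_mult mult_ac)
    qed
    hence A: "\<bar>A x\<bar> \<le> C * A1 x" by (simp add: A1_def)
    have "norm (B x) \<le> integral {x<..} (\<lambda>y. C * (w y * k y))"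
      unfolding B_def
    proof (rule integral_norm_bound_integral)
      have sub: "{x<..} \<subseteq> {0<..}" using x by auto
      show "(\<lambda>y. w y * k y * r y) integrable_on {x<..}"
        using absolutely_integrable_on_subset_Ioi[OF int_kr sub] by (simp add: absolutely_integrable_on_def)
      show "(\<lambda>y. C * (w y * k y)) integrable_on {x<..}"
        using absolutely_integrable_on_subset_Ioi[OF int_k sub]
        by (intro integrable_on_mult_right) (simp add: absolutely_integrable_on_def)
      fix y assume "y \<in> {x<..}"
      hence y: "y > 0" using x by auto
      have "w y * k y * \<bar>r y\<bar> \<le> w y * k y * C"
        using r[of y] y w_pos[of y] k_pos[of y] by (intro mult_left_mono) auto
      thus "norm (w y * k y * r y) \<le> C * (w y * k y)" using y w_pos[of y] k_pos[of y] by (simp add: abs_mult mult_ac)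
    qed
    hence B: "\<bar>B x\<bar> \<le> C * B1 x" by (simp add: B1_def)
    have "exp (- \<beta> * x) * ((- k' x) * \<bar>A x\<bar> + i x * \<bar>B x\<bar>)
        \<le> exp (- \<beta> * x) * ((- k' x) * (C * A1 x) + i x * (C * B1 x))"
      using A B k'_neg[OF x] i_pos[OF x] by (intro mult_left_mono add_mono) auto
    also have "\<dots> = C * (exp (- \<beta> * x) * (- k' x) * A1 x + exp (- \<beta> * x) * i x * B1 x)"
      by (simp add: algebra_simps)
    also have "\<dots> \<le> M" unfolding M_def using M1[OF x] M2[OF x] C by (intro mult_left_mono add_mono) auto
    finally show ?thesis .
  qed
  have F: "\<bar>F x\<bar> \<le> M" if x: "x > 0" for x
  proof -
    have "\<bar>G x\<bar> \<le> k x * \<bar>A x\<bar> + i x * \<bar>B x\<bar>"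
      using k_pos[OF x] i_pos[OF x] abs_triangle_ineq4[of "- (k x * A x)" "i x * B x"]
      by (simp add: G_def abs_mult)
    also have "\<dots> \<le> (- k' x) * \<bar>A x\<bar> + i x * \<bar>B x\<bar>"
      using k_le[OF x] by (intro add_mono mult_right_mono) auto
    finally have "exp (- \<beta> * x) * \<bar>G x\<bar> \<le> exp (- \<beta> * x) * ((- k' x) * \<bar>A x\<bar> + i x * \<bar>B x\<bar>)"
      by (intro mult_left_mono) auto
    moreover have "\<bar>F x\<bar> = exp (- \<beta> * x) * \<bar>G x\<bar>" by (simp add: F_def abs_mult)
    ultimately show ?thesis using *[OF x] by linarith
  qed
  have F1: "\<bar>F1 x\<bar> \<le> 2 * M" if x: "x > 0" for x
  proof -
    have "\<bar>G1 x\<bar> \<le> (- k' x) * \<bar>A x\<bar> + i' x * \<bar>B x\<bar>"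
      using k'_neg[OF x] i'_nonneg[OF x] abs_triangle_ineq4[of "- (k' x * A x)" "i' x * B x"]
      by (simp add: G1_def abs_mult)
    also have "\<dots> \<le> (- k' x) * \<bar>A x\<bar> + i x * \<bar>B x\<bar>"
      using i'_le[OF x] by (intro add_mono mult_right_mono) auto
    finally have "exp (- \<beta> * x) * \<bar>G1 x\<bar> \<le> exp (- \<beta> * x) * ((- k' x) * \<bar>A x\<bar> + i x * \<bar>B x\<bar>)"
      by (intro mult_left_mono) auto
    moreover have "\<bar>exp (- \<beta> * x) * G1 x\<bar> = exp (- \<beta> * x) * \<bar>G1 x\<bar>" by (simp add: abs_mult)
    ultimately have 1: "\<bar>exp (- \<beta> * x) * G1 x\<bar> \<le> M" using *[OF x] by linarith
    have "\<bar>\<beta>\<bar> * \<bar>F x\<bar> \<le> 1 * M" using F[OF x] \<beta> by (intro mult_mono) auto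
    hence 2: "\<bar>\<beta> * F x\<bar> \<le> M" by (simp add: abs_mult)
    have "F1 x = exp (- \<beta> * x) * G1 x - \<beta> * F x" by (simp add: F1_def F_def algebra_simps)
    thus ?thesis using 1 2 by linarith
  qed
  have "M \<ge> 0" using F[of 1] by auto
  show ?thesis
    by (rule that[of "2 * M"]) (use F F1 \<open>M \<ge> 0\<close> in force)+
qed

end

section \<open>Homogeneous solutions and their growth\<close>

context bessel_pair
begin

text \<open>The Wronskians \<open>d1\<close> and \<open>d2\<close> of \<open>v\<close> with
  \<open>i\<close> and \<open>k\<close> are constant; solving for \<open>v\<close> by Cramer's rule
  with the normalised Wronskian of the pair gives c1 = d2 and c2 = -d1.\<close>

lemma homogeneous_solution_eq:
  assumes v: "\<And>x. x > 0 \<Longrightarrow> (v has_real_derivative v' x) (at x)"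
    and v': "\<And>x. x > 0 \<Longrightarrow> (v' has_real_derivative v x - a / x * v' x) (at x)"
  obtains c1 c2 where "\<And>x. x > 0 \<Longrightarrow> v x = c1 * i x + c2 * k x"
proof -
  have W: "\<exists>c. \<forall>x\<in>{0<..}. x powr a * (v' x * u x - v x * u' x) = c"
    if u: "\<And>x. x > 0 \<Longrightarrow> (u has_real_derivative u' x) (at x)"
      "\<And>x. x > 0 \<Longrightarrow> (u' has_real_derivative u x - a / x * u' x) (at x)" for u u'
  proof (rule has_field_derivative_zero_constant)
    fix x :: real assume "x \<in> {0<..}"
    hence x: "x > 0" by simp
    let ?W = "\<lambda>x. x powr a * (v' x * u x - v x * u' x)"
    have "(?W has_real_derivative a * x powr (a - 1) * (v' x * u x - v x * u' x) +
        (((v x - a / x * v' x) * u x + u' x * v' x) - (v' x * u' x + (u x - a / x * u' x) * v x)) * x powr a) (at x)"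
      by (rule DERIV_mult DERIV_diff has_real_derivative_powr u v v' x)+
    moreover have "a * x powr (a - 1) * (v' x * u x - v x * u' x) +
        (((v x - a / x * v' x) * u x + u' x * v' x) - (v' x * u' x + (u x - a / x * u' x) * v x)) * x powr a = 0"
      using x by (simp add: powr_diff field_simps)
    ultimately show "(?W has_real_derivative 0) (at x within {0<..})"
      by (metis has_field_derivative_at_within)
  qed auto
  obtain d1 where d1: "\<And>x. x > 0 \<Longrightarrow> x powr a * (v' x * i x - v x * i' x) = d1"
    using W[OF i_deriv i'_deriv] by auto
  obtain d2 where d2: "\<And>x. x > 0 \<Longrightarrow> x powr a * (v' x * k x - v x * k' x) = d2"
    using W[OF k_deriv k'_deriv] by auto
  show ?thesis
  proof
    fix x :: real assume x: "x > 0"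
    have "v x = v x * (x powr a * (i' x * k x - i x * k' x))" by (simp add: wronskian[OF x])
    also have "\<dots> = i x * (x powr a * (v' x * k x - v x * k' x)) - k x * (x powr a * (v' x * i x - v x * i' x))"
      by (simp add: algebra_simps)
    finally show "v x = d2 * i x + (- d1) * k x" unfolding d1[OF x] d2[OF x] by simp
  qed
qed

text \<open>The Wronskian identity and the sign properties give 1 \<le> 2 x^a i (-k'), so the decay
  of -k' forces i \<ge> exp x / (2 C x^(a+1)); the factor exp (-\<beta> x) leaves the exponential
  rate 1 - \<beta> > 0.\<close>

lemma exp_i_at_top:
  assumes "\<bar>\<beta>\<bar> < 1"
  shows "filterlim (\<lambda>x. exp (- \<beta> * x) * i x) at_top at_top"
proof -
  obtain C where C: "\<And>x. x \<ge> 1 \<Longrightarrow> - k' x \<le> C * (x * exp (- x))" using k'_decay by blast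
  have "0 < C * (1 * exp (- 1))" using C[of 1] k'_neg[of 1] by linarith
  hence C_pos: "C > 0" by (simp add: zero_less_mult_iff)
  define \<gamma> where "\<gamma> = 1 - \<beta>"
  have \<gamma>: "\<gamma> > 0" using assms by (simp add: \<gamma>_def)
  have "filterlim (\<lambda>x. exp (\<gamma> * x) / (2 * C * x powr (a + 1))) at_top at_top"
    using \<gamma> C_pos a_pos by real_asymp
  thus ?thesis
  proof (rule filterlim_at_top_mono)
    show "eventually (\<lambda>x. exp (\<gamma> * x) / (2 * C * x powr (a + 1)) \<le> exp (- \<beta> * x) * i x) at_top"
      using eventually_ge_at_top[of 1]
    proof eventually_elim
      case (elim x)
      hence x: "x > 0" by simp
      have "1 = x powr a * (i' x * k x + i x * (- k' x))" using wronskian[OF x] by simp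
      also have "\<dots> \<le> x powr a * (i x * (- k' x) + i x * (- k' x))"
        using i'_le[OF x] k_le[OF x] k_pos[OF x] i'_nonneg[OF x] i_pos[OF x]
        by (intro mult_left_mono add_mono mult_mono) auto
      also have "\<dots> = 2 * x powr a * i x * (- k' x)" by simp
      also have "\<dots> \<le> 2 * x powr a * i x * (C * (x * exp (- x)))"
        using C[OF elim] i_pos[OF x] by (intro mult_left_mono) auto
      also have "\<dots> = 2 * C * x powr (a + 1) * exp (- x) * i x" using x by (simp add: powr_add)
      finally have "1 \<le> 2 * C * x powr (a + 1) * exp (- x) * i x" .
      hence "exp (\<gamma> * x) * 1 \<le> exp (\<gamma> * x) * (2 * C * x powr (a + 1) * exp (- x) * i x)"
        by (intro mult_left_mono) auto
      also have "\<dots> = exp (\<gamma> * x + - x) * i x * (2 * C * x powr (a + 1))"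
        unfolding exp_add by (simp add: mult_ac)
      also have "\<gamma> * x + - x = - \<beta> * x" by (simp add: \<gamma>_def algebra_simps)
      finally show ?case using C_pos x by (simp add: pos_divide_le_eq)
    qed
  qed
qed

text \<open>Near 0 one has x^a (-k') > c, with c half of the limit, and x^a \<le> x since a \<ge> 1.
  Hence -k' \<ge> c/x, and integration gives divergence at least like a logarithm, which also covers
  the borderline a = 1.\<close>

lemma k_at_0:
  assumes "a \<ge> 1"
  shows "filterlim k at_top (at_right 0)"
proof -
  define c where "c = 1 / (2 * i0)"
  have c: "c > 0" "c < 1 / i0" using i_0(2) by (auto simp: c_def field_simps)
  have "eventually (\<lambda>x. x powr a * (- k' x) > c) (at_right 0)"
    by (rule order_tendstoD(1)[OF k'_0 c(2)])
  then obtain b where b: "b > 0" "\<And>x. 0 < x \<Longrightarrow> x < b \<Longrightarrow> x powr a * (- k' x) > c"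
    by (auto simp: eventually_at_right_field)
  define \<delta> where "\<delta> = min 1 b / 2"
  have \<delta>: "0 < \<delta>" "\<delta> < 1" "\<delta> < b" using b by (auto simp: \<delta>_def)
  have "c * ln \<delta> - c * ln x \<le> k x" if x: "0 < x" "x < \<delta>" for x
  proof -
    have "k \<delta> + c * ln \<delta> \<le> k x + c * ln x"
    proof (rule DERIV_nonpos_imp_nonincreasing[of x \<delta> "\<lambda>x. k x + c * ln x"])
      fix y assume y: "x \<le> y" "y \<le> \<delta>"
      hence ypos: "y > 0" "y < b" "y \<le> 1" using x \<delta> by auto
      have "y powr a \<le> y powr 1" using ypos assms by (intro powr_mono') auto
      hence "y powr a * (- k' y) \<le> y * (- k' y)"
        using k'_neg[OF ypos(1)] ypos by (intro mult_right_mono) auto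
      hence "c \<le> y * (- k' y)" using b(2)[OF ypos(1,2)] by linarith
      hence "k' y + c / y \<le> 0" using ypos by (simp add: field_simps)
      moreover have "((\<lambda>x. k x + c * ln x) has_real_derivative k' y + c / y) (at y)"
        using ypos by (auto intro!: derivative_eq_intros k_deriv)
      ultimately show "\<exists>d. ((\<lambda>x. k x + c * ln x) has_real_derivative d) (at y) \<and> d \<le> 0" by blast
    qed (use x in auto)
    thus ?thesis using k_pos[OF \<delta>(1)] by linarith
  qed
  hence "eventually (\<lambda>x. c * ln \<delta> - c * ln x \<le> k x) (at_right 0)"
    using \<delta>(1) by (auto simp: eventually_at_right_field)
  moreover have "filterlim (\<lambda>x. c * ln \<delta> - c * ln x) at_top (at_right 0)"
    using c(1) by real_asymp
  ultimately show ?thesis by (rule filterlim_at_top_mono[rotated])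
qed

lemma bounded_homogeneous_solution_zero:
  assumes v: "\<And>x. x > 0 \<Longrightarrow> (v has_real_derivative v' x) (at x)"
    and v': "\<And>x. x > 0 \<Longrightarrow> (v' has_real_derivative v x - a / x * v' x) (at x)"
    and bd: "\<And>x. x > 0 \<Longrightarrow> \<bar>exp (- \<beta> * x) * v x\<bar> \<le> M"
    and \<beta>: "\<bar>\<beta>\<bar> < 1" and a: "a \<ge> 1" and x: "x > 0"
  shows "v x = 0"
proof -
  obtain c1 c2 where c: "\<And>x. x > 0 \<Longrightarrow> v x = c1 * i x + c2 * k x"
    using homogeneous_solution_eq[OF v v'] by blast
  obtain D where D: "\<And>x. x \<ge> 1 \<Longrightarrow> exp (- \<beta> * x) * (- k' x) \<le> D" "D \<ge> 0"
    by (rule k'_exp_bounded[OF \<beta>]) blast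
  have "c1 = 0"
  proof (rule ccontr)
    assume c1: "c1 \<noteq> 0"
    \<comment> \<open>At infinity the k-part is at most |c2| D, so a bounded combination would force
      exp (-\<beta> x) i to be bounded.\<close>
    have "eventually (\<lambda>x. exp (- \<beta> * x) * i x > (M + \<bar>c2\<bar> * D) / \<bar>c1\<bar>) at_top"
      using exp_i_at_top[OF \<beta>] by (simp add: filterlim_at_top_dense)
    with eventually_ge_at_top[of 1] have "eventually (\<lambda>x::real. False) at_top"
    proof eventually_elim
      case (elim x)
      hence x: "x > 0" by simp
      have "exp (- \<beta> * x) * k x \<le> exp (- \<beta> * x) * (- k' x)"
        using k_le[OF x] by (intro mult_left_mono) auto
      hence kD: "exp (- \<beta> * x) * k x \<le> D" using D(1)[OF elim(1)] by linarith
      have "\<bar>c1\<bar> * (exp (- \<beta> * x) * i x) = \<bar>exp (- \<beta> * x) * v x - c2 * (exp (- \<beta> * x) * k x)\<bar>"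
        using i_pos[OF x] by (simp add: c[OF x] algebra_simps abs_mult)
      also have "\<dots> \<le> \<bar>exp (- \<beta> * x) * v x\<bar> + \<bar>c2 * (exp (- \<beta> * x) * k x)\<bar>" by (rule abs_triangle_ineq4)
      also have "\<bar>c2 * (exp (- \<beta> * x) * k x)\<bar> = \<bar>c2\<bar> * (exp (- \<beta> * x) * k x)"
        using k_pos[OF x] by (simp add: abs_mult)
      also have "\<bar>exp (- \<beta> * x) * v x\<bar> + \<bar>c2\<bar> * (exp (- \<beta> * x) * k x) \<le> M + \<bar>c2\<bar> * D"
        using bd[OF x] kD by (intro add_mono mult_left_mono) auto
      finally show False using elim(2) c1 by (simp add: pos_divide_less_eq mult_ac)
    qed
    thus False by simp
  qed
  moreover have "c2 = 0"
  proof (rule ccontr)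
    assume c2: "c2 \<noteq> 0"
    \<comment> \<open>With c1 = 0 already known, v = c2 k; for x < 1 the weight exp (\<beta> x) is
      at most exp 1, which is the factor in the threshold.\<close>
    have "eventually (\<lambda>x. k x > M * exp 1 / \<bar>c2\<bar>) (at_right 0)"
      using k_at_0[OF a] by (simp add: filterlim_at_top_dense)
    moreover have "eventually (\<lambda>x::real. x < 1) (at_right 0)"
      by (auto simp: eventually_at_right_field intro!: exI[of _ 1])
    ultimately have "eventually (\<lambda>x::real. False) (at_right 0)"
      using eventually_at_right_less[of 0]
    proof eventually_elim
      case (elim x)
      have "\<beta> * x \<le> \<bar>\<beta>\<bar> * x" using elim by (intro mult_right_mono) auto
      also have "\<dots> \<le> 1 * 1" using elim \<beta> by (intro mult_mono) auto
      finally have e: "exp (\<beta> * x) \<le> exp 1" by simp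
      have "\<bar>c2\<bar> * k x = exp (\<beta> * x) * \<bar>exp (- \<beta> * x) * v x\<bar>"
        using k_pos[OF elim(3)] \<open>c1 = 0\<close> by (simp add: c[OF elim(3)] abs_mult exp_minus)
      also have "\<dots> \<le> exp 1 * M" using e bd[OF elim(3)] by (intro mult_mono) auto
      finally show False using elim(1) c2 by (simp add: pos_divide_less_eq mult_ac)
    qed
    thus False by simp
  qed
  ultimately show ?thesis using c[OF x] by simp
qed

end

section \<open>The equation on the real line\<close>

lemma AE_lborel_if_negligible:
  assumes "negligible N" "\<And>x. x \<notin> N \<Longrightarrow> P x"
  shows "AE x in lborel. P x"
proof -
  have "AE x in lebesgue. P x"
    by (rule AE_I'[of N]) (use assms negligible_iff_null_sets in auto)
  thus ?thesis by (simp add: AE_completion_iff)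
qed

lemma negligible_if_AE_lborel:
  assumes "AE x in lborel. P (x::real)"
  shows "negligible {x. \<not> P x}"
proof -
  have "AE x in lebesgue. P x" using assms by (simp add: AE_completion_iff)
  then obtain N where "N \<in> null_sets lebesgue" "\<forall>x. x \<notin> N \<longrightarrow> P x" by (auto elim!: AE_E3)
  moreover from this(2) have "{x. \<not> P x} \<subseteq> N" by blast
  ultimately show ?thesis using negligible_iff_null_sets negligible_subset by blast
qed

lemma vg_stein_solution_ac_deriv:
  assumes "vg_stein_solution \<nu> \<beta> h c u" "0 \<notin> S"
  shows "has_ac_derivative_on (deriv u) (deriv (deriv u)) S"
  using assms unfolding vg_stein_solution_def has_ac_derivative_on_def by blast

text \<open>The definition speaks of \<open>deriv (deriv u)\<close>, which agrees with the candidate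
  \<open>u2\<close> only off a null set. That null set comes from \<open>ac_deriv_AE\<close>, and
  altering a density on it changes no integral.\<close>

lemma vg_stein_solutionI:
  fixes u u1 u2 :: "real \<Rightarrow> real"
  assumes cont: "continuous_on UNIV u"
    and d1: "\<And>x. x \<noteq> 0 \<Longrightarrow> (u has_real_derivative u1 x) (at x)"
    and ac: "has_ac_derivative_on u1 u2 {0<..}" "has_ac_derivative_on u1 u2 {..<0}"
    and eq: "\<And>x. x \<noteq> 0 \<Longrightarrow> x * u2 x + (2 * \<nu> + 1 + 2 * \<beta> * x) * u1 x
       + ((2 * \<nu> + 1) * \<beta> - (1 - \<beta>\<^sup>2) * x) * u x = h x - c"
  shows "vg_stein_solution \<nu> \<beta> h c u"
proof -
  have du: "deriv u x = u1 x" if "x \<noteq> 0" for x using d1[OF that] by (rule DERIV_imp_deriv)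
  have ac': "has_ac_derivative_on (deriv u) u2 {0<..}" "has_ac_derivative_on (deriv u) u2 {..<0}"
    by (rule ac_deriv_cong[OF ac(1)] ac_deriv_cong[OF ac(2)]; simp add: du)+
  define N where "N = insert 0 ({x \<in> {0<..}. \<not> (deriv u has_real_derivative u2 x) (at x)} \<union>
      {x \<in> {..<0}. \<not> (deriv u has_real_derivative u2 x) (at x)})"
  have N: "negligible N"
    unfolding N_def using ac_deriv_AE[OF ac'(1)] ac_deriv_AE[OF ac'(2)] by auto
  have d2: "(deriv u has_real_derivative u2 x) (at x)" if "x \<notin> N" for x
    using that unfolding N_def by (cases x "0::real" rule: linorder_cases) auto
  have ddu: "deriv (deriv u) x = u2 x" if "x \<notin> N" for x using d2[OF that] by (rule DERIV_imp_deriv)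
  have ac'': "has_ac_derivative_on (deriv u) (deriv (deriv u)) {0<..}"
    "has_ac_derivative_on (deriv u) (deriv (deriv u)) {..<0}"
    by (rule ac_deriv_cong_AE[OF ac'(1) N] ac_deriv_cong_AE[OF ac'(2) N]; simp add: ddu)+
  show ?thesis
    unfolding vg_stein_solution_def
  proof (intro conjI allI impI)
    show "continuous_on UNIV u" by fact
    show "u differentiable (at x)" if "x \<noteq> 0" for x
      using d1[OF that] real_differentiable_def by blast
    show "AE x in lborel. deriv u differentiable (at x)"
      by (rule AE_lborel_if_negligible[OF N]) (use d2 real_differentiable_def in blast)
    show "AE x in lborel. vg_stein_eq_at \<nu> \<beta> h c u x"
    proof (rule AE_lborel_if_negligible[OF N])
      fix x assume x: "x \<notin> N"
      hence "x \<noteq> 0" by (auto simp: N_def)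
      thus "vg_stein_eq_at \<nu> \<beta> h c u x" unfolding vg_stein_eq_at_def using ddu[OF x] du eq by simp
    qed
  next
    fix a b :: real assume ab: "a \<le> b \<and> 0 \<notin> {a..b}"
    hence "{a..b} \<subseteq> {0<..} \<or> {a..b} \<subseteq> {..<0}" by (auto simp: not_le subset_iff)
    thus "deriv (deriv u) absolutely_integrable_on {a..b}"
      "integral {a..b} (deriv (deriv u)) = deriv u b - deriv u a"
      using ac'' ab unfolding has_ac_derivative_on_def by blast+
  qed
qed

section \<open>Uniqueness of bounded solutions\<close>

context bessel_pair
begin

text \<open>A regularity bootstrap: the density of \<open>d1\<close> is expressed by
  \<open>d\<close> and \<open>d1\<close>, so it is continuous and the equation holds classically.
  Multiplication by exp (\<beta> x) then leads to the homogeneous equation of the pair.\<close>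

lemma bounded_half_line_solution_zero:
  assumes d: "\<And>x. x > 0 \<Longrightarrow> (d has_real_derivative d1 x) (at x)"
    and ac: "has_ac_derivative_on d1 (\<lambda>x. - ((a + 2 * \<beta> * x) * d1 x + (a * \<beta> - (1 - \<beta>\<^sup>2) * x) * d x) / x) {0<..}"
    and bd: "\<And>x. x > 0 \<Longrightarrow> \<bar>d x\<bar> \<le> M"
    and \<beta>: "\<bar>\<beta>\<bar> < 1" and a: "a \<ge> 1" and x: "x > 0"
  shows "d x = 0"
proof -
  let ?d2 = "\<lambda>x. - ((a + 2 * \<beta> * x) * d1 x + (a * \<beta> - (1 - \<beta>\<^sup>2) * x) * d x) / x"
  have d1: "(d1 has_real_derivative ?d2 x) (at x)" if x: "x > 0" for x
  proof (rule ac_deriv_has_real_derivative[OF ac])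
    have "isCont d1 x" by (rule ac_deriv_isCont[OF ac]) (use x in auto)
    moreover have "isCont d x" using d[OF x] by (rule DERIV_isCont)
    ultimately show "isCont ?d2 x" using x by (intro continuous_intros) auto
  qed (use x in auto)
  let ?v = "\<lambda>x. exp (\<beta> * x) * d x" and ?v1 = "\<lambda>x. exp (\<beta> * x) * (d1 x + \<beta> * d x)"
  have e: "((\<lambda>x. exp (\<beta> * x)) has_real_derivative \<beta> * exp (\<beta> * x)) (at x)" for x
    by (auto intro!: derivative_eq_intros)
  have "?v x = 0"
  proof (rule bounded_homogeneous_solution_zero[where v = ?v and v' = ?v1 and \<beta> = \<beta> and M = M])
    fix x :: real assume x: "x > 0"
    have "(?v has_real_derivative \<beta> * exp (\<beta> * x) * d x + d1 x * exp (\<beta> * x)) (at x)"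
      by (rule DERIV_mult e d x)+
    thus "(?v has_real_derivative ?v1 x) (at x)" by (simp add: algebra_simps)
    have "(?v1 has_real_derivative \<beta> * exp (\<beta> * x) * (d1 x + \<beta> * d x) + (?d2 x + \<beta> * d1 x) * exp (\<beta> * x)) (at x)"
      by (rule DERIV_cmult DERIV_mult DERIV_add e d d1 x)+
    moreover have "\<beta> * exp (\<beta> * x) * (d1 x + \<beta> * d x) + (?d2 x + \<beta> * d1 x) * exp (\<beta> * x) = ?v x - a / x * ?v1 x"
      using x by (simp add: field_simps power2_eq_square)
    ultimately show "(?v1 has_real_derivative ?v x - a / x * ?v1 x) (at x)" by simp
    show "\<bar>exp (- \<beta> * x) * ?v x\<bar> \<le> M" using bd[OF x] by (simp add: mult.assoc[symmetric] exp_minus)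
  qed fact+
  thus ?thesis by simp
qed

lemma vg_stein_solution_unique:
  assumes \<nu>: "a = 2 * \<nu> + 1" "\<nu> \<ge> 0" and \<beta>: "\<bar>\<beta>\<bar> < 1"
    and u: "vg_stein_solution \<nu> \<beta> h c u" "bounded (range u)"
    and f: "vg_stein_solution \<nu> \<beta> h c f" "bounded (range f)"
  shows "u = f"
proof -
  define d where "d = (\<lambda>x. u x - f x)"
  define d1 where "d1 = (\<lambda>x. deriv u x - deriv f x)"
  let ?d2 = "\<lambda>x. - ((a + 2 * \<beta> * x) * d1 x + (a * \<beta> - (1 - \<beta>\<^sup>2) * x) * d x) / x"
  have a: "a \<ge> 1" using \<nu> by simp
  obtain M where M: "\<And>x. \<bar>d x\<bar> \<le> M"
  proof -
    obtain M1 M2 where "\<And>x. \<bar>u x\<bar> \<le> M1" "\<And>x. \<bar>f x\<bar> \<le> M2"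
      using u(2) f(2) by (auto simp: bounded_iff)
    hence "\<bar>d x\<bar> \<le> M1 + M2" for x
      unfolding d_def by (meson abs_triangle_ineq4 add_mono order_trans)
    thus ?thesis using that by blast
  qed
  have der: "(d has_real_derivative d1 x) (at x)" if "x \<noteq> 0" for x
    unfolding d_def d1_def
    by (intro DERIV_diff)
      (use u(1) f(1) that in \<open>simp_all add: vg_stein_solution_def DERIV_deriv_iff_real_differentiable\<close>)
  define N where "N = {x. \<not> vg_stein_eq_at \<nu> \<beta> h c u x} \<union> {x. \<not> vg_stein_eq_at \<nu> \<beta> h c f x}"
  have N: "negligible N"
    unfolding N_def using u(1) f(1) unfolding vg_stein_solution_def
    by (intro negligible_Un negligible_if_AE_lborel) auto
  \<comment> \<open>The two equations hold off the null set \<open>N\<close>, and there the unknown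
    second derivatives cancel in favour of the continuous expression \<open>?d2\<close>.\<close>
  have ac: "has_ac_derivative_on d1 ?d2 S" if S: "0 \<notin> S" for S
  proof (rule ac_deriv_cong_AE[OF _ N])
    show "has_ac_derivative_on d1 (\<lambda>x. deriv (deriv u) x - deriv (deriv f) x) S"
      unfolding d1_def by (intro ac_deriv_diff vg_stein_solution_ac_deriv[OF u(1)] vg_stein_solution_ac_deriv[OF f(1)] S)
    fix x assume "x \<in> S - N"
    hence x: "x \<noteq> 0" "vg_stein_eq_at \<nu> \<beta> h c u x" "vg_stein_eq_at \<nu> \<beta> h c f x" using S by (auto simp: N_def)
    have "x * (deriv (deriv u) x - deriv (deriv f) x) = - ((a + 2 * \<beta> * x) * d1 x + (a * \<beta> - (1 - \<beta>\<^sup>2) * x) * d x)"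
      using x(2,3) unfolding vg_stein_eq_at_def d1_def d_def \<nu>(1) by (simp add: algebra_simps)
    thus "?d2 x = deriv (deriv u) x - deriv (deriv f) x" using x(1) by (simp add: field_simps)
  qed
  have pos: "d x = 0" if "x > 0" for x
    by (rule bounded_half_line_solution_zero[OF der ac M \<beta> a that]) auto
  \<comment> \<open>The reflected function d(-x) satisfies the homogeneous equation with -\<beta> in
    place of \<beta>.\<close>
  have neg: "d (- x) = 0" if "x > 0" for x
  proof (rule bounded_half_line_solution_zero[where d = "\<lambda>x. d (- x)" and ?d1.0 = "\<lambda>x. - d1 (- x)" and \<beta> = "- \<beta>" and M = M])
    fix x :: real assume "x > 0"
    thus "((\<lambda>x. d (- x)) has_real_derivative - d1 (- x)) (at x)"
      using DERIV_mirror[of d "d1 (- x)" x] der[of "- x"] by simp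
  next
    have img: "uminus ` {..<0} = {0::real<..}" by (simp add: image_uminus_lessThan)
    have "has_ac_derivative_on (\<lambda>x. d1 (- x)) (\<lambda>x. - ?d2 (- x)) {0<..}"
      using ac_deriv_reflect[OF ac[of "{..<0}"]] unfolding img by simp
    from ac_deriv_cmult[OF this, of "-1"]
    show "has_ac_derivative_on (\<lambda>x. - d1 (- x))
       (\<lambda>x. - ((a + 2 * - \<beta> * x) * - d1 (- x) + (a * - \<beta> - (1 - (- \<beta>)\<^sup>2) * x) * d (- x)) / x) {0<..}"
      by (rule ac_deriv_cong) (auto simp: field_simps)
  qed (use M \<beta> a that in auto)
  have nz: "d x = 0" if "x \<noteq> 0" for x
    using pos[of x] neg[of "- x"] that by (cases "x > 0") auto
  have "d 0 = 0"
  proof -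
    have "isCont d 0" unfolding d_def
      using u(1) f(1) by (auto simp: vg_stein_solution_def continuous_on_eq_continuous_at intro!: continuous_intros)
    hence "(d \<longlongrightarrow> d 0) (at 0)" by (simp add: isCont_def)
    moreover have "(d \<longlongrightarrow> 0) (at 0)"
      by (rule Lim_transform_eventually[OF tendsto_const]) (auto simp: eventually_at_filter nz)
    ultimately show ?thesis using tendsto_unique[OF _ _ _, of "at 0" d] by auto
  qed
  with nz have "d x = 0" for x by (cases "x = 0") auto
  thus ?thesis by (auto simp: d_def fun_eq_iff)
qed

end

text \<open>\<open>F0_eq\<close> is all that remains here of the mean-zero property of h - c: it is
  the condition that the two half-line solutions meet continuously at 0.\<close>

locale stein_line = bessel_pair +
  fixes \<beta> :: real and h :: "real \<Rightarrow> real" and c :: real and \<nu> :: real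
  assumes pos: "stein_half a i i' k k' i0 \<beta> (\<lambda>x. h x - c)"
    and neg: "stein_half a i i' k k' i0 (- \<beta>) (\<lambda>x. h (- x) - c)"
    and F0_eq: "stein_half.F0 a k i0 \<beta> (\<lambda>x. h x - c) = - stein_half.F0 a k i0 (- \<beta>) (\<lambda>x. h (- x) - c)"
    and a_eq: "a = 2 * \<nu> + 1"
begin

sublocale P: stein_half a i i' k k' i0 \<beta> "\<lambda>x. h x - c" by (rule pos)
sublocale N: stein_half a i i' k k' i0 "- \<beta>" "\<lambda>x. h (- x) - c" by (rule neg)

text \<open>The minus sign on the left: replacing x by -x and \<beta> by -\<beta> reverses the sign
  of the left-hand side of the equation. The values of \<open>f1\<close> and \<open>f2\<close> at 0
  are irrelevant defaults.\<close>

definition f :: "real \<Rightarrow> real" where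
  "f x = (if x > 0 then P.F x else if x < 0 then - N.F (- x) else P.F0)"
definition f1 :: "real \<Rightarrow> real" where
  "f1 x = (if x > 0 then P.F1 x else N.F1 (- x))"
definition f2 :: "real \<Rightarrow> real" where
  "f2 x = (if x > 0 then P.F2 x else - N.F2 (- x))"

lemma f_deriv:
  assumes "x \<noteq> 0"
  shows "(f has_real_derivative f1 x) (at x)"
proof (cases "x > 0")
  case True
  hence "(P.F has_real_derivative f1 x) (at x)" using P.F_deriv[OF True] by (simp add: f1_def)
  thus ?thesis
    by (rule has_field_derivative_transform_within_open[where S = "{0<..}"]) (use True in \<open>auto simp: f_def\<close>)
next
  case False
  hence x: "- x > 0" using assms by simp
  have "((\<lambda>x. N.F (- x)) has_real_derivative - N.F1 (- x)) (at x)"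
    using N.F_deriv[OF x] by (subst (asm) DERIV_mirror) simp
  from DERIV_minus[OF this] have "((\<lambda>x. - N.F (- x)) has_real_derivative f1 x) (at x)"
    using False by (simp add: f1_def)
  thus ?thesis
    by (rule has_field_derivative_transform_within_open[where S = "{..<0}"]) (use x in \<open>auto simp: f_def\<close>)
qed

lemma deriv_f: "x \<noteq> 0 \<Longrightarrow> deriv f x = f1 x"
  by (rule DERIV_imp_deriv[OF f_deriv])

lemma ac_f1: "has_ac_derivative_on f1 f2 {0<..}" "has_ac_derivative_on f1 f2 {..<0}"
proof -
  show "has_ac_derivative_on f1 f2 {0<..}"
    by (rule ac_deriv_cong[OF P.ac_F1]) (auto simp: f1_def f2_def)
  have "uminus ` {0<..} = {..<0::real}" by (simp add: image_uminus_greaterThan)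
  with ac_deriv_reflect[OF N.ac_F1] show "has_ac_derivative_on f1 f2 {..<0}"
    by (auto intro: ac_deriv_cong simp: f1_def f2_def)
qed

lemma f_eq:
  assumes "x \<noteq> 0"
  shows "x * f2 x + (2 * \<nu> + 1 + 2 * \<beta> * x) * f1 x + ((2 * \<nu> + 1) * \<beta> - (1 - \<beta>\<^sup>2) * x) * f x = h x - c"
proof (cases "x > 0")
  case True
  thus ?thesis using P.F_eq[OF True] by (simp add: f_def f1_def f2_def a_eq[symmetric])
next
  case False
  hence "- x > 0" using assms by simp
  note eq = N.F_eq[OF this]
  have f: "f x = - N.F (- x)" "f1 x = N.F1 (- x)" "f2 x = - N.F2 (- x)"
    using False assms by (auto simp: f_def f1_def f2_def)
  show ?thesis using eq unfolding a_eq[symmetric] f by (simp add: algebra_simps)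
qed

lemma f_at_0: "(f \<longlongrightarrow> P.F0) (at 0)"
proof -
  have "(f \<longlongrightarrow> P.F0) (at_right 0)"
    by (rule Lim_transform_eventually[OF P.F_at_0])
      (use eventually_at_right_less[of 0] in \<open>auto elim!: eventually_mono simp: f_def\<close>)
  moreover have "(f \<longlongrightarrow> P.F0) (at_left 0)"
    unfolding filterlim_at_left_to_right[of f _ 0]
    by (rule Lim_transform_eventually[where f = "\<lambda>x. - N.F x"])
      (use tendsto_minus[OF N.F_at_0] F0_eq eventually_at_right_less[of 0] in
        \<open>auto elim!: eventually_mono simp: f_def\<close>)
  ultimately show ?thesis by (simp add: filterlim_split_at)
qed

lemma f_isCont: "isCont f x"
proof (cases "x = 0")
  case True
  thus ?thesis using f_at_0 by (simp add: isCont_def f_def)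
qed (use f_deriv DERIV_isCont in blast)

lemma f_solution: "vg_stein_solution \<nu> \<beta> h c f"
  by (rule vg_stein_solutionI[OF _ f_deriv ac_f1 f_eq])
    (auto intro: continuous_at_imp_continuous_on f_isCont)

lemma f1_deriv:
  assumes "x \<noteq> 0" "isCont h x"
  shows "(f1 has_real_derivative f2 x) (at x)"
proof (cases "x > 0")
  case True
  have "isCont (\<lambda>x. h x - c) x" using assms by (intro continuous_intros)
  with P.F1_deriv[OF True] have "(P.F1 has_real_derivative f2 x) (at x)" using True by (simp add: f2_def)
  thus ?thesis
    by (rule has_field_derivative_transform_within_open[where S = "{0<..}"]) (use True in \<open>auto simp: f1_def\<close>)
next
  case False
  hence x: "- x > 0" using assms by simp
  have "isCont (\<lambda>x. h (- x)) (- x)"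
    using isCont_o2[of "- x" uminus h] assms(2) by (simp add: continuous_intros)
  hence "isCont (\<lambda>x. h (- x) - c) (- x)" by (intro continuous_intros)
  from N.F1_deriv[OF x this] have "((\<lambda>x. N.F1 (- x)) has_real_derivative f2 x) (at x)"
    using False by (subst (asm) DERIV_mirror) (simp add: f2_def)
  thus ?thesis
    by (rule has_field_derivative_transform_within_open[where S = "{..<0}"]) (use x in \<open>auto simp: f1_def\<close>)
qed

lemma deriv_f_deriv:
  assumes "x \<noteq> 0" "isCont h x"
  shows "(deriv f has_real_derivative f2 x) (at x)"
  by (rule has_field_derivative_transform_within_open[OF f1_deriv[OF assms], where S = "- {0}"])
    (use assms deriv_f in auto)

lemma f_deriv_at_0:
  assumes "isCont h 0"
  shows "(f has_real_derivative (h 0 - c) / a - \<beta> * P.F0) (at 0)"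
proof -
  have "(h \<longlongrightarrow> h 0) (at_right 0)" "(h \<longlongrightarrow> h 0) (at_left 0)"
    using assms by (simp_all add: isCont_def filterlim_split_at_real filterlim_at_split)
  hence h: "((\<lambda>x. h x - c) \<longlongrightarrow> h 0 - c) (at_right 0)" "((\<lambda>x. h (- x) - c) \<longlongrightarrow> h 0 - c) (at_right 0)"
    unfolding filterlim_at_left_to_right[of h _ 0] by (auto intro!: tendsto_intros)
  have "((\<lambda>y. (f y - f 0) / y) \<longlongrightarrow> (h 0 - c) / a - \<beta> * P.F0) (at_right 0)"
    by (rule Lim_transform_eventually[OF P.F_deriv_at_0[OF h(1)]])
      (use eventually_at_right_less[of 0] in \<open>auto elim!: eventually_mono simp: f_def\<close>)
  moreover have "((\<lambda>y. (f y - f 0) / y) \<longlongrightarrow> (h 0 - c) / a - \<beta> * P.F0) (at_left 0)"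
    unfolding filterlim_at_left_to_right[of _ _ 0] minus_zero
  proof (rule Lim_transform_eventually)
    \<comment> \<open>The left-hand limit is (h(0) - c)/a + \<beta> N.F0; by \<open>F0_eq\<close>
      the change of sign of \<beta> is offset by that of \<open>F0\<close>, so both sides
      agree.\<close>
    show "((\<lambda>x. (N.F x - N.F0) / x) \<longlongrightarrow> (h 0 - c) / a - \<beta> * P.F0) (at_right 0)"
      using N.F_deriv_at_0[OF h(2)] F0_eq by simp
    show "eventually (\<lambda>x. (N.F x - N.F0) / x = (f (- x) - f 0) / - x) (at_right 0)"
      using eventually_at_right_less[of 0]
    proof eventually_elim
      case (elim x)
      have "(f (- x) - f 0) / - x = (N.F x + P.F0) / x" using elim by (simp add: f_def field_simps)
      thus ?case using F0_eq by simp
    qed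
  qed
  ultimately have "((\<lambda>y. (f y - f 0) / y) \<longlongrightarrow> (h 0 - c) / a - \<beta> * P.F0) (at 0)"
    by (simp add: filterlim_split_at)
  thus ?thesis by (simp add: has_field_derivative_iff)
qed

lemma f_classical:
  assumes "isCont h x"
  shows "f differentiable (at x)" "x \<noteq> 0 \<Longrightarrow> deriv f differentiable (at x)" "vg_stein_eq_at \<nu> \<beta> h c f x"
proof -
  show "f differentiable (at x)"
    using f_deriv[of x] f_deriv_at_0 assms real_differentiable_def by (cases "x = 0") blast+
  show "deriv f differentiable (at x)" if "x \<noteq> 0"
    using deriv_f_deriv[OF that assms] real_differentiable_def by blast
  show "vg_stein_eq_at \<nu> \<beta> h c f x"
  proof (cases "x = 0")
    \<comment> \<open>At 0 the second-order term is multiplied by 0, so the equation reduces to a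
      relation between f(0) and f'(0) that \<open>f_deriv_at_0\<close> satisfies.\<close>
    case True
    have "deriv f 0 = (h 0 - c) / a - \<beta> * P.F0"
      using f_deriv_at_0 assms True by (auto intro: DERIV_imp_deriv)
    moreover have "f 0 = P.F0" by (simp add: f_def)
    moreover have "a * ((h 0 - c) / a - \<beta> * P.F0) + a * \<beta> * P.F0 = h 0 - c"
      using a_pos by (simp add: field_simps)
    ultimately show ?thesis unfolding True vg_stein_eq_at_def by (simp add: a_eq[symmetric])
  next
    case False
    thus ?thesis unfolding vg_stein_eq_at_def
      using f_eq[OF False] deriv_f[OF False] DERIV_imp_deriv[OF deriv_f_deriv[OF False assms]] by simp
  qed
qed

lemma f_bounded:
  assumes "bounded (range h)"
  shows "bounded (range f)" "\<exists>C. \<forall>x. f differentiable (at x) \<longrightarrow> \<bar>deriv f x\<bar> \<le> C"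
proof -
  obtain H where H: "\<And>x. \<bar>h x\<bar> \<le> H" using assms by (auto simp: bounded_iff)
  have b: "\<bar>h x - c\<bar> \<le> H + \<bar>c\<bar>" for x using H[of x] by linarith
  obtain M1 where M1: "\<And>x. x > 0 \<Longrightarrow> \<bar>P.F x\<bar> \<le> M1" "\<And>x. x > 0 \<Longrightarrow> \<bar>P.F1 x\<bar> \<le> M1"
    by (rule P.F_bounded[OF b]) blast
  obtain M2 where M2: "\<And>x. x > 0 \<Longrightarrow> \<bar>N.F x\<bar> \<le> M2" "\<And>x. x > 0 \<Longrightarrow> \<bar>N.F1 x\<bar> \<le> M2"
    by (rule N.F_bounded[OF b]) blast
  have "\<bar>f x\<bar> \<le> max (max M1 M2) \<bar>P.F0\<bar>" for x
    using M1(1)[of x] M2(1)[of "- x"] by (cases x "0::real" rule: linorder_cases) (auto simp: f_def)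
  thus "bounded (range f)" by (auto simp: bounded_iff)
  \<comment> \<open>\<open>deriv f 0\<close> is some fixed number whether or not \<open>f\<close> is
    differentiable at 0, so it can simply be included in the maximum.\<close>
  have "\<bar>deriv f x\<bar> \<le> max (max M1 M2) \<bar>deriv f 0\<bar>" for x
    using M1(2)[of x] M2(2)[of "- x"]
    by (cases x "0::real" rule: linorder_cases) (auto simp: deriv_f f1_def)
  thus "\<exists>C. \<forall>x. f differentiable (at x) \<longrightarrow> \<bar>deriv f x\<bar> \<le> C" by blast
qed

end

section \<open>Identification of the explicit formula with the half-line solutions\<close>

abbreviation vg_kernel :: "real \<Rightarrow> real \<Rightarrow> real \<Rightarrow> real" where
  "vg_kernel \<nu> \<beta> y \<equiv> exp (\<beta> * y) * \<bar>y\<bar> powr \<nu> * bessel_K \<nu> \<bar>y\<bar>"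

abbreviation vg_half :: "real \<Rightarrow> real \<Rightarrow> (real \<Rightarrow> real) \<Rightarrow> bool" where
  "vg_half \<nu> \<beta> g \<equiv> stein_half (2 * \<nu> + 1) (reduced_I \<nu>) (\<lambda>x. x * reduced_I (\<nu> + 1) x)
     (reduced_K \<nu>) (\<lambda>x. - x * reduced_K (\<nu> + 1) x) (reduced_I \<nu> 0) \<beta> g"

lemma bessel_K_eq_reduced: "x > 0 \<Longrightarrow> bessel_K \<nu> x = x powr \<nu> * reduced_K \<nu> x"
  by (simp add: reduced_K_def powr_minus)

lemma vg_kernel_eq:
  assumes "y > 0"
  shows "vg_kernel \<nu> \<beta> y = exp (\<beta> * y) * y powr (2 * \<nu> + 1 - 1) * reduced_K \<nu> y"
  using assms by (simp add: bessel_K_eq_reduced powr_add[symmetric])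

lemma vg_half_if_integrable:
  assumes "\<nu> > - 1/2" "\<bar>\<beta>\<bar> < 1"
    and "integrable lborel (vg_kernel \<nu> \<beta>)" "integrable lborel (\<lambda>y. vg_kernel \<nu> \<beta> y * g y)"
  shows "vg_half \<nu> \<beta> g"
proof -
  interpret bessel_pair "2 * \<nu> + 1" "reduced_I \<nu>" "\<lambda>x. x * reduced_I (\<nu> + 1) x"
     "reduced_K \<nu>" "\<lambda>x. - x * reduced_K (\<nu> + 1) x" "reduced_I \<nu> 0"
    by (rule bessel_pair_reduced[OF assms(1)])
  have ai: "\<phi> absolutely_integrable_on {0<..}" if "integrable lborel \<psi>" "\<And>y. y > 0 \<Longrightarrow> \<phi> y = \<psi> y" for \<phi> \<psi> :: "real \<Rightarrow> real"
  proof (rule absolutely_integrable_spike[where f = \<psi> and S = "{}"])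
    have "set_integrable lborel {0<..} \<psi>"
      by (rule set_integrable_subset[of _ UNIV]) (use that(1) in \<open>auto simp: set_integrable_def\<close>)
    thus "\<psi> absolutely_integrable_on {0<..}" by (rule set_integrable_lborel_imp_absolutely_integrable_on)
  qed (use that in auto)
  show ?thesis
  proof unfold_locales
    show "\<bar>\<beta>\<bar> < 1" by fact
    show "(\<lambda>y. exp (\<beta> * y) * y powr (2 * \<nu> + 1 - 1) * reduced_K \<nu> y) absolutely_integrable_on {0<..}"
      by (rule ai[OF assms(3)]) (simp only: vg_kernel_eq)
    show "(\<lambda>y. exp (\<beta> * y) * y powr (2 * \<nu> + 1 - 1) * reduced_K \<nu> y * g y) absolutely_integrable_on {0<..}"
      by (rule ai[OF assms(4)]) (simp only: vg_kernel_eq)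
  qed
qed

lemma reduced_I_borel_measurable: "\<nu> > -1 \<Longrightarrow> reduced_I \<nu> \<in> borel_measurable borel"
  by (intro borel_measurable_continuous_onI continuous_at_imp_continuous_on)
    (auto intro: DERIV_isCont[OF reduced_I_has_real_derivative])

lemma LBINT_eq_A:
  assumes \<nu>: "\<nu> > - 1/2" and half: "vg_half \<nu> \<beta> g" and g: "g \<in> borel_measurable borel" and x: "x > 0"
  shows "(LBINT y=0..ereal x. exp (\<beta> * y) * \<bar>y\<bar> powr \<nu> * bessel_I \<nu> \<bar>y\<bar> * g y)
    = stein_half.A (2 * \<nu> + 1) (reduced_I \<nu>) \<beta> g x"
proof -
  interpret S: stein_half "2 * \<nu> + 1" "reduced_I \<nu>" "\<lambda>x. x * reduced_I (\<nu> + 1) x"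
     "reduced_K \<nu>" "\<lambda>x. - x * reduced_K (\<nu> + 1) x" "reduced_I \<nu> 0" \<beta> g by (rule half)
  let ?\<psi> = "\<lambda>y. S.w y * reduced_I \<nu> y * g y"
  note [measurable] = reduced_I_borel_measurable g
  have m: "?\<psi> \<in> borel_measurable borel"
  proof -
    have "\<nu> > -1" using \<nu> by simp
    thus ?thesis unfolding S.w_def by measurable
  qed
  \<comment> \<open>Absolute integrability refers to Lebesgue measure; as the integrand is Borel
    measurable, it transfers to \<open>lborel\<close>, where the interval integral of the formula
    lives.\<close>
  have "?\<psi> absolutely_integrable_on {0<..<x}" by (rule S.int_ir[OF x])
  hence si: "set_integrable lborel {0<..<x} ?\<psi>"
    unfolding set_integrable_def using m by (subst (asm) integrable_completion) auto
  have "(LBINT y=0..ereal x. exp (\<beta> * y) * \<bar>y\<bar> powr \<nu> * bessel_I \<nu> \<bar>y\<bar> * g y)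
     = (LBINT y:{0<..<x}. exp (\<beta> * y) * \<bar>y\<bar> powr \<nu> * bessel_I \<nu> \<bar>y\<bar> * g y)"
    using x by (subst interval_lebesgue_integral_le_eq) (auto simp: zero_ereal_def)
  also have "\<dots> = (LBINT y:{0<..<x}. ?\<psi> y)"
    by (rule set_lebesgue_integral_cong)
      (use \<nu> in \<open>auto simp: bessel_I_eq_reduced S.w_def powr_add[symmetric]\<close>)
  also have "\<dots> = S.A x" unfolding S.A_def by (rule set_borel_integral_eq_integral(2)[OF si])
  finally show ?thesis .
qed

lemma LBINT_eq_B:
  assumes half: "vg_half \<nu> \<beta> g" and int: "integrable lborel (\<lambda>y. vg_kernel \<nu> \<beta> y * g y)" and x: "x \<ge> 0"
  shows "(LBINT y=ereal x..\<infinity>. vg_kernel \<nu> \<beta> y * g y)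
    = stein_half.B (2 * \<nu> + 1) (reduced_K \<nu>) \<beta> g x"
proof -
  interpret S: stein_half "2 * \<nu> + 1" "reduced_I \<nu>" "\<lambda>x. x * reduced_I (\<nu> + 1) x"
     "reduced_K \<nu>" "\<lambda>x. - x * reduced_K (\<nu> + 1) x" "reduced_I \<nu> 0" \<beta> g by (rule half)
  have si: "set_integrable lborel {x<..} (\<lambda>y. vg_kernel \<nu> \<beta> y * g y)"
    by (rule set_integrable_subset[of _ UNIV]) (use int in \<open>auto simp: set_integrable_def\<close>)
  have "(LBINT y=ereal x..\<infinity>. vg_kernel \<nu> \<beta> y * g y) = integral {x<..} (\<lambda>y. vg_kernel \<nu> \<beta> y * g y)"
    unfolding interval_integral_to_infinity_eq by (rule set_borel_integral_eq_integral(2)[OF si])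
  also have "\<dots> = S.B x"
    unfolding S.B_def by (rule Henstock_Kurzweil_Integration.integral_cong)
      (use x vg_kernel_eq in \<open>auto simp: S.w_def\<close>)
  finally show ?thesis .
qed

lemma vg_stein_formula_pos:
  assumes \<nu>: "\<nu> > - 1/2" and half: "vg_half \<nu> \<beta> (\<lambda>y. h y - c)" and h: "h \<in> borel_measurable borel"
    and int: "integrable lborel (\<lambda>y. vg_kernel \<nu> \<beta> y * (h y - c))" and x: "x > 0"
  shows "vg_stein_formula \<nu> \<beta> h c x = stein_half.F (2 * \<nu> + 1) (reduced_I \<nu>) (reduced_K \<nu>) \<beta> (\<lambda>y. h y - c) x"
proof -
  interpret S: stein_half "2 * \<nu> + 1" "reduced_I \<nu>" "\<lambda>x. x * reduced_I (\<nu> + 1) x"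
     "reduced_K \<nu>" "\<lambda>x. - x * reduced_K (\<nu> + 1) x" "reduced_I \<nu> 0" \<beta> "\<lambda>y. h y - c" by (rule half)
  have m: "(\<lambda>y. h y - c) \<in> borel_measurable borel" using h by measurable
  have "bessel_K \<nu> x / x powr \<nu> = reduced_K \<nu> x" "bessel_I \<nu> x / x powr \<nu> = reduced_I \<nu> x"
    using x \<nu> by (simp_all add: bessel_K_eq_reduced bessel_I_eq_reduced)
  hence "exp (- \<beta> * x) * bessel_K \<nu> \<bar>x\<bar> / \<bar>x\<bar> powr \<nu> = exp (- \<beta> * x) * reduced_K \<nu> x"
    "exp (- \<beta> * x) * bessel_I \<nu> \<bar>x\<bar> / \<bar>x\<bar> powr \<nu> = exp (- \<beta> * x) * reduced_I \<nu> x"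
    using x by (simp_all flip: times_divide_eq_right)
  thus ?thesis
    unfolding vg_stein_formula_def LBINT_eq_A[OF \<nu> half m x] LBINT_eq_B[OF half int less_imp_le[OF x]]
      S.F_def S.G_def by (simp add: algebra_simps)
qed

lemma integrable_reflect_lborel:
  fixes f :: "real \<Rightarrow> real"
  assumes "integrable lborel f"
  shows "integrable lborel (\<lambda>x. f (- x))"
  using lborel_integrable_real_affine[OF assms, of "-1" 0] by simp

lemma integrable_imp_interval_lebesgue_integrable:
  fixes f :: "real \<Rightarrow> real"
  assumes "integrable lborel f"
  shows "interval_lebesgue_integrable lborel a b f"
  unfolding interval_lebesgue_integrable_def set_integrable_def
  by (auto intro!: integrable_mult_indicator assms simp del: real_scaleR_def)

text \<open>As the total integral vanishes, the upper tail from b is minus the lower tail up to b,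
  which reflection turns into an upper tail from -b. This is how the mean-zero property enters, both
  for negative x and for the matching at 0.\<close>

lemma LBINT_split_zero:
  fixes f :: "real \<Rightarrow> real"
  assumes "integrable lborel f" "(LINT x|lborel. f x) = 0"
  shows "(LBINT y=b..\<infinity>. f y) = - (LBINT y=-b..\<infinity>. f (- y))"
proof -
  have "(LBINT y=-\<infinity>..b. f y) + (LBINT y=b..\<infinity>. f y) = (LBINT y=-\<infinity>..\<infinity>. f y)"
    by (intro interval_integral_sum integrable_imp_interval_lebesgue_integrable assms)
  also have "\<dots> = 0" using assms(2) by (simp add: interval_lebesgue_integral_def set_lebesgue_integral_def einterval_def)
  finally show ?thesis using interval_integral_reflect[of "-\<infinity>" b f] by simp
qed

text \<open>The formula changes sign under reflection: its first integral does so by orientation,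
  its second, which runs across 0, by \<open>LBINT_split_zero\<close>. Then
  \<open>vg_stein_formula_pos\<close> applies with -\<beta>.\<close>

lemma vg_stein_formula_neg:
  assumes \<nu>: "\<nu> > - 1/2" and half: "vg_half \<nu> (- \<beta>) (\<lambda>y. h (- y) - c)" and h: "h \<in> borel_measurable borel"
    and int: "integrable lborel (\<lambda>y. vg_kernel \<nu> \<beta> y * (h y - c))"
    and zero: "(LINT y|lborel. vg_kernel \<nu> \<beta> y * (h y - c)) = 0" and x: "x < 0"
  shows "vg_stein_formula \<nu> \<beta> h c x
    = - stein_half.F (2 * \<nu> + 1) (reduced_I \<nu>) (reduced_K \<nu>) (- \<beta>) (\<lambda>y. h (- y) - c) (- x)"
proof -
  let ?h = "\<lambda>y. h (- y)"
  have x': "- x > 0" using x by simp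
  have mh: "?h \<in> borel_measurable borel" using h by measurable
  have int': "integrable lborel (\<lambda>y. vg_kernel \<nu> (- \<beta>) y * (?h y - c))"
    using integrable_reflect_lborel[OF int] by simp
  have "(LBINT y=0..ereal x. exp (\<beta> * y) * \<bar>y\<bar> powr \<nu> * bessel_I \<nu> \<bar>y\<bar> * (h y - c))
    = - (LBINT y=0..ereal (- x). exp (- \<beta> * y) * \<bar>y\<bar> powr \<nu> * bessel_I \<nu> \<bar>y\<bar> * (?h y - c))"
    by (subst interval_integral_reflect, subst interval_integral_endpoints_reverse) simp
  moreover have "(LBINT y=ereal x..\<infinity>. vg_kernel \<nu> \<beta> y * (h y - c))
    = - (LBINT y=ereal (- x)..\<infinity>. vg_kernel \<nu> (- \<beta>) y * (?h y - c))"
    using LBINT_split_zero[OF int zero, of "ereal x"] by simp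
  ultimately have "vg_stein_formula \<nu> \<beta> h c x = - vg_stein_formula \<nu> (- \<beta>) ?h c (- x)"
    unfolding vg_stein_formula_def by simp
  thus ?thesis using vg_stein_formula_pos[OF \<nu> half mh int' x'] by simp
qed

lemma vg2_density_eq:
  "vg2_density \<nu> \<beta> x = (1 - \<beta>\<^sup>2) powr (\<nu> + 1/2) / (sqrt pi * Gamma (\<nu> + 1/2)) / 2 powr \<nu> * vg_kernel \<nu> \<beta> x"
  by (simp add: vg2_density_def powr_divide)

lemma vg_kernel_nonneg: "vg_kernel \<nu> \<beta> x \<ge> 0"
  using bessel_K_pos[of "\<bar>x\<bar>" \<nu>] by (cases "x = 0") auto

text \<open>The conjunct for continuity points of \<open>h\<close> recovers the classical meaning of
  the equation, including the point 0, which an almost-everywhere statement does not see.\<close>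

theorem lemma3p3:
  fixes M :: "'a measure" and X :: "'a \<Rightarrow> real" and h f :: "real \<Rightarrow> real" and \<nu> \<beta> Eh :: real
  assumes "prob_space M"
    and "\<nu> > - 1/2" and "- 1 < \<beta>" and "\<beta> < 1"
    and "distributed M lborel X (\<lambda>x. ennreal (vg2_density \<nu> \<beta> x))"
    and "h \<in> borel_measurable borel"
    and "integrable M (\<lambda>\<omega>. \<bar>h (X \<omega>)\<bar>)"
    and "Eh = prob_space.expectation M (\<lambda>\<omega>. h (X \<omega>))"
    and "f = vg_stein_sol \<nu> \<beta> h Eh"
  shows "vg_stein_solution \<nu> \<beta> h Eh f
    \<and> (\<forall>x. isCont h x \<longrightarrow>
          f differentiable (at x) \<and> (x \<noteq> 0 \<longrightarrow> deriv f differentiable (at x))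
          \<and> vg_stein_eq_at \<nu> \<beta> h Eh f x)
    \<and> (bounded (range h) \<longrightarrow>
          bounded (range f)
          \<and> (\<exists>C. \<forall>x. f differentiable (at x) \<longrightarrow> \<bar>deriv f x\<bar> \<le> C)
          \<and> (\<nu> \<ge> 0 \<longrightarrow>
               (\<forall>u. vg_stein_solution \<nu> \<beta> h Eh u \<and> bounded (range u) \<longrightarrow> u = f)))"
proof -
  interpret prob_space M by fact
  note \<nu> = assms(2) and D = assms(5) and h[measurable] = assms(6)
  have \<beta>: "\<bar>\<beta>\<bar> < 1" using assms(3,4) by linarith
  have X[measurable]: "X \<in> borel_measurable M" using distributed_measurable[OF D] by simp
  let ?\<kappa> = "vg_kernel \<nu> \<beta>"
  define C0 where "C0 = (1 - \<beta>\<^sup>2) powr (\<nu> + 1/2) / (sqrt pi * Gamma (\<nu> + 1/2)) / 2 powr \<nu>"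
  have "1 - \<beta>\<^sup>2 > 0" using \<beta> by (simp add: abs_square_less_1)
  hence C0: "C0 > 0" using \<nu> by (simp add: C0_def Gamma_real_pos)
  have dens: "vg2_density \<nu> \<beta> x = C0 * ?\<kappa> x" for x unfolding C0_def by (rule vg2_density_eq)
  have dens_nonneg: "vg2_density \<nu> \<beta> x \<ge> 0" for x
    unfolding dens using C0 vg_kernel_nonneg[where x = x and \<nu> = \<nu> and \<beta> = \<beta>] by simp
  have "integrable M (\<lambda>\<omega>. h (X \<omega>))"
    using assms(7) by (subst (asm) integrable_abs_iff) auto
  hence int_hX: "integrable M (\<lambda>\<omega>. h (X \<omega>) - Eh)" by simp
  \<comment> \<open>Integrability of the kernel needs no Bessel estimate: the density is that of a
    random variable, and the constant 1 is integrable over a probability space.\<close>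
  have int_\<kappa>: "integrable lborel ?\<kappa>"
  proof -
    have "integrable lborel (\<lambda>x. vg2_density \<nu> \<beta> x * 1)"
      by (subst distributed_integrable[OF D]) (use dens_nonneg in auto)
    thus ?thesis unfolding dens using C0 by simp
  qed
  have int_\<kappa>h: "integrable lborel (\<lambda>x. ?\<kappa> x * (h x - Eh))"
  proof -
    have "integrable lborel (\<lambda>x. vg2_density \<nu> \<beta> x * (h x - Eh))"
      by (subst distributed_integrable[OF D]) (use dens_nonneg int_hX in auto)
    thus ?thesis unfolding dens mult.assoc using C0 by simp
  qed
  have zero: "(LINT x|lborel. ?\<kappa> x * (h x - Eh)) = 0"
  proof -
    have "(LINT x|lborel. vg2_density \<nu> \<beta> x * (h x - Eh)) = expectation (\<lambda>\<omega>. h (X \<omega>) - Eh)"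
      by (rule distributed_integral[OF D]) (use dens_nonneg in auto)
    also have "\<dots> = 0" using \<open>integrable M (\<lambda>\<omega>. h (X \<omega>))\<close> assms(8) by (simp add: prob_space)
    finally show ?thesis unfolding dens mult.assoc using C0 by simp
  qed
  have half_pos: "vg_half \<nu> \<beta> (\<lambda>x. h x - Eh)"
    by (rule vg_half_if_integrable[OF \<nu> \<beta> int_\<kappa> int_\<kappa>h])
  have int_\<kappa>h': "integrable lborel (\<lambda>x. vg_kernel \<nu> (- \<beta>) x * (h (- x) - Eh))"
    using integrable_reflect_lborel[OF int_\<kappa>h] by simp
  have half_neg: "vg_half \<nu> (- \<beta>) (\<lambda>x. h (- x) - Eh)"
    by (rule vg_half_if_integrable[OF \<nu> _ _ int_\<kappa>h'])
      (use \<beta> integrable_reflect_lborel[OF int_\<kappa>] in auto)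
  interpret P: stein_half "2 * \<nu> + 1" "reduced_I \<nu>" "\<lambda>x. x * reduced_I (\<nu> + 1) x"
     "reduced_K \<nu>" "\<lambda>x. - x * reduced_K (\<nu> + 1) x" "reduced_I \<nu> 0" \<beta> "\<lambda>x. h x - Eh" by (rule half_pos)
  interpret N: stein_half "2 * \<nu> + 1" "reduced_I \<nu>" "\<lambda>x. x * reduced_I (\<nu> + 1) x"
     "reduced_K \<nu>" "\<lambda>x. - x * reduced_K (\<nu> + 1) x" "reduced_I \<nu> 0" "- \<beta>" "\<lambda>x. h (- x) - Eh" by (rule half_neg)
  \<comment> \<open>\<open>B\<close> at 0 is the integral over the whole half-line, so splitting the
    vanishing total integral at 0 yields the matching condition.\<close>
  have B0: "P.B 0 = - N.B 0"
    using LBINT_split_zero[OF int_\<kappa>h zero, of "ereal 0"]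
      LBINT_eq_B[OF half_pos int_\<kappa>h order_refl] LBINT_eq_B[OF half_neg int_\<kappa>h' order_refl]
    by simp
  interpret L: stein_line "2 * \<nu> + 1" "reduced_I \<nu>" "\<lambda>x. x * reduced_I (\<nu> + 1) x"
     "reduced_K \<nu>" "\<lambda>x. - x * reduced_K (\<nu> + 1) x" "reduced_I \<nu> 0" \<beta> h Eh \<nu>
  proof unfold_locales
    show "P.F0 = - N.F0" using B0 unfolding P.F0_def N.F0_def P.B_def N.B_def by simp
  qed (use half_pos half_neg in auto)
  have formula: "vg_stein_formula \<nu> \<beta> h Eh x = L.f x" if "x \<noteq> 0" for x
    using vg_stein_formula_pos[OF \<nu> half_pos h int_\<kappa>h, of x]
      vg_stein_formula_neg[OF \<nu> half_neg h int_\<kappa>h zero, of x] that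
    by (cases "x > 0") (auto simp: L.f_def)
  \<comment> \<open>The value at 0 was fixed as a limit of the formula; the formula agrees with the
    continuous \<open>L.f\<close> off 0, so this limit exists and equals
    \<open>L.f 0\<close>.\<close>
  have "(vg_stein_formula \<nu> \<beta> h Eh \<longlongrightarrow> L.f 0) (at 0)"
  proof (rule Lim_transform_eventually)
    show "(L.f \<longlongrightarrow> L.f 0) (at 0)" using L.f_isCont[of 0] by (simp add: isCont_def)
    show "eventually (\<lambda>x. L.f x = vg_stein_formula \<nu> \<beta> h Eh x) (at 0)"
      by (simp add: eventually_at_filter formula)
  qed
  hence "Lim (at 0) (vg_stein_formula \<nu> \<beta> h Eh) = L.f 0" by (intro tendsto_Lim) auto
  hence f: "f = L.f" unfolding assms(9) by (auto simp: vg_stein_sol_def formula fun_eq_iff)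
  show ?thesis
    unfolding f
  proof (intro conjI allI impI; (elim conjE)?)
    show "vg_stein_solution \<nu> \<beta> h Eh L.f" by (rule L.f_solution)
    show "u = L.f" if "bounded (range h)" "0 \<le> \<nu>" "vg_stein_solution \<nu> \<beta> h Eh u" "bounded (range u)" for u
      using P.vg_stein_solution_unique[of \<nu> \<beta> h Eh u L.f] that L.f_solution L.f_bounded(1) \<beta> by simp
  qed (use L.f_classical L.f_bounded in blast)+
qed

end
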